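(* Let $(\Lambda_t)_{t\ge0}$ be a family of CPTP maps on $d\times d$ density matrices ($d\ge2$ finite), with $\Lambda_0=\mathrm{id}$ and $t\mapsto\Lambda_t$ differentiable, which is non-Markovian. Suppose either (i) every $\Lambda_t$ is invertible as a linear map on $d\times d$ matrices, or (ii) $d=2$ (in which case invertibility is not required). Then there exist finite-dimensional systems $B$ and $C$ and a state $\rho^{ABC}$ on $\mathbb{C}^d\otimes\mathcal H_B\otimes\mathcal H_C$ such that for some $t>0$ $$\frac{\mathrm d}{\mathrm dt}E^{AB|C}\big((\Lambda_t^A\otimes\mathrm{id}^{BC})[\rho^{ABC}]\big)>0$$ (understood as the right derivative), so that the negativity $E^{AB|C}$ of the evolved state strictly increases at some time.
   Context: Negativity of a bipartite operator $X$ on $\mathcal H_{X_1}\otimes\mathcal H_{X_2}$ with respect to the cut $X_1|X_2$ is $E^{X_1|X_2}(X)=\frac{\|X^{T_{X_2}}\|_1-1}{2}$, where $T_{X_2}$ is the partial transpose on $X_2$ and $\|M\|_1=\mathrm{Tr}\sqrt{M^\dagger M}$. Here $E^{AB|C}$ treats $AB$ as one party and $C$ as the other. An evolution $(\Lambda_t)$ is Markovian (CP-divisible) if for every $0\le s\le t$ there is a CPTP map $V_{t,s}$ with $\Lambda_t=V_{t,s}\circ\Lambda_s$; otherwise it is non-Markovian. $\Lambda_t^A\otimes\mathrm{id}^{BC}$ means $\Lambda_t$ acting on the system $A=\mathbb{C}^d$ only. *)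

theory Defs
  imports Complex_Main "Jordan_Normal_Form.Matrix"
begin

definition mtrace :: "complex mat \<Rightarrow> complex" where
  "mtrace A = (\<Sum>i<dim_row A. A $$ (i,i))"

definition adj :: "complex mat \<Rightarrow> complex mat" where
  "adj A = mat (dim_col A) (dim_row A) (\<lambda>(i,j). cnj (A $$ (j,i)))"

definition psd :: "nat \<Rightarrow> complex mat \<Rightarrow> bool" where
  "psd n A \<longleftrightarrow> A \<in> carrier_mat n n \<and> adj A = A \<and>
     (\<forall>v :: nat \<Rightarrow> complex. 0 \<le> Re (\<Sum>i<n. \<Sum>j<n. cnj (v i) * A $$ (i,j) * v j))"

definition density :: "nat \<Rightarrow> complex mat \<Rightarrow> bool" where
  "density n \<rho> \<longleftrightarrow> psd n \<rho> \<and> mtrace \<rho> = 1"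

definition trace_norm :: "complex mat \<Rightarrow> real" where
  "trace_norm X = Re (mtrace (THE S. psd (dim_col X) S \<and> S * S = adj X * X))"

(* partial transpose on the second factor of C^n1 (x) C^n2,
   basis index (i1,i2) |-> i1*n2 + i2 *)
definition partial_transpose2 :: "nat \<Rightarrow> nat \<Rightarrow> complex mat \<Rightarrow> complex mat" where
  "partial_transpose2 n1 n2 X = mat (n1*n2) (n1*n2)
     (\<lambda>(i,j). X $$ ((i div n2) * n2 + j mod n2, (j div n2) * n2 + i mod n2))"

definition negativity :: "nat \<Rightarrow> nat \<Rightarrow> complex mat \<Rightarrow> real" where
  "negativity n1 n2 X = (trace_norm (partial_transpose2 n1 n2 X) - 1) / 2"

(* (Phi (x) id_m) for a map Phi on d x d matrices acting on the first factor of
   C^d (x) C^m, basis index (a,k) |-> a*m + k *)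
definition ampl :: "(complex mat \<Rightarrow> complex mat) \<Rightarrow> nat \<Rightarrow> nat \<Rightarrow> complex mat \<Rightarrow> complex mat" where
  "ampl \<Phi> d m X = mat (d*m) (d*m)
     (\<lambda>(i,j). \<Phi> (mat d d (\<lambda>(x,y). X $$ (x*m + i mod m, y*m + j mod m))) $$ (i div m, j div m))"

definition linear_map_on :: "nat \<Rightarrow> (complex mat \<Rightarrow> complex mat) \<Rightarrow> bool" where
  "linear_map_on d \<Phi> \<longleftrightarrow>
     (\<forall>X \<in> carrier_mat d d. \<Phi> X \<in> carrier_mat d d) \<and>
     (\<forall>X \<in> carrier_mat d d. \<forall>Y \<in> carrier_mat d d. \<Phi> (X + Y) = \<Phi> X + \<Phi> Y) \<and>
     (\<forall>c. \<forall>X \<in> carrier_mat d d. \<Phi> (c \<cdot>\<^sub>m X) = c \<cdot>\<^sub>m \<Phi> X)"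

definition CPTP :: "nat \<Rightarrow> (complex mat \<Rightarrow> complex mat) \<Rightarrow> bool" where
  "CPTP d \<Phi> \<longleftrightarrow> linear_map_on d \<Phi> \<and>
     (\<forall>m>0. \<forall>X. psd (d*m) X \<longrightarrow> psd (d*m) (ampl \<Phi> d m X)) \<and>
     (\<forall>X \<in> carrier_mat d d. mtrace (\<Phi> X) = mtrace X)"

definition markovian :: "nat \<Rightarrow> (real \<Rightarrow> complex mat \<Rightarrow> complex mat) \<Rightarrow> bool" where
  "markovian d \<Lambda> \<longleftrightarrow> (\<forall>s t. 0 \<le> s \<and> s \<le> t \<longrightarrow>
     (\<exists>V. CPTP d V \<and> (\<forall>X \<in> carrier_mat d d. \<Lambda> t X = V (\<Lambda> s X))))"

end

theory Submission
  imports Defs "Jordan_Normal_Form.Determinant" "HOL-Analysis.Elementary_Metric_Spaces"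
begin

text \<open>
  Mixing two positive operators \<open>P\<close>, \<open>N\<close> on \<open>A\<close> and an ancilla with the Bell states \<open>\<phi>\<^sub>+\<close>, \<open>\<phi>\<^sub>-\<close> shared
  by \<open>B\<close> and \<open>C\<close> gives a state whose negativity is, up to a positive factor, the trace norm of
  \<open>P - N\<close>, and \<open>P - N\<close> can be a positive multiple of any Hermitian \<open>X\<close>. Hence if the negativity
  never has a positive right derivative, \<open>\<parallel>(\<Lambda> t \<otimes> id) X\<parallel>\<close> is nonincreasing in \<open>t > 0\<close> for every
  Hermitian \<open>X\<close>: its right derivative always exists because the trace norm is convex and Lipschitz.

  If \<open>\<Lambda> s\<close> is invertible, \<open>V = \<Lambda> t \<circ> (\<Lambda> s)\<^sup>-\<^sup>1\<close> preserves the trace and is a trace norm contraction on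
  Hermitian operators at every level, so it is completely positive.

  For a qubit, let \<open>t1\<close> be the first time at which \<open>\<Lambda> t1\<close> is singular. The factors between times
  \<open>s < t1\<close> and \<open>t1\<close> accumulate at a singular channel fixing the range of \<open>\<Lambda> t1\<close>; no such channel exists
  if that range is three-dimensional, so from \<open>t1\<close> on the states are mapped into a line of the Bloch
  ball. For two qubit states the contraction property is sufficient for the existence of a channel
  (Alberti and Uhlmann).
\<close>

section \<open>Matrices, forms and traces\<close>

text \<open>A factor preserves the trace, and an operator whose trace norm does not exceed its trace
  is positive; this is how contraction turns into complete positivity. Without invertibility,
  contraction yields a well-defined map on the range of \<open>\<Lambda> s\<close> only, because
  kernels can only grow, and the obstacle is to extend that map to a channel on all operators. For a
  qubit the growth of kernels confines the problem: once dimension three is excluded at the first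
  singular time, all later ranges have dimension one or two. In dimension one the factor prepares a
  fixed state; in dimension two it has to send one given pair of pure states to another given pair
  of states, which is a question about overlaps of purifications. The trace norm is handled through
  compactness instead of diagonalisation: a unitary \<open>U\<close> maximising the real part of tr
  (U X) makes \<open>U * X\<close> the positive square root in the definition of the norm, and the
  norm becomes a maximum of real-linear functions of \<open>X\<close>.\<close>

definition qform :: "nat \<Rightarrow> complex mat \<Rightarrow> (nat \<Rightarrow> complex) \<Rightarrow> complex" where
  "qform n A v = (\<Sum>i<n. \<Sum>j<n. cnj (v i) * A $$ (i,j) * v j)"

definition herm :: "nat \<Rightarrow> complex mat \<Rightarrow> bool" where
  "herm n A \<longleftrightarrow> A \<in> carrier_mat n n \<and> adj A = A"

definition unitary :: "nat \<Rightarrow> complex mat \<Rightarrow> bool" where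
  "unitary n U \<longleftrightarrow> U \<in> carrier_mat n n \<and> adj U * U = 1\<^sub>m n"

lemma mult_index:
  assumes "A \<in> carrier_mat n m" "B \<in> carrier_mat m p" "i < n" "j < p"
  shows "(A * B) $$ (i,j) = (\<Sum>k<m. A $$ (i,k) * B $$ (k,j))"
  using assms by (auto simp: scalar_prod_def atLeast0LessThan)

declare index_mult_mat(1) [simp del]

lemma mult_square_carrier [simp]:
  "A \<in> carrier_mat n n \<Longrightarrow> B \<in> carrier_mat n n \<Longrightarrow> A * B \<in> carrier_mat n n"
  by (rule mult_carrier_mat)

lemma adj_carrier [simp]: "A \<in> carrier_mat n m \<Longrightarrow> adj A \<in> carrier_mat m n"
  by (auto simp: adj_def)

lemma adj_index [simp]:
  "A \<in> carrier_mat n m \<Longrightarrow> i < m \<Longrightarrow> j < n \<Longrightarrow> adj A $$ (i,j) = cnj (A $$ (j,i))"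
  by (auto simp: adj_def)

lemma adj_adj: "A \<in> carrier_mat n m \<Longrightarrow> adj (adj A) = A"
  by (intro eq_matI) (auto simp: adj_def)

lemma adj_mult:
  assumes "A \<in> carrier_mat n m" "B \<in> carrier_mat m p"
  shows "adj (A * B) = adj B * adj A"
proof (intro eq_matI)
  fix i j assume "i < dim_row (adj B * adj A)" "j < dim_col (adj B * adj A)"
  then have "i < p" "j < n" using assms by (auto simp: adj_def)
  then show "adj (A * B) $$ (i,j) = (adj B * adj A) $$ (i,j)"
    using assms by (simp add: adj_index[of _ n p] mult_index[of _ p m _ n] mult_index[of _ n m _ p]
        adj_index[of _ n m] adj_index[of _ m p] mult.commute)
qed (use assms in \<open>auto simp: adj_def\<close>)

lemma adj_add: "A \<in> carrier_mat n m \<Longrightarrow> B \<in> carrier_mat n m \<Longrightarrow> adj (A + B) = adj A + adj B"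
  by (intro eq_matI) (auto simp: adj_def)

lemma adj_minus: "A \<in> carrier_mat n m \<Longrightarrow> B \<in> carrier_mat n m \<Longrightarrow> adj (A - B) = adj A - adj B"
  by (intro eq_matI) (auto simp: adj_def)

lemma adj_smult: "adj (c \<cdot>\<^sub>m A) = cnj c \<cdot>\<^sub>m adj A"
  by (intro eq_matI) (auto simp: adj_def)

lemma adj_one [simp]: "adj (1\<^sub>m n) = 1\<^sub>m n"
  by (intro eq_matI) (auto simp: adj_def)

lemma herm_iff:
  "herm n A \<longleftrightarrow> A \<in> carrier_mat n n \<and> (\<forall>i<n. \<forall>j<n. cnj (A $$ (i,j)) = A $$ (j,i))"
  (is "?L \<longleftrightarrow> ?R")
proof
  assume ?L
  then show ?R unfolding herm_def by (metis adj_index)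
next
  assume R: ?R
  then show ?L unfolding herm_def by (auto intro!: eq_matI simp: adj_def)
qed

lemma herm_index: "herm n A \<Longrightarrow> i < n \<Longrightarrow> j < n \<Longrightarrow> cnj (A $$ (i,j)) = A $$ (j,i)"
  by (simp add: herm_iff)

lemma herm_add: "herm n A \<Longrightarrow> herm n B \<Longrightarrow> herm n (A + B)"
  by (auto simp: herm_def adj_add)

lemma herm_minus: "herm n A \<Longrightarrow> herm n B \<Longrightarrow> herm n (A - B)"
  unfolding herm_def by (metis adj_minus minus_carrier_mat)

lemma herm_smult: "herm n A \<Longrightarrow> herm n (complex_of_real c \<cdot>\<^sub>m A)"
  by (auto simp: herm_def adj_smult)

lemma herm_one: "herm n (1\<^sub>m n)"
  by (auto simp: herm_def)

lemma herm_decomp: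
  assumes "X \<in> carrier_mat n n"
  obtains A B where "herm n A" "herm n B" "X = A + \<i> \<cdot>\<^sub>m B"
proof
  show "herm n (mat n n (\<lambda>(i,j). (X $$ (i,j) + cnj (X $$ (j,i))) / 2))"
    by (auto simp: herm_iff)
  show "herm n (mat n n (\<lambda>(i,j). (cnj (X $$ (j,i)) - X $$ (i,j)) * (\<i> / 2)))"
    by (auto simp: herm_iff algebra_simps)
  show "X = mat n n (\<lambda>(i,j). (X $$ (i,j) + cnj (X $$ (j,i))) / 2)
      + \<i> \<cdot>\<^sub>m mat n n (\<lambda>(i,j). (cnj (X $$ (j,i)) - X $$ (i,j)) * (\<i> / 2))"
    using assms by (intro eq_matI) (auto simp: field_simps)
qed

lemma mtrace_eq: "A \<in> carrier_mat n n \<Longrightarrow> mtrace A = (\<Sum>i<n. A $$ (i,i))"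
  by (auto simp: mtrace_def)

lemma mtrace_add: "A \<in> carrier_mat n n \<Longrightarrow> B \<in> carrier_mat n n \<Longrightarrow> mtrace (A + B) = mtrace A + mtrace B"
  by (simp add: mtrace_def sum.distrib[symmetric])

lemma mtrace_minus: "A \<in> carrier_mat n n \<Longrightarrow> B \<in> carrier_mat n n \<Longrightarrow> mtrace (A - B) = mtrace A - mtrace B"
  by (simp add: mtrace_def sum_subtractf[symmetric])

lemma mtrace_smult: "A \<in> carrier_mat n n \<Longrightarrow> mtrace (c \<cdot>\<^sub>m A) = c * mtrace A"
  by (simp add: mtrace_def sum_distrib_left)

lemma mtrace_one: "mtrace (1\<^sub>m n) = of_nat n"
  by (simp add: mtrace_def)

lemma mtrace_mult:
  assumes "A \<in> carrier_mat n n" "B \<in> carrier_mat n n"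
  shows "mtrace (A * B) = (\<Sum>i<n. \<Sum>j<n. A $$ (i,j) * B $$ (j,i))"
  using assms by (auto simp: mtrace_eq[of _ n] mult_index[of _ n n _ n] intro!: sum.cong)

lemma mtrace_comm:
  assumes "A \<in> carrier_mat n n" "B \<in> carrier_mat n n"
  shows "mtrace (A * B) = mtrace (B * A)"
  unfolding mtrace_mult[OF assms] mtrace_mult[OF assms(2,1)]
  by (subst sum.swap) (simp add: mult.commute)

lemma mtrace_herm_real: "herm n A \<Longrightarrow> Im (mtrace A) = 0"
  using herm_index[of n A] by (auto simp: herm_def mtrace_eq[of _ n] intro!: sum.neutral dest: arg_cong[of _ _ Im]) (metis cnj.simps(2) equal_neg_zero)

section \<open>Positive semidefinite matrices\<close>

lemma psd_iff: "psd n A \<longleftrightarrow> herm n A \<and> (\<forall>v. 0 \<le> Re (qform n A v))"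
  by (auto simp: psd_def herm_def qform_def)

lemma psd_carrier: "psd n A \<Longrightarrow> A \<in> carrier_mat n n"
  by (simp add: psd_def)

lemma qform_add: "A \<in> carrier_mat n n \<Longrightarrow> B \<in> carrier_mat n n \<Longrightarrow>
    qform n (A + B) v = qform n A v + qform n B v"
  by (simp add: qform_def sum.distrib[symmetric] algebra_simps)

lemma qform_smult: "A \<in> carrier_mat n n \<Longrightarrow> qform n (c \<cdot>\<^sub>m A) v = c * qform n A v"
  by (simp add: qform_def sum_distrib_left algebra_simps)

lemma qform_mult:
  assumes "A \<in> carrier_mat n n" "B \<in> carrier_mat n n"
  shows "qform n (A * B) v = (\<Sum>k<n. cnj (\<Sum>i<n. adj A $$ (k,i) * v i) * (\<Sum>j<n. B $$ (k,j) * v j))"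
proof -
  have "qform n (A * B) v = (\<Sum>i<n. \<Sum>j<n. \<Sum>k<n. cnj (v i) * A $$ (i,k) * (B $$ (k,j) * v j))"
    using assms by (simp add: qform_def mult_index[of _ n n _ n] sum_distrib_left sum_distrib_right algebra_simps)
  also have "\<dots> = (\<Sum>k<n. \<Sum>i<n. \<Sum>j<n. cnj (v i) * A $$ (i,k) * (B $$ (k,j) * v j))"
    by (subst (2) sum.swap, subst sum.swap) simp
  also have "\<dots> = (\<Sum>k<n. cnj (\<Sum>i<n. adj A $$ (k,i) * v i) * (\<Sum>j<n. B $$ (k,j) * v j))"
    using assms by (intro sum.cong refl) (simp add: sum_distrib_left sum_distrib_right algebra_simps adj_index[of _ n n])
  finally show ?thesis .
qed

lemma qform_conj_mult:
  assumes D: "D \<in> carrier_mat n n" and A: "A \<in> carrier_mat n n"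
  shows "qform n (adj D * A * D) v = qform n A (\<lambda>i. \<Sum>j<n. D $$ (i,j) * v j)"
proof -
  have "qform n (adj D * A * D) v = qform n (adj D * (A * D)) v"
    using assms by (simp add: assoc_mult_mat[of _ n n _ n _ n])
  also have "\<dots> = (\<Sum>k<n. cnj (\<Sum>i<n. D $$ (k,i) * v i) * (\<Sum>j<n. (A * D) $$ (k,j) * v j))"
    using assms by (simp add: qform_mult adj_adj[of D n n])
  also have "\<dots> = (\<Sum>k<n. cnj (\<Sum>i<n. D $$ (k,i) * v i) * (\<Sum>l<n. A $$ (k,l) * (\<Sum>j<n. D $$ (l,j) * v j)))"
  proof (rule sum.cong[OF refl], rule arg_cong2[where f="(*)", OF refl])
    fix k assume "k \<in> {..<n}"
    then have "(\<Sum>j<n. (A * D) $$ (k,j) * v j) = (\<Sum>j<n. \<Sum>l<n. A $$ (k,l) * (D $$ (l,j) * v j))"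
      using assms by (simp add: mult_index[of _ n n _ n] sum_distrib_right mult.assoc)
    also have "\<dots> = (\<Sum>l<n. A $$ (k,l) * (\<Sum>j<n. D $$ (l,j) * v j))"
      by (subst sum.swap) (simp add: sum_distrib_left)
    finally show "(\<Sum>j<n. (A * D) $$ (k,j) * v j) = (\<Sum>l<n. A $$ (k,l) * (\<Sum>j<n. D $$ (l,j) * v j))" .
  qed
  also have "\<dots> = qform n A (\<lambda>i. \<Sum>j<n. D $$ (i,j) * v j)"
    by (simp add: qform_def sum_distrib_left mult.assoc)
  finally show ?thesis .
qed

lemma psd_conj_mult:
  assumes D: "D \<in> carrier_mat n n" and A: "psd n A"
  shows "psd n (adj D * A * D)"
proof -
  have Ac: "A \<in> carrier_mat n n" and h: "adj A = A" using A by (auto simp: psd_def)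
  have "adj (adj D * A * D) = adj D * A * D"
    using D Ac by (simp add: adj_mult[of _ n n _ n] h adj_adj[of D n n] assoc_mult_mat[of _ n n _ n _ n])
  then show ?thesis
    using assms Ac by (auto simp: psd_iff herm_def qform_conj_mult)
qed

lemma psd_add: "psd n A \<Longrightarrow> psd n B \<Longrightarrow> psd n (A + B)"
  using herm_add[of n A B] by (auto simp: psd_iff qform_add herm_def)

lemma psd_smult: "psd n A \<Longrightarrow> 0 \<le> c \<Longrightarrow> psd n (complex_of_real c \<cdot>\<^sub>m A)"
  using herm_smult[of n A c] by (auto simp: psd_iff qform_smult herm_def)

lemma qform_two:
  assumes "i < n" "j < n" "i \<noteq> j"
  shows "qform n A (\<lambda>k. if k = i then x else if k = j then y else 0) =
    cnj x * A $$ (i,i) * x + cnj x * A $$ (i,j) * y + cnj y * A $$ (j,i) * x + cnj y * A $$ (j,j) * y"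
proof -
  have s: "(\<Sum>k<n. f k * (if k = i then x else if k = j then y else 0)) = f i * x + f j * y" for f :: "nat \<Rightarrow> complex"
  proof -
    have "(\<Sum>k<n. f k * (if k = i then x else if k = j then y else 0)) =
      (\<Sum>k<n. (if k = i then f k * x else 0) + (if k = j then f k * y else 0))"
      using assms(3) by (intro sum.cong) auto
    then show ?thesis using assms by (simp add: sum.distrib)
  qed
  have "qform n A (\<lambda>k. if k = i then x else if k = j then y else 0) =
     (\<Sum>k<n. cnj (if k = i then x else if k = j then y else 0) * (A $$ (k,i) * x + A $$ (k,j) * y))"
    unfolding qform_def by (simp add: mult.assoc sum_distrib_left[symmetric] s)
  also have "\<dots> = cnj (\<Sum>k<n. cnj (A $$ (k,i) * x + A $$ (k,j) * y) * (if k = i then x else if k = j then y else 0))"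
    by (simp add: mult.commute)
  also have "\<dots> = cnj x * A $$ (i,i) * x + cnj x * A $$ (i,j) * y + cnj y * A $$ (j,i) * x + cnj y * A $$ (j,j) * y"
    unfolding s by (simp add: algebra_simps)
  finally show ?thesis .
qed

lemma qform_unit:
  assumes "i < n"
  shows "qform n A (\<lambda>k. if k = i then x else 0) = cnj x * A $$ (i,i) * x"
proof -
  have "qform n A (\<lambda>k. if k = i then x else 0) =
    (\<Sum>k<n. \<Sum>l<n. if k = i then if l = i then cnj x * A $$ (i,i) * x else 0 else 0)"
    unfolding qform_def by (intro sum.cong refl) auto
  also have "\<dots> = (\<Sum>k<n. if k = i then cnj x * A $$ (i,i) * x else 0)"
    using assms by (intro sum.cong refl) auto
  finally show ?thesis using assms by simp
qed

lemma psd_diag: "psd n A \<Longrightarrow> i < n \<Longrightarrow> 0 \<le> Re (A $$ (i,i)) \<and> Im (A $$ (i,i)) = 0"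
  using qform_unit[of i n A 1] herm_index[of n A i i] unfolding psd_iff
  by (auto simp: complex_eq_iff) metis

lemma psd_mtrace: "psd n A \<Longrightarrow> 0 \<le> Re (mtrace A)"
  by (auto simp: mtrace_eq[OF psd_carrier] psd_diag intro!: sum_nonneg)

lemma psd_diag_le_mtrace:
  assumes "psd n A" "i < n" shows "Re (A $$ (i,i)) \<le> Re (mtrace A)"
  unfolding mtrace_eq[OF psd_carrier[OF assms(1)]] Re_sum
  by (rule member_le_sum) (use assms psd_diag in auto)

text \<open>Through this inequality the trace of a positive matrix controls every entry. It gives
  the vanishing of positive matrices of trace zero and the uniform bound behind the compactness of
  the set of channels.\<close>

lemma psd_offdiag:
  assumes A: "psd n A" and ij: "i < n" "j < n" "i \<noteq> j"
  shows "2 * cmod (A $$ (i,j)) \<le> Re (A $$ (i,i)) + Re (A $$ (j,j))"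
proof (cases "A $$ (i,j) = 0")
  case True
  then show ?thesis using psd_diag[OF A] ij by simp
next
  case False
  \<comment> \<open>The phase that turns both cross terms of the form at \<open>e_i + y e_j\<close>
    into \<open>- cmod (A $$ (i,j))\<close>.\<close>
  define y where "y = - cnj (A $$ (i,j)) / of_real (cmod (A $$ (i,j)))"
  have y: "cnj y * y = 1" "A $$ (i,j) * y = - of_real (cmod (A $$ (i,j)))"
    using False by (auto simp: y_def complex_norm_square power2_eq_square field_simps simp flip: of_real_mult)
      (metis complex_norm_square mult.commute power2_eq_square)+
  have ji: "A $$ (j,i) = cnj (A $$ (i,j))" using A ij herm_index[of n A i j] by (simp add: psd_iff)
  have y2: "cnj y * A $$ (j,i) = - of_real (cmod (A $$ (i,j)))"
    unfolding ji using arg_cong[OF y(2), of cnj] by (simp add: mult.commute)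
  have "qform n A (\<lambda>k. if k = i then 1 else if k = j then y else 0) =
     A $$ (i,i) + A $$ (i,j) * y + cnj y * A $$ (j,i) + (cnj y * y) * A $$ (j,j)"
    unfolding qform_two[OF ij] by (simp add: algebra_simps)
  moreover have "0 \<le> Re (qform n A (\<lambda>k. if k = i then 1 else if k = j then y else 0))"
    using A unfolding psd_iff by blast
  ultimately have "Re (A $$ (i,i) + A $$ (i,j) * y + cnj y * A $$ (j,i) + (cnj y * y) * A $$ (j,j)) \<ge> 0"
    by simp
  then show ?thesis unfolding y y2 by simp
qed

lemma psd_mtrace_zero:
  assumes A: "psd n A" and t: "Re (mtrace A) = 0"
  shows "A = 0\<^sub>m n n"
proof (intro eq_matI)
  have d: "Re (A $$ (i,i)) = 0" if "i < n" for i
    using psd_diag_le_mtrace[OF A that] psd_diag[OF A that] t by simp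
  fix i j assume "i < dim_row (0\<^sub>m n n)" "j < dim_col (0\<^sub>m n n)"
  then have ij: "i < n" "j < n" by auto
  show "A $$ (i,j) = 0\<^sub>m n n $$ (i,j)"
    using ij psd_offdiag[OF A ij] d psd_diag[OF A] by (cases "i = j") (auto simp: complex_eq_iff)
qed (use psd_carrier[OF A] in auto)

lemma psd_entry_bound:
  assumes A: "psd n A" and ij: "i < n" "j < n"
  shows "cmod (A $$ (i,j)) \<le> Re (mtrace A)"
proof (cases "i = j")
  case True
  then show ?thesis using psd_diag[OF A ij(1)] psd_diag_le_mtrace[OF A ij(1)]
    by (simp add: cmod_eq_Re)
next
  case False
  then show ?thesis using psd_offdiag[OF A ij] psd_diag_le_mtrace[OF A ij(1)] psd_diag_le_mtrace[OF A ij(2)]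
    by simp
qed

text \<open>Each diagonal entry of \<open>D * D\<close> is the sum of the squared moduli along a row
  of \<open>D\<close>.\<close>

lemma herm_square_zero:
  assumes D: "herm n D" and z: "D * D = 0\<^sub>m n n"
  shows "D = 0\<^sub>m n n"
proof (intro eq_matI)
  have Dc: "D \<in> carrier_mat n n" using D by (simp add: herm_def)
  fix i j assume "i < dim_row (0\<^sub>m n n)" "j < dim_col (0\<^sub>m n n)"
  then have ij: "i < n" "j < n" by auto
  have "0 = (D * D) $$ (i,i)" using ij z by simp
  also have "\<dots> = (\<Sum>k<n. D $$ (i,k) * cnj (D $$ (i,k)))"
    using ij Dc by (simp add: mult_index[of _ n n _ n] herm_index[OF D] del: index_mult_mat)
  also have "\<dots> = of_real (\<Sum>k<n. (cmod (D $$ (i,k)))\<^sup>2)"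
    by (simp add: complex_norm_square del: of_real_power)
  finally have "(\<Sum>k<n. (cmod (D $$ (i,k)))\<^sup>2) = 0" by (metis of_real_eq_0_iff)
  then have "(cmod (D $$ (i,j)))\<^sup>2 = 0" using ij by (subst (asm) sum_nonneg_eq_0_iff) auto
  then show "D $$ (i,j) = 0\<^sub>m n n $$ (i,j)" using ij by simp
qed (use D in \<open>auto simp: herm_def\<close>)

text \<open>With \<open>D = A - B\<close>, the identity \<open>A\<^sup>2 = B\<^sup>2\<close> reads \<open>A D + D B = 0\<close>, so the nonnegative numbers
  \<open>tr (D A D)\<close> and \<open>tr (D B D)\<close> add up to zero; hence \<open>D A D = D B D = 0\<close> and \<open>D\<^sup>3 = 0\<close>.\<close>

lemma psd_sqrt_unique:
  assumes A: "psd n A" and B: "psd n B" and eq: "A * A = B * B"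
  shows "A = B"
proof -
  have Ac [simp]: "A \<in> carrier_mat n n" and Bc [simp]: "B \<in> carrier_mat n n"
    using A B by (auto simp: psd_def)
  define D where "D = A - B"
  have Dh: "herm n D" using A B unfolding D_def psd_iff by (blast intro: herm_minus)
  then have Dc [simp]: "D \<in> carrier_mat n n" and Da: "adj D = D" by (auto simp: herm_def)
  note as = assoc_mult_mat[of _ n n _ n _ n]
  have "A * D + D * B = (A * A - A * B) + (A * B - B * B)"
    unfolding D_def by (simp add: mult_minus_distrib_mat[of _ n n _ n] minus_mult_distrib_mat[of _ n n _ _ n])
  also have "\<dots> = 0\<^sub>m n n" unfolding eq
    using carrier_matD[OF Ac] carrier_matD[OF Bc] by (intro eq_matI) auto
  finally have z: "A * D + D * B = 0\<^sub>m n n" .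
  have "mtrace (D * B * D) = mtrace (D * (D * B))" by (rule mtrace_comm[of _ n]) auto
  then have "mtrace (D * A * D) + mtrace (D * B * D) = mtrace (D * (A * D)) + mtrace (D * (D * B))"
    by (simp only: as[OF Dc Ac Dc])
  also have "\<dots> = mtrace (D * (A * D) + D * (D * B))"
    by (rule mtrace_add[symmetric]) (auto intro!: mult_carrier_mat[of _ n n _ n])
  also have "\<dots> = mtrace (D * (A * D + D * B))"
    by (subst mult_add_distrib_mat[of _ n n _ n]) (auto intro!: mult_carrier_mat[of _ n n _ n])
  also have "\<dots> = 0" unfolding z right_mult_zero_mat[OF Dc] by (simp add: mtrace_def)
  finally have t: "mtrace (D * A * D) + mtrace (D * B * D) = 0" .
  have p: "psd n (D * A * D)" "psd n (D * B * D)"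
    using psd_conj_mult[OF Dc A] psd_conj_mult[OF Dc B] by (simp_all add: Da)
  have "Re (mtrace (D * A * D)) = 0" "Re (mtrace (D * B * D)) = 0"
    using psd_mtrace[OF p(1)] psd_mtrace[OF p(2)] arg_cong[OF t, of Re] by auto
  then have z2: "D * A * D = 0\<^sub>m n n" "D * B * D = 0\<^sub>m n n"
    using psd_mtrace_zero p by blast+
  have "D * D * D = D * A * D - D * B * D"
    by (subst (2) D_def) (simp add: mult_minus_distrib_mat[of _ n n _ n] minus_mult_distrib_mat[of _ n n _ _ n] mult_carrier_mat[of _ n n _ n])
  also have "\<dots> = 0\<^sub>m n n" unfolding z2 by (intro eq_matI) auto
  finally have d3: "D * D * D = 0\<^sub>m n n" .
  have "herm n (D * D)" using Dc by (simp add: herm_def adj_mult[of _ n n _ n] Da mult_carrier_mat[of _ n n _ n])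
  moreover have "(D * D) * (D * D) = (D * D * D) * D" by (simp add: as mult_carrier_mat[of _ n n _ n])
  then have "(D * D) * (D * D) = 0\<^sub>m n n" unfolding d3 using Dc by (simp only: left_mult_zero_mat)
  ultimately have "D * D = 0\<^sub>m n n" by (rule herm_square_zero)
  then have "D = 0\<^sub>m n n" by (rule herm_square_zero[OF Dh])
  then have e: "(A - B) $$ (i,j) = 0" if "i < n" "j < n" for i j using that by (simp add: D_def)
  show ?thesis
  proof (intro eq_matI)
    fix i j assume "i < dim_row B" "j < dim_col B"
    then show "A $$ (i,j) = B $$ (i,j)" using e[of i j] carrier_matD[OF Ac] carrier_matD[OF Bc] by auto
  qed (use carrier_matD[OF Ac] carrier_matD[OF Bc] in auto)
qed

text \<open>Polarisation: the vector \<open>e_i + e_j\<close> compares the imaginary parts of two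
  opposite entries, and \<open>e_i + \<i> e_j\<close> their real parts.\<close>

lemma herm_if_qform_real:
  assumes Ac: "A \<in> carrier_mat n n" and r: "\<And>v. Im (qform n A v) = 0"
  shows "herm n A"
proof -
  have d: "Im (A $$ (i,i)) = 0" if "i < n" for i
    using r[of "\<lambda>k. if k = i then 1 else 0"] qform_unit[OF that, of A 1] by simp
  have "cnj (A $$ (i,j)) = A $$ (j,i)" if ij: "i < n" "j < n" for i j
  proof (cases "i = j")
    case True then show ?thesis using d[OF ij(1)] by (simp add: complex_eq_iff)
  next
    case False
    have "Im (A $$ (i,j) + A $$ (j,i)) = 0"
      using r[of "\<lambda>k. if k = i then 1 else if k = j then 1 else 0"]
        qform_two[OF ij False, of A 1 1] d[OF ij(1)] d[OF ij(2)] by simp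
    moreover have "Re (A $$ (i,j)) - Re (A $$ (j,i)) = 0"
      using r[of "\<lambda>k. if k = i then 1 else if k = j then \<i> else 0"]
        qform_two[OF ij False, of A 1 \<i>] d[OF ij(1)] d[OF ij(2)] by simp
    ultimately show ?thesis by (auto simp: complex_eq_iff)
  qed
  then show ?thesis using Ac by (simp add: herm_iff)
qed

lemma qform_one: "qform n (1\<^sub>m n) v = of_real (\<Sum>i<n. (cmod (v i))\<^sup>2)"
proof -
  have "qform n (1\<^sub>m n) v = (\<Sum>i<n. \<Sum>j<n. if j = i then cnj (v i) * v i else 0)"
    unfolding qform_def by (intro sum.cong refl) auto
  then show ?thesis by (simp add: complex_norm_square mult.commute del: of_real_power)
qed

lemma psd_one: "psd n (1\<^sub>m n)"
  by (auto simp: psd_iff herm_one qform_one intro: sum_nonneg)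

lemma qform_bound:
  "cmod (qform n A v) \<le> (\<Sum>i<n. \<Sum>j<n. cmod (A $$ (i,j))) * (\<Sum>i<n. (cmod (v i))\<^sup>2)"
proof -
  let ?S = "\<Sum>i<n. (cmod (v i))\<^sup>2"
  have le: "cmod (v i) * cmod (v j) \<le> ?S" if "i < n" "j < n" for i j
  proof (cases "i = j")
    case True
    then show ?thesis using that member_le_sum[of i "{..<n}" "\<lambda>i. (cmod (v i))\<^sup>2"] by (simp add: power2_eq_square)
  next
    case False
    have "2 * (cmod (v i) * cmod (v j)) \<le> (cmod (v i))\<^sup>2 + (cmod (v j))\<^sup>2"
      using sum_squares_bound[of "cmod (v i)" "cmod (v j)"] by simp
    also have "\<dots> = (\<Sum>k\<in>{i,j}. (cmod (v k))\<^sup>2)" using False by simp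
    also have "\<dots> \<le> ?S" using that by (intro sum_mono2) auto
    finally have "2 * (cmod (v i) * cmod (v j)) \<le> ?S" .
    moreover have "0 \<le> cmod (v i) * cmod (v j)" by simp
    ultimately show ?thesis by linarith
  qed
  have "cmod (qform n A v) \<le> (\<Sum>i<n. \<Sum>j<n. cmod (A $$ (i,j)) * (cmod (v i) * cmod (v j)))"
    unfolding qform_def by (intro sum_norm_le order_trans[OF norm_sum]) (simp add: norm_mult sum_mono algebra_simps)
  also have "\<dots> \<le> (\<Sum>i<n. \<Sum>j<n. cmod (A $$ (i,j)) * ?S)"
    using le by (intro sum_mono mult_left_mono) auto
  finally show ?thesis by (simp add: sum_distrib_right)
qed

text \<open>The form of \<open>X\<close> is bounded by the sum of the moduli of its entries, so a
  large multiple of the identity dominates it. Hermitian operators thereby become differences of two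
  positive ones, the second being a multiple of the identity.\<close>

lemma psd_shift:
  assumes X: "herm n X"
  obtains c where "c > 0" "psd n (X + complex_of_real c \<cdot>\<^sub>m 1\<^sub>m n)"
proof
  \<comment> \<open>The summand 1 keeps \<open>c\<close> positive for \<open>X = 0\<close> as
    well.\<close>
  define c where "c = (\<Sum>i<n. \<Sum>j<n. cmod (X $$ (i,j))) + 1"
  show "c > 0" unfolding c_def by (intro add_nonneg_pos sum_nonneg) auto
  have Xc: "X \<in> carrier_mat n n" using X by (simp add: herm_def)
  have "0 \<le> Re (qform n (X + complex_of_real c \<cdot>\<^sub>m 1\<^sub>m n) v)" for v
  proof -
    let ?S = "\<Sum>i<n. (cmod (v i))\<^sup>2"
    have "- Re (qform n X v) \<le> cmod (qform n X v)" using abs_Re_le_cmod[of "qform n X v"] by linarith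
    also have "\<dots> \<le> (c - 1) * ?S" using qform_bound[of n X v] by (simp add: c_def)
    also have "\<dots> \<le> c * ?S" by (intro mult_right_mono sum_nonneg) auto
    finally show ?thesis using Xc by (simp add: qform_add qform_smult qform_one del: of_real_sum)
  qed
  then show "psd n (X + complex_of_real c \<cdot>\<^sub>m 1\<^sub>m n)"
    using X by (auto simp: psd_iff intro!: herm_add herm_smult herm_one)
qed

section \<open>Compactness\<close>

lemma bounded_complex_subseq:
  fixes f :: "nat \<Rightarrow> complex"
  assumes "\<And>n. cmod (f n) \<le> C"
  obtains r l where "strict_mono r" "(\<lambda>n. f (r n)) \<longlonglongrightarrow> l"
proof -
  obtain r where r: "strict_mono r" "monoseq (\<lambda>n. Re (f (r n)))"
    using seq_monosub[of "\<lambda>n. Re (f n)"] by auto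
  obtain q where q: "strict_mono q" "monoseq (\<lambda>n. Im (f (r (q n))))"
    using seq_monosub[of "\<lambda>n. Im (f (r n))"] by auto
  have "Bseq (\<lambda>n. Re (f (r n)))" "Bseq (\<lambda>n. Im (f (r (q n))))"
    using order_trans[OF abs_Re_le_cmod assms] order_trans[OF abs_Im_le_cmod assms]
    by (auto intro!: BseqI'[of _ C])
  then obtain a b where "(\<lambda>n. Re (f (r n))) \<longlonglongrightarrow> a" "(\<lambda>n. Im (f (r (q n)))) \<longlonglongrightarrow> b"
    using Bseq_monoseq_convergent r q unfolding convergent_def by blast
  then have "(\<lambda>n. f (r (q n))) \<longlonglongrightarrow> Complex a b"
    using q(1) by (auto simp: tendsto_complex_iff dest: LIMSEQ_subseq_LIMSEQ simp: o_def)
  moreover have "strict_mono (\<lambda>n. r (q n))" using r q by (auto simp: strict_mono_def)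
  ultimately show ?thesis using that by blast
qed

text \<open>Passing to a subsequence one index at a time. Unitaries, normalised matrices and
  channels are all determined by finitely many bounded entries, so this is the compactness used for
  each of them.\<close>

lemma finite_family_subseq:
  fixes f :: "nat \<Rightarrow> 'i \<Rightarrow> complex"
  assumes "finite I" "\<And>n i. i \<in> I \<Longrightarrow> cmod (f n i) \<le> C"
  shows "\<exists>r l. strict_mono r \<and> (\<forall>i\<in>I. (\<lambda>n. f (r n) i) \<longlonglongrightarrow> l i)"
  using assms
proof (induction I rule: finite_induct)
  case empty
  then show ?case by (auto intro: exI[of _ id] strict_mono_id)
next
  case (insert x I)
  then obtain r l where r: "strict_mono r" "\<forall>i\<in>I. (\<lambda>n. f (r n) i) \<longlonglongrightarrow> l i" by auto
  obtain q a where q: "strict_mono q" "(\<lambda>n. f (r (q n)) x) \<longlonglongrightarrow> a"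
    using bounded_complex_subseq[of "\<lambda>n. f (r n) x" C] insert.prems by auto
  have "strict_mono (\<lambda>n. r (q n))" using r q by (auto simp: strict_mono_def)
  moreover have "(\<lambda>n. f (r (q n)) i) \<longlonglongrightarrow> (if i = x then a else l i)" if "i \<in> insert x I" for i
    using that q r(2) insert.hyps LIMSEQ_subseq_LIMSEQ[of "\<lambda>n. f (r n) i" "l i" q] by (auto simp: o_def)
  ultimately show ?case by (intro exI[of _ "\<lambda>n. r (q n)"] exI[of _ "\<lambda>i. if i = x then a else l i"]) auto
qed

section \<open>The trace norm as a maximum over unitaries\<close>

lemma unitary_iff:
  "unitary n U \<longleftrightarrow> U \<in> carrier_mat n n \<and>
    (\<forall>i<n. \<forall>j<n. (\<Sum>k<n. cnj (U $$ (k,i)) * U $$ (k,j)) = (if i = j then 1 else 0))"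
proof (cases "U \<in> carrier_mat n n")
  case True
  have e: "(adj U * U) $$ (i,j) = (\<Sum>k<n. cnj (U $$ (k,i)) * U $$ (k,j))" if "i < n" "j < n" for i j
    using True that by (simp add: mult_index[of _ n n _ n] adj_index[of _ n n])
  show ?thesis
  proof
    assume "unitary n U"
    then have "(adj U * U) $$ (i,j) = 1\<^sub>m n $$ (i,j)" for i j by (simp add: unitary_def)
    then show "U \<in> carrier_mat n n \<and>
      (\<forall>i<n. \<forall>j<n. (\<Sum>k<n. cnj (U $$ (k,i)) * U $$ (k,j)) = (if i = j then 1 else 0))"
      using True e by auto
  next
    assume R: "U \<in> carrier_mat n n \<and>
      (\<forall>i<n. \<forall>j<n. (\<Sum>k<n. cnj (U $$ (k,i)) * U $$ (k,j)) = (if i = j then 1 else 0))"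
    have "adj U * U = 1\<^sub>m n"
      by (rule eq_matI) (use R e True in \<open>auto simp: adj_def\<close>)
    then show "unitary n U" using True by (simp add: unitary_def)
  qed
qed (auto simp: unitary_def)

lemma unitary_carrier: "unitary n U \<Longrightarrow> U \<in> carrier_mat n n"
  by (simp add: unitary_def)

lemma unitary_entry:
  assumes U: "unitary n U" and ij: "i < n" "j < n"
  shows "cmod (U $$ (i,j)) \<le> 1"
proof -
  have "of_real (\<Sum>k<n. (cmod (U $$ (k,j)))\<^sup>2) = (\<Sum>k<n. cnj (U $$ (k,j)) * U $$ (k,j))"
    by (simp add: complex_norm_square mult.commute del: of_real_power)
  also have "\<dots> = of_real 1" using U ij by (auto simp: unitary_iff)
  finally have "(\<Sum>k<n. (cmod (U $$ (k,j)))\<^sup>2) = 1" by (simp only: of_real_eq_iff)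
  then have "(cmod (U $$ (i,j)))\<^sup>2 \<le> 1"
    using member_le_sum[of i "{..<n}" "\<lambda>k. (cmod (U $$ (k,j)))\<^sup>2"] ij by auto
  then show ?thesis by (simp add: abs_square_le_1[symmetric] abs_le_square_iff[symmetric] power2_le_imp_le)
qed

lemma unitary_one: "unitary n (1\<^sub>m n)"
  by (simp add: unitary_def)

lemma unitary_mult:
  assumes "unitary n U" "unitary n V" shows "unitary n (U * V)"
proof -
  have c: "U \<in> carrier_mat n n" "V \<in> carrier_mat n n" using assms by (auto simp: unitary_def)
  have "adj (U * V) * (U * V) = adj V * (adj U * U) * V"
    using c by (simp add: adj_mult[of _ n n _ n] assoc_mult_mat[of _ n n _ n _ n])
  then show ?thesis using assms c right_mult_one_mat[OF adj_carrier[OF c(2)]] by (simp add: unitary_def)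
qed

text \<open>The matrix multiplies the unit vector \<open>v\<close> by \<open>z\<close> and fixes its
  orthogonal complement. For \<open>z\<close> of modulus one, \<open>cnj (1 - z) * (1 - z)\<close>
  equals \<open>(1 - z) + cnj (1 - z)\<close>, which cancels the cross terms.\<close>

lemma rank_one_unitary:
  assumes v: "(\<Sum>i<n. (cmod (v i))\<^sup>2) = 1" and z: "cmod z = 1"
  shows "unitary n (mat n n (\<lambda>(i,j). (if i = j then 1 else 0) - (1 - z) * v i * cnj (v j)))"
    (is "unitary n ?R")
proof -
  have v': "(\<Sum>k<n. cnj (v k) * v k) = 1"
    using arg_cong[OF v, of complex_of_real] by (simp add: complex_norm_square mult.commute del: of_real_power)
  have zz: "cnj z * z = 1" using z complex_norm_square[of z] by (simp add: mult.commute)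
  have "(\<Sum>k<n. cnj (?R $$ (k,i)) * ?R $$ (k,j)) = (if i = j then 1 else 0)" if ij: "i < n" "j < n" for i j
  proof -
    have "(\<Sum>k<n. cnj (?R $$ (k,i)) * ?R $$ (k,j)) =
      (\<Sum>k<n. (if k = i then (if i = j then 1 else 0) else 0)
        - (if k = i then (1 - z) * v i * cnj (v j) else 0)
        - (if k = j then cnj (1 - z) * v i * cnj (v j) else 0)
        + cnj (1 - z) * (1 - z) * v i * cnj (v j) * (cnj (v k) * v k))"
      using ij by (intro sum.cong refl) (auto simp: algebra_simps)
    also have "\<dots> = (if i = j then 1 else 0) - (1 - z) * v i * cnj (v j)
        - cnj (1 - z) * v i * cnj (v j) + cnj (1 - z) * (1 - z) * v i * cnj (v j) * (\<Sum>k<n. cnj (v k) * v k)"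
      using ij by (simp add: sum.distrib sum_subtractf sum_distrib_left)
    also have "\<dots> = (if i = j then 1 else 0)
        + (cnj (1 - z) * (1 - z) - (1 - z) - cnj (1 - z)) * (v i * cnj (v j))"
      unfolding v' by (simp add: algebra_simps)
    also have "cnj (1 - z) * (1 - z) - (1 - z) - cnj (1 - z) = 0"
      using zz by (simp add: algebra_simps)
    finally show ?thesis by simp
  qed
  then show ?thesis by (simp add: unitary_iff)
qed

lemma qform_scale: "qform n A (\<lambda>i. of_real c * v i) = of_real (c\<^sup>2) * qform n A v"
  by (simp add: qform_def sum_distrib_left power2_eq_square algebra_simps)

text \<open>It suffices to test with the unitaries \<open>1 - (1 - z) v v\<^sup>*\<close>, where \<open>v\<close> is a unit vector and
  \<open>z\<close> has modulus one.\<close>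

lemma psd_if_trace_max:
  assumes S: "S \<in> carrier_mat n n"
    and mx: "\<And>V. unitary n V \<Longrightarrow> Re (mtrace (V * S)) \<le> Re (mtrace S)"
  shows "psd n S"
proof -
  have unit: "cmod (qform n S v) \<le> Re (qform n S v)" if v: "(\<Sum>i<n. (cmod (v i))\<^sup>2) = 1" for v
  proof (cases "qform n S v = 0")
    case False
    \<comment> \<open>With this phase the rank one change replaces \<open>qform n S v\<close> inside
      the trace by its modulus, and maximality of tr S forces the modulus below the real
      part.\<close>
    define z where "z = cnj (qform n S v) / of_real (cmod (qform n S v))"
    define R where "R = mat n n (\<lambda>(i,j). (if i = j then 1 else 0) - (1 - z) * v i * cnj (v j))"
    have z: "cmod z = 1" using False by (simp add: z_def norm_divide)
    have R: "unitary n R" unfolding R_def by (rule rank_one_unitary[OF v z])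
    have zs: "z * qform n S v = of_real (cmod (qform n S v))"
      using False complex_norm_square[of "qform n S v"] by (simp add: z_def field_simps power2_eq_square)
    have "mtrace (R * S) = (\<Sum>i<n. \<Sum>j<n. (if j = i then S $$ (i,i) else 0) - (1 - z) * (v i * cnj (v j) * S $$ (j,i)))"
      unfolding mtrace_mult[OF unitary_carrier[OF R] S]
      by (intro sum.cong refl) (auto simp: R_def algebra_simps)
    also have "\<dots> = mtrace S - (1 - z) * (\<Sum>i<n. \<Sum>j<n. v i * cnj (v j) * S $$ (j,i))"
      using S by (simp add: sum_subtractf sum_distrib_left mtrace_eq[of _ n])
    also have "(\<Sum>i<n. \<Sum>j<n. v i * cnj (v j) * S $$ (j,i)) = qform n S v"
      unfolding qform_def by (subst sum.swap) (simp add: algebra_simps)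
    finally have "mtrace (R * S) = mtrace S - qform n S v + of_real (cmod (qform n S v))"
      using zs by (simp add: algebra_simps)
    with mx[OF R] show ?thesis by simp
  qed simp
  have all: "cmod (qform n S v) \<le> Re (qform n S v)" for v
  proof -
    define N where "N = (\<Sum>i<n. (cmod (v i))\<^sup>2)"
    have N0: "N \<ge> 0" by (simp add: N_def sum_nonneg)
    show ?thesis
    proof (cases "N = 0")
      case True
      then show ?thesis using qform_bound[of n S v] by (simp add: N_def)
    next
      case False
      define w where "w = (\<lambda>i. of_real (1 / sqrt N) * v i)"
      have "(\<Sum>i<n. (cmod (w i))\<^sup>2) = (\<Sum>i<n. (cmod (v i))\<^sup>2) / N"
        using N0 by (simp add: w_def norm_mult power_mult_distrib power_divide sum_divide_distrib norm_divide)
      also have "\<dots> = 1" using False by (simp add: N_def)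
      finally have "cmod (qform n S w) \<le> Re (qform n S w)" by (rule unit)
      moreover have "qform n S v = of_real N * qform n S w"
        using False N0 unfolding w_def qform_scale by (simp add: power_divide)
      ultimately show ?thesis using N0 by (simp add: norm_mult mult_left_mono)
    qed
  qed
  have "Im (qform n S v) = 0 \<and> 0 \<le> Re (qform n S v)" for v
  proof -
    have "0 \<le> Re (qform n S v)" using all[of v] norm_ge_zero order_trans by blast
    moreover have "Re (qform n S v) = cmod (qform n S v)"
      using all[of v] complex_Re_le_cmod[of "qform n S v"] by linarith
    then have "(Im (qform n S v))\<^sup>2 = 0"
      using cmod_power2[of "qform n S v"] by simp
    ultimately show ?thesis by simp
  qed
  then show ?thesis using S by (simp add: psd_iff herm_if_qform_real)
qed

text \<open>Uniqueness of the positive square root evaluates the definite description in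
  \<open>trace_norm\<close>, so exhibiting any positive root of \<open>adj X * X\<close>
  suffices.\<close>

lemma trace_norm_eqI:
  assumes X: "X \<in> carrier_mat n n" and S: "psd n S" and eq: "S * S = adj X * X"
  shows "trace_norm X = Re (mtrace S)"
proof -
  have "(THE S. psd (dim_col X) S \<and> S * S = adj X * X) = S"
    using X S eq psd_sqrt_unique[of n] by (intro the_equality) auto
  then show ?thesis by (simp add: trace_norm_def)
qed

lemma mtrace_mult_bound:
  assumes U: "unitary n U" and X: "X \<in> carrier_mat n n"
  shows "Re (mtrace (U * X)) \<le> (\<Sum>i<n. \<Sum>j<n. cmod (X $$ (i,j)))"
proof -
  have "Re (mtrace (U * X)) \<le> cmod (mtrace (U * X))" by (rule complex_Re_le_cmod)
  also have "\<dots> \<le> (\<Sum>i<n. \<Sum>j<n. cmod (X $$ (j,i)))"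
    unfolding mtrace_mult[OF unitary_carrier[OF U] X]
  proof (intro sum_norm_le)
    fix i j assume "i \<in> {..<n}" "j \<in> {..<n}"
    then show "cmod (U $$ (i,j) * X $$ (j,i)) \<le> cmod (X $$ (j,i))"
      using unitary_entry[OF U, of i j] by (simp add: norm_mult mult_left_le_one_le)
  qed
  also have "\<dots> = (\<Sum>i<n. \<Sum>j<n. cmod (X $$ (i,j)))" by (rule sum.swap)
  finally show ?thesis .
qed

text \<open>The entries of unitaries are bounded and the unitarity equations are closed, so a
  maximising sequence has a limit point that is again unitary.\<close>

lemma unitary_trace_max:
  assumes X: "X \<in> carrier_mat n n"
  obtains U where "unitary n U" "\<And>V. unitary n V \<Longrightarrow> Re (mtrace (V * X)) \<le> Re (mtrace (U * X))"
proof -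
  define T where "T = (\<lambda>U. Re (mtrace (U * X))) ` {U. unitary n U}"
  have ne: "T \<noteq> {}" using unitary_one by (auto simp: T_def)
  have bd: "bdd_above T" using mtrace_mult_bound[OF _ X] by (auto simp: T_def bdd_above_def)
  have "\<exists>U. unitary n U \<and> Sup T - 1 / real (Suc k) < Re (mtrace (U * X))" for k
  proof -
    have "Sup T - 1 / real (Suc k) < Sup T" by simp
    then obtain y where "y \<in> T" "Sup T - 1 / real (Suc k) < y"
      using less_cSup_iff[OF ne bd] by blast
    then show ?thesis by (auto simp: T_def)
  qed
  then obtain W where W: "\<And>k. unitary n (W k)" "\<And>k. Sup T - 1 / real (Suc k) < Re (mtrace (W k * X))"
    by metis
  obtain r l where r: "strict_mono r" "\<forall>p\<in>{..<n}\<times>{..<n}. (\<lambda>k. W (r k) $$ p) \<longlonglongrightarrow> l p"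
    using finite_family_subseq[of "{..<n}\<times>{..<n}" "\<lambda>k p. W k $$ p" 1] unitary_entry[OF W(1)] by auto
  then have lim: "(\<lambda>k. W (r k) $$ (i,j)) \<longlonglongrightarrow> l (i,j)" if "i < n" "j < n" for i j using that by auto
  define U where "U = mat n n l"
  have Uc: "U \<in> carrier_mat n n" by (simp add: U_def)
  have "unitary n U" unfolding unitary_iff
  proof (intro conjI allI impI Uc)
    fix i j assume ij: "i < n" "j < n"
    have "(\<lambda>k. \<Sum>m<n. cnj (W (r k) $$ (m,i)) * W (r k) $$ (m,j)) \<longlonglongrightarrow> (\<Sum>m<n. cnj (l (m,i)) * l (m,j))"
      using ij by (intro tendsto_sum tendsto_mult tendsto_cnj lim) auto
    moreover have "(\<Sum>m<n. cnj (W (r k) $$ (m,i)) * W (r k) $$ (m,j)) = (if i = j then 1 else 0)" for k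
      using W(1)[of "r k"] ij by (auto simp: unitary_iff)
    ultimately have "(\<Sum>m<n. cnj (l (m,i)) * l (m,j)) = (if i = j then 1 else 0)"
      by (simp add: LIMSEQ_const_iff)
    then show "(\<Sum>m<n. cnj (U $$ (m,i)) * U $$ (m,j)) = (if i = j then 1 else 0)"
      using ij by (simp add: U_def)
  qed
  moreover have "Re (mtrace (V * X)) \<le> Re (mtrace (U * X))" if "unitary n V" for V
  proof -
    have "(\<lambda>k. mtrace (W (r k) * X)) \<longlonglongrightarrow> mtrace (U * X)"
      unfolding mtrace_mult[OF unitary_carrier[OF W(1)] X] mtrace_mult[OF Uc X]
      by (intro tendsto_sum tendsto_mult tendsto_const) (auto simp: U_def intro: lim)
    then have "(\<lambda>k. Re (mtrace (W (r k) * X))) \<longlonglongrightarrow> Re (mtrace (U * X))" by (rule tendsto_Re)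
    moreover have "(\<lambda>k. Sup T - 1 / real (Suc (r k))) \<longlonglongrightarrow> Sup T - 0"
      using LIMSEQ_subseq_LIMSEQ[OF LIMSEQ_inverse_real_of_nat r(1)]
      by (intro tendsto_diff tendsto_const) (simp add: o_def inverse_eq_divide)
    ultimately have "Sup T - 0 \<le> Re (mtrace (U * X))"
      using W(2) by (intro LIMSEQ_le) (auto intro: less_imp_le)
    moreover have "Re (mtrace (V * X)) \<le> Sup T" using that bd by (auto simp: T_def intro: cSup_upper)
    ultimately show ?thesis by simp
  qed
  ultimately show ?thesis using that by blast
qed

text \<open>Polar decomposition by maximisation. If \<open>U\<close> is a maximiser for
  \<open>X\<close>, then the identity is one for \<open>U * X\<close>, because \<open>V * U\<close>
  is unitary whenever \<open>V\<close> is; hence \<open>U * X\<close> is positive. Being Hermitian,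
  it has the square \<open>adj (U * X) * (U * X) = adj X * X\<close>.\<close>

lemma trace_norm_attained:
  assumes X: "X \<in> carrier_mat n n"
  obtains U where "unitary n U" "psd n (U * X)" "trace_norm X = Re (mtrace (U * X))"
    "(U * X) * (U * X) = adj X * X"
    "\<And>V. unitary n V \<Longrightarrow> Re (mtrace (V * X)) \<le> trace_norm X"
proof -
  obtain U where U: "unitary n U" "\<And>V. unitary n V \<Longrightarrow> Re (mtrace (V * X)) \<le> Re (mtrace (U * X))"
    using unitary_trace_max[OF X] by blast
  have Uc: "U \<in> carrier_mat n n" using U(1) by (rule unitary_carrier)
  note as = assoc_mult_mat[of _ n n _ n _ n]
  have psd: "psd n (U * X)"
  proof (rule psd_if_trace_max)
    fix V assume V: "unitary n V"
    then have "V * (U * X) = (V * U) * X" using Uc X by (simp add: as unitary_carrier)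
    then show "Re (mtrace (V * (U * X))) \<le> Re (mtrace (U * X))"
      using U(2)[OF unitary_mult[OF V U(1)]] by simp
  qed (use Uc X in simp)
  have "(U * X) * (U * X) = adj (U * X) * (U * X)" using psd by (simp add: psd_def)
  also have "\<dots> = adj X * (adj U * U) * X" using Uc X by (simp add: adj_mult[of _ n n _ n] as)
  also have "\<dots> = adj X * X" using U(1) right_mult_one_mat[OF adj_carrier[OF X]] by (simp add: unitary_def)
  finally have sq: "(U * X) * (U * X) = adj X * X" .
  have "trace_norm X = Re (mtrace (U * X))" by (rule trace_norm_eqI[OF X psd sq])
  then show ?thesis using that[OF U(1) psd _ sq] U(2) by simp
qed

lemma trace_norm_ge:
  "X \<in> carrier_mat n n \<Longrightarrow> unitary n V \<Longrightarrow> Re (mtrace (V * X)) \<le> trace_norm X"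
  by (metis trace_norm_attained)

lemma trace_norm_nonneg: "X \<in> carrier_mat n n \<Longrightarrow> 0 \<le> trace_norm X"
  by (metis trace_norm_attained psd_mtrace)

lemma trace_norm_le_entries:
  "X \<in> carrier_mat n n \<Longrightarrow> trace_norm X \<le> (\<Sum>i<n. \<Sum>j<n. cmod (X $$ (i,j)))"
  by (metis trace_norm_attained mtrace_mult_bound)

text \<open>A unitary attaining the norm of the sum is admissible for either summand.\<close>

lemma trace_norm_triangle:
  assumes "X \<in> carrier_mat n n" "Y \<in> carrier_mat n n"
  shows "trace_norm (X + Y) \<le> trace_norm X + trace_norm Y"
proof -
  obtain U where U: "unitary n U" "trace_norm (X + Y) = Re (mtrace (U * (X + Y)))"
    using trace_norm_attained[of "X + Y" n] assms by auto
  have "U * (X + Y) = U * X + U * Y"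
    using assms unitary_carrier[OF U(1)] by (simp add: mult_add_distrib_mat[of _ n n _ n])
  then have "trace_norm (X + Y) = Re (mtrace (U * X)) + Re (mtrace (U * Y))"
    using assms unitary_carrier[OF U(1)] U(2) by (simp add: mtrace_add[of _ n])
  then show ?thesis using trace_norm_ge[OF assms(1) U(1)] trace_norm_ge[OF assms(2) U(1)] by simp
qed

lemma trace_norm_scale:
  assumes X: "X \<in> carrier_mat n n" and c: "0 \<le> c"
  shows "trace_norm (complex_of_real c \<cdot>\<^sub>m X) = c * trace_norm X"
proof -
  have cX: "complex_of_real c \<cdot>\<^sub>m X \<in> carrier_mat n n" using X by simp
  have e: "Re (mtrace (U * (complex_of_real c \<cdot>\<^sub>m X))) = c * Re (mtrace (U * X))" if "unitary n U" for U
    using X unitary_carrier[OF that] by (simp add: mult_smult_distrib[of _ n n _ n] mtrace_smult[of _ n])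
  obtain U where U: "unitary n U" "trace_norm X = Re (mtrace (U * X))"
    using trace_norm_attained[OF X] by metis
  obtain V where V: "unitary n V" "trace_norm (complex_of_real c \<cdot>\<^sub>m X) = Re (mtrace (V * (complex_of_real c \<cdot>\<^sub>m X)))"
    using trace_norm_attained[OF cX] by metis
  have "c * Re (mtrace (V * X)) \<le> c * trace_norm X"
    by (intro mult_left_mono c trace_norm_ge[OF X V(1)])
  moreover have "c * trace_norm X \<le> trace_norm (complex_of_real c \<cdot>\<^sub>m X)"
    using trace_norm_ge[OF cX U(1)] e[OF U(1)] U(2) by simp
  ultimately show ?thesis using V(2) e[OF V(1)] by linarith
qed

lemma trace_norm_lipschitz:
  assumes "X \<in> carrier_mat n n" "Y \<in> carrier_mat n n"
  shows "\<bar>trace_norm X - trace_norm Y\<bar> \<le> (\<Sum>i<n. \<Sum>j<n. cmod (X $$ (i,j) - Y $$ (i,j)))"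
proof -
  have a: "trace_norm A \<le> trace_norm B + (\<Sum>i<n. \<Sum>j<n. cmod (A $$ (i,j) - B $$ (i,j)))"
    if AB: "A \<in> carrier_mat n n" "B \<in> carrier_mat n n" for A B
  proof -
    have "A = B + (A - B)" using AB by (intro eq_matI) auto
    then have "trace_norm A \<le> trace_norm B + trace_norm (A - B)"
      using AB trace_norm_triangle[of B n "A - B"] by (metis minus_carrier_mat)
    moreover have "trace_norm (A - B) \<le> (\<Sum>i<n. \<Sum>j<n. cmod (A $$ (i,j) - B $$ (i,j)))"
      using trace_norm_le_entries[of "A - B" n] AB by (simp add: minus_carrier_mat)
    ultimately show ?thesis by simp
  qed
  have "(\<Sum>i<n. \<Sum>j<n. cmod (Y $$ (i,j) - X $$ (i,j))) = (\<Sum>i<n. \<Sum>j<n. cmod (X $$ (i,j) - Y $$ (i,j)))"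
    by (simp add: norm_minus_commute)
  then show ?thesis using a[OF assms] a[OF assms(2,1)] by simp
qed

lemma trace_norm_psd: "psd n X \<Longrightarrow> trace_norm X = Re (mtrace X)"
  by (rule trace_norm_eqI[of X n]) (auto simp: psd_def)

text \<open>Under the hypothesis the identity attains the maximum over unitaries. This is the
  passage from norm inequalities to positivity.\<close>

lemma psd_if_trace_norm_le:
  assumes X: "X \<in> carrier_mat n n" and le: "trace_norm X \<le> Re (mtrace X)"
  shows "psd n X"
  using trace_norm_ge[OF X] le by (intro psd_if_trace_max[OF X]) (meson order_trans)

lemma trace_norm_zero:
  assumes X: "X \<in> carrier_mat n n" and z: "trace_norm X = 0"
  shows "X = 0\<^sub>m n n"
proof -
  obtain U where U: "unitary n U" "psd n (U * X)" "trace_norm X = Re (mtrace (U * X))"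
    using trace_norm_attained[OF X] by metis
  then have "U * X = 0\<^sub>m n n" using z psd_mtrace_zero by simp
  then have "adj U * (U * X) = 0\<^sub>m n n" using right_mult_zero_mat[OF adj_carrier[OF unitary_carrier[OF U(1)]]] by simp
  moreover have "adj U * (U * X) = (adj U * U) * X"
    using X unitary_carrier[OF U(1)] by (simp add: assoc_mult_mat[of _ n n _ n _ n])
  ultimately show ?thesis using U(1) X by (simp add: unitary_def)
qed

lemma trace_norm_zero_mat: "trace_norm (0\<^sub>m n n) = 0"
  using trace_norm_le_entries[of "0\<^sub>m n n" n] trace_norm_nonneg[of "0\<^sub>m n n" n] by simp

section \<open>Amplifications of linear maps\<close>

lemma linear_map_onD:
  assumes "linear_map_on d \<Phi>"
  shows "X \<in> carrier_mat d d \<Longrightarrow> \<Phi> X \<in> carrier_mat d d"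
    and "X \<in> carrier_mat d d \<Longrightarrow> Y \<in> carrier_mat d d \<Longrightarrow> \<Phi> (X + Y) = \<Phi> X + \<Phi> Y"
    and "X \<in> carrier_mat d d \<Longrightarrow> \<Phi> (c \<cdot>\<^sub>m X) = c \<cdot>\<^sub>m \<Phi> X"
  using assms unfolding linear_map_on_def by blast+

lemma linear_map_on_minus:
  assumes L: "linear_map_on d \<Phi>" and X: "X \<in> carrier_mat d d" and Y: "Y \<in> carrier_mat d d"
  shows "\<Phi> (X - Y) = \<Phi> X - \<Phi> Y"
proof -
  have "X - Y = X + (-1) \<cdot>\<^sub>m Y" using X Y by (intro eq_matI) auto
  then have "\<Phi> (X - Y) = \<Phi> X + (-1) \<cdot>\<^sub>m \<Phi> Y"
    using linear_map_onD(2)[OF L X, of "(-1) \<cdot>\<^sub>m Y"] linear_map_onD(3)[OF L Y] Y by simp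
  also have "\<dots> = \<Phi> X - \<Phi> Y"
    using linear_map_onD(1)[OF L X] linear_map_onD(1)[OF L Y] by (intro eq_matI) auto
  finally show ?thesis .
qed

lemma linear_map_on_zero:
  assumes L: "linear_map_on d \<Phi>" shows "\<Phi> (0\<^sub>m d d) = 0\<^sub>m d d"
proof -
  have "0\<^sub>m d d = (0::complex) \<cdot>\<^sub>m 0\<^sub>m d d" by (intro eq_matI) auto
  then have "\<Phi> (0\<^sub>m d d) = 0 \<cdot>\<^sub>m \<Phi> (0\<^sub>m d d)" using linear_map_onD(3)[OF L, of "0\<^sub>m d d" 0] by simp
  also have "\<dots> = 0\<^sub>m d d" using linear_map_onD(1)[OF L, of "0\<^sub>m d d"] by (intro eq_matI) auto
  finally show ?thesis .
qed

text \<open>Fixing the two ancilla indices leaves an operator on \<open>A\<close>. Amplification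
  acts on each of these blocks separately, which reduces linearity, composition and traces of
  \<open>ampl\<close> to facts about the map itself.\<close>

definition block :: "nat \<Rightarrow> nat \<Rightarrow> complex mat \<Rightarrow> nat \<Rightarrow> nat \<Rightarrow> complex mat" where
  "block d m X k l = mat d d (\<lambda>(x,y). X $$ (x*m + k, y*m + l))"

lemma block_carrier [simp]: "block d m X k l \<in> carrier_mat d d"
  by (simp add: block_def)

lemma ampl_eq: "ampl \<Phi> d m X = mat (d*m) (d*m)
    (\<lambda>(i,j). \<Phi> (block d m X (i mod m) (j mod m)) $$ (i div m, j div m))"
  by (simp add: ampl_def block_def)

lemma ampl_carrier [simp]: "ampl \<Phi> d m X \<in> carrier_mat (d*m) (d*m)"
  by (simp add: ampl_def)

lemma pair_index_less:
  assumes "x < d" "k < m" shows "x * m + k < d * (m::nat)"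
proof -
  have "x * m + k < Suc x * m" using assms by simp
  also have "\<dots> \<le> d * m" using assms by (intro mult_le_mono1) simp
  finally show ?thesis .
qed

lemma div_index_less: "i < d * m \<Longrightarrow> i div m < (d::nat)"
  by (simp add: less_mult_imp_div_less)

lemma mod_index_less: "i < d * m \<Longrightarrow> i mod m < (m::nat)"
  by (metis less_nat_zero_code mod_less_divisor mult_0_right not_gr_zero)

lemma ampl_index:
  assumes "x < d" "y < d" "k < m" "l < m"
  shows "ampl \<Phi> d m X $$ (x*m + k, y*m + l) = \<Phi> (block d m X k l) $$ (x,y)"
  using assms by (simp add: ampl_eq pair_index_less)

lemma block_ampl:
  assumes "\<Phi> (block d m X k l) \<in> carrier_mat d d" "k < m" "l < m"
  shows "block d m (ampl \<Phi> d m X) k l = \<Phi> (block d m X k l)"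
  using assms by (intro eq_matI) (auto simp: block_def[of _ _ "ampl \<Phi> d m X"] ampl_index)

lemma eq_by_blocks:
  assumes X: "X \<in> carrier_mat (d*m) (d*m)" and Y: "Y \<in> carrier_mat (d*m) (d*m)"
    and b: "\<And>k l. k < m \<Longrightarrow> l < m \<Longrightarrow> block d m X k l = block d m Y k l"
  shows "X = Y"
proof (intro eq_matI)
  fix i j assume "i < dim_row Y" "j < dim_col Y"
  then have ij: "i < d * m" "j < d * m" using Y by auto
  have "X $$ (i,j) = block d m X (i mod m) (j mod m) $$ (i div m, j div m)"
    using ij by (simp add: block_def div_index_less)
  also have "\<dots> = block d m Y (i mod m) (j mod m) $$ (i div m, j div m)"
    using b ij mod_index_less by simp
  also have "\<dots> = Y $$ (i,j)" using ij by (simp add: block_def div_index_less)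
  finally show "X $$ (i,j) = Y $$ (i,j)" .
qed (use X Y in auto)

lemma block_add:
  assumes "X \<in> carrier_mat (d*m) (d*m)" "Y \<in> carrier_mat (d*m) (d*m)" "k < m" "l < m"
  shows "block d m (X + Y) k l = block d m X k l + block d m Y k l"
  using assms by (intro eq_matI) (auto simp: block_def pair_index_less)

lemma block_smult:
  assumes "X \<in> carrier_mat (d*m) (d*m)" "k < m" "l < m"
  shows "block d m (c \<cdot>\<^sub>m X) k l = c \<cdot>\<^sub>m block d m X k l"
  using assms by (intro eq_matI) (auto simp: block_def pair_index_less)

lemma ampl_linear:
  assumes L: "linear_map_on d \<Phi>"
  shows "linear_map_on (d*m) (ampl \<Phi> d m)"
  unfolding linear_map_on_def
proof (intro conjI ballI allI)
  note C = linear_map_onD(1)[OF L]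
  fix X Y :: "complex mat" and c assume X: "X \<in> carrier_mat (d*m) (d*m)" and Y: "Y \<in> carrier_mat (d*m) (d*m)"
  show "ampl \<Phi> d m (X + Y) = ampl \<Phi> d m X + ampl \<Phi> d m Y"
    by (rule eq_by_blocks[of _ d m]) (use X Y in \<open>simp_all add: block_ampl C block_add linear_map_onD(2)[OF L]\<close>)
  show "ampl \<Phi> d m (c \<cdot>\<^sub>m X) = c \<cdot>\<^sub>m ampl \<Phi> d m X"
    by (rule eq_by_blocks[of _ d m]) (use X in \<open>simp_all add: block_ampl C block_smult linear_map_onD(3)[OF L]\<close>)
qed auto

text \<open>Only the behaviour on \<open>d\<close> by \<open>d\<close> matrices enters, as
  \<open>ampl\<close> feeds nothing but blocks to its map. An inverse chosen on the carrier alone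
  can therefore be amplified.\<close>

lemma ampl_comp:
  assumes "\<And>X. X \<in> carrier_mat d d \<Longrightarrow> \<Psi> X \<in> carrier_mat d d"
    "\<And>X. X \<in> carrier_mat d d \<Longrightarrow> \<Theta> X = \<Phi> (\<Psi> X)"
    "\<And>X. X \<in> carrier_mat d d \<Longrightarrow> \<Phi> X \<in> carrier_mat d d"
  shows "ampl \<Theta> d m X = ampl \<Phi> d m (ampl \<Psi> d m X)"
  by (rule eq_by_blocks[of _ d m]) (simp_all add: block_ampl assms)

lemma ampl_id:
  assumes "X \<in> carrier_mat (d*m) (d*m)" "\<And>X. X \<in> carrier_mat d d \<Longrightarrow> \<Theta> X = X"
  shows "ampl \<Theta> d m X = X"
  by (rule eq_by_blocks[of _ d m]) (use assms in \<open>simp_all add: block_ampl\<close>)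

lemma ampl_one:
  assumes X: "X \<in> carrier_mat d d" and c: "\<Phi> X \<in> carrier_mat d d"
  shows "ampl \<Phi> d 1 X = \<Phi> X"
proof -
  have "block d 1 X 0 0 = X" using X by (intro eq_matI) (auto simp: block_def)
  then show ?thesis using c by (intro eq_matI) (auto simp: ampl_eq)
qed

lemma sum_pair_index: "(\<Sum>i<d*m. f i) = (\<Sum>x<d. \<Sum>k<m. f (x*m + k))" for f :: "nat \<Rightarrow> 'a::comm_monoid_add"
proof -
  have "(\<Sum>i<d*m. f i) = (\<Sum>x<d. sum f {x*m..<x*m + m})" by (rule sum.nat_group[symmetric])
  moreover have "sum f {x*m..<x*m + m} = (\<Sum>k<m. f (x*m + k))" for x
    using sum.shift_bounds_nat_ivl[of f 0 "x*m" m] by (simp add: atLeast0LessThan add.commute)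
  ultimately show ?thesis by simp
qed

lemma mtrace_blocks:
  assumes "X \<in> carrier_mat (d*m) (d*m)"
  shows "mtrace X = (\<Sum>k<m. mtrace (block d m X k k))"
proof -
  have "mtrace X = (\<Sum>x<d. \<Sum>k<m. X $$ (x*m + k, x*m + k))"
    using assms by (simp add: mtrace_eq sum_pair_index)
  also have "\<dots> = (\<Sum>k<m. \<Sum>x<d. X $$ (x*m + k, x*m + k))" by (rule sum.swap)
  also have "\<dots> = (\<Sum>k<m. mtrace (block d m X k k))" by (simp add: mtrace_def block_def)
  finally show ?thesis .
qed

lemma CPTP_D:
  assumes "CPTP d \<Phi>"
  shows "linear_map_on d \<Phi>" "\<And>m X. m > 0 \<Longrightarrow> psd (d*m) X \<Longrightarrow> psd (d*m) (ampl \<Phi> d m X)"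
    "\<And>X. X \<in> carrier_mat d d \<Longrightarrow> mtrace (\<Phi> X) = mtrace X"
    "\<And>X. X \<in> carrier_mat d d \<Longrightarrow> \<Phi> X \<in> carrier_mat d d"
  using assms unfolding CPTP_def linear_map_on_def by blast+

lemma ampl_mtrace:
  assumes "CPTP d \<Phi>" "X \<in> carrier_mat (d*m) (d*m)"
  shows "mtrace (ampl \<Phi> d m X) = mtrace X"
  using assms by (simp add: mtrace_blocks[of _ d m] block_ampl CPTP_D)

lemma CPTP_psd:
  assumes C: "CPTP d \<Phi>" and X: "psd d X" shows "psd d (\<Phi> X)"
  using CPTP_D(2)[OF C, of 1 X] ampl_one[of X d \<Phi>] CPTP_D(4)[OF C] psd_carrier[OF X] X by simp

text \<open>\<open>X\<close> is the difference of \<open>X + c 1\<close> and \<open>c 1\<close>,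
  both of which have positive images for suitable \<open>c\<close>.\<close>

lemma positive_map_herm:
  assumes L: "linear_map_on n F" and P: "\<And>X. psd n X \<Longrightarrow> psd n (F X)" and X: "herm n X"
  shows "herm n (F X)"
proof -
  obtain c where c: "c > 0" "psd n (X + complex_of_real c \<cdot>\<^sub>m 1\<^sub>m n)" by (rule psd_shift[OF X])
  have Xc: "X \<in> carrier_mat n n" using X by (simp add: herm_def)
  let ?I = "complex_of_real c \<cdot>\<^sub>m 1\<^sub>m n"
  have "X = (X + ?I) - ?I" using Xc by (intro eq_matI) auto
  then have "F X = F (X + ?I) - F ?I" using linear_map_on_minus[OF L, of "X + ?I" ?I] Xc by simp
  moreover have "herm n (F (X + ?I))" "herm n (F ?I)"
    using P[OF c(2)] P[OF psd_smult[OF psd_one, of c]] c(1) by (auto simp: psd_iff)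
  ultimately show ?thesis by (simp add: herm_minus)
qed

lemma positive_map_adj:
  assumes L: "linear_map_on n F" and P: "\<And>X. psd n X \<Longrightarrow> psd n (F X)" and X: "X \<in> carrier_mat n n"
  shows "F (adj X) = adj (F X)"
proof -
  obtain A B where AB: "herm n A" "herm n B" and XAB: "X = A + \<i> \<cdot>\<^sub>m B" by (rule herm_decomp[OF X])
  have c: "A \<in> carrier_mat n n" "B \<in> carrier_mat n n" "\<i> \<cdot>\<^sub>m B \<in> carrier_mat n n" "(-\<i>) \<cdot>\<^sub>m B \<in> carrier_mat n n"
    using AB by (auto simp: herm_def)
  have Fc: "F A \<in> carrier_mat n n" "F B \<in> carrier_mat n n" using linear_map_onD(1)[OF L] c by auto
  have F: "adj (F A) = F A" "adj (F B) = F B"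
    using positive_map_herm[OF L P AB(1)] positive_map_herm[OF L P AB(2)] by (auto simp: herm_def)
  have "adj X = A + (-\<i>) \<cdot>\<^sub>m B"
    using AB c unfolding XAB by (simp add: adj_add[of _ n n] adj_smult herm_def)
  then have "F (adj X) = F A + (-\<i>) \<cdot>\<^sub>m F B"
    using linear_map_onD(2)[OF L c(1,4)] linear_map_onD(3)[OF L c(2), of "-\<i>"] by simp
  moreover have "adj (F X) = F A + (-\<i>) \<cdot>\<^sub>m F B"
    unfolding XAB linear_map_onD(2)[OF L c(1,3)] linear_map_onD(3)[OF L c(2)]
    using Fc F by (simp add: adj_add[of _ n n] adj_smult)
  ultimately show ?thesis by simp
qed

lemma CPTP_herm: "CPTP d \<Phi> \<Longrightarrow> herm d X \<Longrightarrow> herm d (\<Phi> X)"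
  by (rule positive_map_herm[of d \<Phi>]) (auto intro: CPTP_psd CPTP_D(1))

section \<open>Contractive factors of invertible channels\<close>

lemma CPTP_factor_of_bij:
  assumes Phi: "CPTP d \<Phi>" and Psi: "CPTP d \<Psi>"
    and bij: "bij_betw \<Phi> (carrier_mat d d) (carrier_mat d d)"
    and contr: "\<And>m X. m > 0 \<Longrightarrow> herm (d*m) X \<Longrightarrow> trace_norm (ampl \<Psi> d m X) \<le> trace_norm (ampl \<Phi> d m X)"
  shows "\<exists>V. CPTP d V \<and> (\<forall>X\<in>carrier_mat d d. \<Psi> X = V (\<Phi> X))"
proof -
  let ?C = "carrier_mat d d :: complex mat set"
  define J where "J = inv_into ?C \<Phi>"
  define V where "V = (\<lambda>Y. \<Psi> (J Y))"
  note L = CPTP_D(1)[OF Phi] and L' = CPTP_D(1)[OF Psi]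
  have J: "J Y \<in> ?C" "\<Phi> (J Y) = Y" if "Y \<in> ?C" for Y
    using that bij unfolding J_def bij_betw_def by (metis inv_into_into, metis f_inv_into_f)
  have JP: "J (\<Phi> X) = X" if "X \<in> ?C" for X
    using that bij unfolding J_def bij_betw_def by (simp add: inv_into_f_f)
  have Jadd: "J (X + Y) = J X + J Y" if "X \<in> ?C" "Y \<in> ?C" for X Y
    using JP[of "J X + J Y"] linear_map_onD(2)[OF L, of "J X" "J Y"] J that by simp
  have Jsm: "J (c \<cdot>\<^sub>m X) = c \<cdot>\<^sub>m J X" if "X \<in> ?C" for c X
    using JP[of "c \<cdot>\<^sub>m J X"] linear_map_onD(3)[OF L, of "J X" c] J that by simp
  have VL: "linear_map_on d V"
    unfolding linear_map_on_def V_def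
    using J Jadd Jsm CPTP_D(4)[OF Psi] linear_map_onD[OF L'] by auto
  have "psd (d*m) (ampl V d m Y)" if m: "m > 0" and Y: "psd (d*m) Y" for m Y
  proof -
    have Yc: "Y \<in> carrier_mat (d*m) (d*m)" by (rule psd_carrier[OF Y])
    define X where "X = ampl J d m Y"
    have Xc: "X \<in> carrier_mat (d*m) (d*m)" by (simp add: X_def)
    have PX: "ampl \<Phi> d m X = Y"
      unfolding X_def using ampl_comp[of d J "\<lambda>X. X" \<Phi> m Y] J CPTP_D(4)[OF Phi] ampl_id[OF Yc, of "\<lambda>X. X"] by simp
    have VX: "ampl V d m Y = ampl \<Psi> d m X"
      unfolding X_def by (rule ampl_comp) (auto simp: V_def J CPTP_D(4)[OF Psi])
    have JA: "ampl J d m (ampl \<Phi> d m Z) = Z" if "Z \<in> carrier_mat (d*m) (d*m)" for Z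
      using ampl_comp[of d \<Phi> "\<lambda>X. X" J m Z] J JP CPTP_D(4)[OF Phi] ampl_id[OF that, of "\<lambda>X. X"] by simp
    \<comment> \<open>Contraction is available for Hermitian operators only, so the preimage of the
      Hermitian \<open>Y\<close> must be shown to be Hermitian: the amplified map commutes with
      \<open>adj\<close> and is inverted by \<open>ampl J d m\<close>.\<close>
    have "ampl \<Phi> d m (adj X) = adj (ampl \<Phi> d m X)"
      by (rule positive_map_adj[OF ampl_linear[OF L] CPTP_D(2)[OF Phi m] Xc])
    also have "\<dots> = ampl \<Phi> d m X" unfolding PX using Y by (simp add: psd_def)
    finally have "adj X = X" using JA[OF Xc] JA[OF adj_carrier[OF Xc]] by simp
    then have "herm (d*m) X" using Xc by (simp add: herm_def)
    \<comment> \<open>The norm of the image is at most the norm of \<open>Y\<close>, which is the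
      trace of \<open>Y\<close> and, both channels preserving the trace, that of the image.\<close>
    then have "trace_norm (ampl \<Psi> d m X) \<le> trace_norm Y" using contr[OF m] PX by metis
    also have "\<dots> = Re (mtrace Y)" by (rule trace_norm_psd[OF Y])
    also have "mtrace Y = mtrace (ampl \<Psi> d m X)"
      using ampl_mtrace[OF Phi Xc] ampl_mtrace[OF Psi Xc] PX by simp
    finally show ?thesis unfolding VX by (intro psd_if_trace_norm_le) auto
  qed
  moreover have "mtrace (V X) = mtrace X" if "X \<in> ?C" for X
    using J[OF that] CPTP_D(3)[OF Psi, of "J X"] CPTP_D(3)[OF Phi, of "J X"] by (simp add: V_def)
  ultimately have "CPTP d V" using VL by (simp add: CPTP_def)
  then show ?thesis using JP by (auto simp: V_def)
qed

section \<open>One-sided derivatives\<close>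

text \<open>If \<open>g\<close> increased overall, it would eventually stay above some line of
  positive slope \<open>e\<close> through its starting point. At the last point where it is not
  above the line, its right derivative would have to be at least \<open>e\<close>.\<close>

lemma nonincreasing_if_right_derivative_nonpos:
  fixes g :: "real \<Rightarrow> real"
  assumes st: "s \<le> t" and cont: "continuous_on {s..t} g"
    and der: "\<And>x. s \<le> x \<Longrightarrow> x < t \<Longrightarrow> \<exists>D\<le>0. (g has_real_derivative D) (at_right x)"
  shows "g t \<le> g s"
proof (rule ccontr)
  assume "\<not> g t \<le> g s"
  then have gt: "g s < g t" and lt: "s < t" using st by (auto simp: less_le)
  \<comment> \<open>Half of the mean slope, so that \<open>g\<close> still ends strictly above the
    line.\<close>
  define e where "e = (g t - g s) / (2 * (t - s))"
  have "e * (t - s) = (g t - g s) / 2" using lt by (simp add: e_def field_simps)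
  then have e: "e > 0" "e * (t - s) < g t - g s" using gt lt by (auto simp: e_def)
  define h where "h = (\<lambda>x. g x - g s - e * (x - s))"
  define Z where "Z = {x\<in>{s..t}. h x \<le> 0}"
  have ch: "continuous_on {s..t} h" unfolding h_def by (intro continuous_intros cont)
  have "Z = h -` {..0} \<inter> {s..t}" by (auto simp: Z_def)
  then have "closed Z" using ch continuous_on_closed_vimage[of "{s..t}" h] by simp
  moreover have sZ: "s \<in> Z" using st by (simp add: Z_def h_def)
  moreover have bd: "bdd_above Z" by (auto simp: Z_def bdd_above_def)
  ultimately have cZ: "Sup Z \<in> Z" using closed_contains_Sup[of Z] by auto
  \<comment> \<open>The last time at which \<open>g\<close> is not above the line; \<open>Z\<close>
    is closed by continuity, so \<open>c\<close> belongs to it.\<close>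
  define c where "c = Sup Z"
  have c: "s \<le> c" "c \<le> t" "h c \<le> 0" using cZ by (auto simp: c_def Z_def)
  have "h t > 0" using e by (simp add: h_def)
  then have ct: "c < t" using c by (cases "c = t") auto
  have pos: "h x > 0" if "c < x" "x \<le> t" for x
  proof (rule ccontr)
    assume "\<not> h x > 0"
    then have "x \<in> Z" using that c by (simp add: Z_def)
    then have "x \<le> c" unfolding c_def using bd by (rule cSup_upper)
    then show False using that by simp
  qed
  obtain D where D: "D \<le> 0" "(g has_real_derivative D) (at_right c)" using der[OF c(1) ct] by auto
  then have "((\<lambda>x. (g x - g c) / (x - c)) \<longlongrightarrow> D) (at_right c)"
    by (simp add: has_field_derivative_iff)
  then have "eventually (\<lambda>x. (g x - g c) / (x - c) < e) (at_right c)"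
    by (rule order_tendstoD) (use D e in simp)
  moreover have "eventually (\<lambda>x. x \<in> {c<..<t}) (at_right c)" by (rule eventually_at_right_real[OF ct])
  ultimately have "eventually (\<lambda>x. False) (at_right c)"
  proof eventually_elim
    case (elim x)
    then have "g x - g c < e * (x - c)" by (simp add: field_simps)
    then have "h x < h c" by (simp add: h_def algebra_simps)
    then show False using pos[of x] elim c by simp
  qed
  then show False by simp
qed

text \<open>By convexity the difference quotients along a line decrease to the directional derivative;
  the error against the actual path is controlled by the Lipschitz bound.\<close>

lemma trace_norm_right_differentiable:
  fixes F :: "real \<Rightarrow> complex mat"
  assumes Fc: "\<And>s. F s \<in> carrier_mat n n"
    and diff: "\<And>i j. i < n \<Longrightarrow> j < n \<Longrightarrow> (\<lambda>s. F s $$ (i,j)) differentiable (at_right t)"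
  shows "\<exists>D. ((\<lambda>s. trace_norm (F s)) has_real_derivative D) (at_right t)"
proof -
  have "\<exists>y. ((\<lambda>s. (F s $$ (i,j) - F t $$ (i,j) - of_real (s - t) * y) / of_real (s - t)) \<longlongrightarrow> 0) (at_right t)"
    if ij: "i < n" "j < n" for i j
  proof -
    obtain f' where f': "((\<lambda>s. F s $$ (i,j)) has_derivative f') (at_right t)"
      using diff[OF ij] by (auto simp: differentiable_def)
    then interpret f': bounded_linear f' by (rule has_derivative_bounded_linear)
    \<comment> \<open>The derivative is linear over the reals only, and \<open>f' 1\<close> is the
      complex velocity of the entry.\<close>
    have lin: "f' (s - t) = of_real (s - t) * f' 1" for s
      using f'.scaleR[of "s - t" 1] by (simp add: scaleR_conv_of_real)
    have "((\<lambda>s. (1 / norm (s - t)) *\<^sub>R (F s $$ (i,j) - (F t $$ (i,j) + f' (s - t)))) \<longlongrightarrow> 0) (at_right t)"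
      using f' by (simp add: has_derivative_within)
    moreover have "eventually (\<lambda>s. (1 / norm (s - t)) *\<^sub>R (F s $$ (i,j) - (F t $$ (i,j) + f' (s - t))) =
       (F s $$ (i,j) - F t $$ (i,j) - of_real (s - t) * f' 1) / of_real (s - t)) (at_right t)"
      using eventually_at_right_less[of t]
    proof eventually_elim
      case (elim s)
      then show ?case unfolding lin by (simp add: scaleR_conv_of_real field_simps)
    qed
    ultimately have "((\<lambda>s. (F s $$ (i,j) - F t $$ (i,j) - of_real (s - t) * f' 1) / of_real (s - t)) \<longlongrightarrow> 0) (at_right t)"
      by (rule Lim_transform_eventually)
    then show ?thesis by blast
  qed
  note ex = this
  define y where "y i j = (SOME y. ((\<lambda>s. (F s $$ (i,j) - F t $$ (i,j) - of_real (s - t) * y) / of_real (s - t)) \<longlongrightarrow> 0) (at_right t))" for i j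
  have y: "((\<lambda>s. (F s $$ (i,j) - F t $$ (i,j) - of_real (s - t) * y i j) / of_real (s - t)) \<longlongrightarrow> 0) (at_right t)"
    if "i < n" "j < n" for i j
    unfolding y_def by (rule someI_ex[OF ex[OF that]])
  define Y where "Y = mat n n (\<lambda>(i,j). y i j)"
  define A where "A = F t"
  have Yc: "Y \<in> carrier_mat n n" and Ac: "A \<in> carrier_mat n n" using Fc by (auto simp: Y_def A_def)
  define G where "G = (\<lambda>h::real. A + of_real h \<cdot>\<^sub>m Y)"
  have Gc: "G h \<in> carrier_mat n n" for h using Ac Yc by (simp add: G_def)
  define q where "q = (\<lambda>h. (trace_norm (G h) - trace_norm A) / h)"
  have q_mono: "q h \<le> q k" if hk: "0 < h" "h \<le> k" for h k
  proof -
    have "G h = of_real (1 - h / k) \<cdot>\<^sub>m A + of_real (h / k) \<cdot>\<^sub>m G k"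
      using Ac Yc hk by (intro eq_matI) (auto simp: G_def field_simps)
    then have "trace_norm (G h) \<le> trace_norm (of_real (1 - h / k) \<cdot>\<^sub>m A) + trace_norm (of_real (h / k) \<cdot>\<^sub>m G k)"
      using trace_norm_triangle[of "of_real (1 - h / k) \<cdot>\<^sub>m A" n "of_real (h / k) \<cdot>\<^sub>m G k"] Ac Gc by simp
    also have "\<dots> = (1 - h / k) * trace_norm A + h / k * trace_norm (G k)"
      using hk by (simp add: trace_norm_scale[OF Ac] trace_norm_scale[OF Gc] del: of_real_divide of_real_diff)
    finally have "trace_norm (G h) - trace_norm A \<le> h / k * (trace_norm (G k) - trace_norm A)"
      by (simp add: algebra_simps)
    then have "(trace_norm (G h) - trace_norm A) / h \<le> (h / k * (trace_norm (G k) - trace_norm A)) / h"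
      using hk by (intro divide_right_mono) auto
    then show ?thesis using hk by (simp add: q_def)
  qed
  have q_bound: "- (\<Sum>i<n. \<Sum>j<n. cmod (Y $$ (i,j))) \<le> q h" if h: "0 < h" for h
  proof -
    have "\<bar>trace_norm (G h) - trace_norm A\<bar> \<le> (\<Sum>i<n. \<Sum>j<n. cmod (G h $$ (i,j) - A $$ (i,j)))"
      by (rule trace_norm_lipschitz[OF Gc Ac])
    also have "\<dots> = h * (\<Sum>i<n. \<Sum>j<n. cmod (Y $$ (i,j)))"
      using h Ac Yc by (simp add: G_def norm_mult sum_distrib_left)
    finally have "- (h * (\<Sum>i<n. \<Sum>j<n. cmod (Y $$ (i,j)))) \<le> trace_norm (G h) - trace_norm A" by linarith
    then show ?thesis using h by (simp add: q_def field_simps)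
  qed
  \<comment> \<open>The quotients decrease as \<open>h\<close> decreases to 0, so their limit is
    their infimum; the Lipschitz bound keeps it finite.\<close>
  define D where "D = Inf (q ` {0<..})"
  have bd: "bdd_below (q ` {0<..})" using q_bound by (auto simp: bdd_below_def)
  have D_le: "D \<le> q h" if "0 < h" for h unfolding D_def using that bd by (intro cInf_lower) auto
  have q_lim: "((\<lambda>s. q (s - t)) \<longlongrightarrow> D) (at_right t)"
  proof (rule order_tendstoI)
    fix a assume a: "a < D"
    show "eventually (\<lambda>s. a < q (s - t)) (at_right t)"
      using eventually_at_right_less[of t]
    proof eventually_elim
      case (elim s)
      then show ?case using a D_le[of "s - t"] by simp
    qed
  next
    fix a assume "D < a"
    then obtain k where k: "0 < k" "q k < a"
      unfolding D_def using cInf_less_iff[OF _ bd] by auto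
    have "eventually (\<lambda>s. s \<in> {t<..<t + k}) (at_right t)" by (rule eventually_at_right_real) (use k in simp)
    then show "eventually (\<lambda>s. q (s - t) < a) (at_right t)"
    proof eventually_elim
      case (elim s)
      then have "q (s - t) \<le> q k" by (intro q_mono) auto
      then show ?case using k by simp
    qed
  qed
  have err: "((\<lambda>s. (trace_norm (F s) - trace_norm A) / (s - t) - q (s - t)) \<longlongrightarrow> 0) (at_right t)"
  proof (rule tendsto_0_le)
    show "((\<lambda>s. \<Sum>i<n. \<Sum>j<n. cmod ((F s $$ (i,j) - F t $$ (i,j) - of_real (s - t) * y i j) / of_real (s - t))) \<longlongrightarrow> 0) (at_right t)"
      by (intro tendsto_null_sum tendsto_norm_zero y) auto
    show "eventually (\<lambda>s. norm ((trace_norm (F s) - trace_norm A) / (s - t) - q (s - t)) \<le>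
      norm (\<Sum>i<n. \<Sum>j<n. cmod ((F s $$ (i,j) - F t $$ (i,j) - of_real (s - t) * y i j) / of_real (s - t))) * 1) (at_right t)"
      using eventually_at_right_less[of t]
    proof eventually_elim
      case (elim s)
      have "(trace_norm (F s) - trace_norm A) / (s - t) - q (s - t) = (trace_norm (F s) - trace_norm (G (s - t))) / (s - t)"
        by (simp add: q_def diff_divide_distrib)
      then have "norm ((trace_norm (F s) - trace_norm A) / (s - t) - q (s - t)) =
          \<bar>trace_norm (F s) - trace_norm (G (s - t))\<bar> / (s - t)" using elim by simp
      also have "\<dots> \<le> (\<Sum>i<n. \<Sum>j<n. cmod (F s $$ (i,j) - G (s - t) $$ (i,j))) / (s - t)"
        using elim by (intro divide_right_mono trace_norm_lipschitz Fc Gc) auto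
      also have "\<dots> = (\<Sum>i<n. \<Sum>j<n. cmod ((F s $$ (i,j) - F t $$ (i,j) - of_real (s - t) * y i j) / of_real (s - t)))"
      proof -
        have "cmod (F s $$ (i,j) - G (s - t) $$ (i,j)) / (s - t) =
            cmod ((F s $$ (i,j) - F t $$ (i,j) - of_real (s - t) * y i j) / of_real (s - t))" if "i < n" "j < n" for i j
          using that elim Ac Yc unfolding norm_divide
          by (simp add: G_def A_def Y_def diff_diff_eq norm_of_real del: of_real_diff)
        then show ?thesis by (simp add: sum_divide_distrib)
      qed
      finally show ?case by (simp add: sum_nonneg)
    qed
  qed
  have "((\<lambda>s. (trace_norm (F s) - trace_norm (F t)) / (s - t)) \<longlongrightarrow> D) (at_right t)"
    using tendsto_add[OF err q_lim] by (simp add: A_def)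
  then show ?thesis by (auto simp: has_field_derivative_iff)
qed

section \<open>Negativity as a trace norm\<close>

text \<open>The second tensor factor is a function of two indices, so that fixed four by four
  operators can be given by formulas and compared by cases.\<close>

definition kron :: "complex mat \<Rightarrow> nat \<Rightarrow> (nat \<Rightarrow> nat \<Rightarrow> complex) \<Rightarrow> complex mat" where
  "kron A n G = mat (dim_row A * n) (dim_col A * n) (\<lambda>(i,j). A $$ (i div n, j div n) * G (i mod n) (j mod n))"

lemma kron_carrier [simp]: "A \<in> carrier_mat M M \<Longrightarrow> kron A n G \<in> carrier_mat (M*n) (M*n)"
  by (auto simp: kron_def)

lemma kron_index:
  "A \<in> carrier_mat M M \<Longrightarrow> i < M*n \<Longrightarrow> j < M*n \<Longrightarrow>
    kron A n G $$ (i,j) = A $$ (i div n, j div n) * G (i mod n) (j mod n)"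
  by (auto simp: kron_def)

lemma kron_index_pair:
  "A \<in> carrier_mat M M \<Longrightarrow> x < M \<Longrightarrow> y < M \<Longrightarrow> p < n \<Longrightarrow> q < n \<Longrightarrow>
    kron A n G $$ (x*n + p, y*n + q) = A $$ (x,y) * G p q"
  by (simp add: kron_index[of A M] pair_index_less)

lemma kron_mult:
  assumes A: "A \<in> carrier_mat M M" and B: "B \<in> carrier_mat M M"
  shows "kron A n G * kron B n H = kron (A * B) n (\<lambda>p q. \<Sum>r<n. G p r * H r q)"
proof (rule eq_matI)
  fix i j assume "i < dim_row (kron (A * B) n (\<lambda>p q. \<Sum>r<n. G p r * H r q))"
    "j < dim_col (kron (A * B) n (\<lambda>p q. \<Sum>r<n. G p r * H r q))"
  then have ij: "i < M*n" "j < M*n" using A B by (auto simp: kron_def)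
  have "(kron A n G * kron B n H) $$ (i,j) = (\<Sum>x<M. \<Sum>r<n. kron A n G $$ (i, x*n + r) * kron B n H $$ (x*n + r, j))"
    using ij A B by (simp add: mult_index[of _ "M*n" "M*n" _ "M*n"] sum_pair_index)
  also have "\<dots> = (\<Sum>x<M. \<Sum>r<n. (A $$ (i div n, x) * B $$ (x, j div n)) * (G (i mod n) r * H r (j mod n)))"
    using ij A B by (intro sum.cong refl) (simp add: kron_index[of _ M] pair_index_less)
  also have "\<dots> = (\<Sum>x<M. A $$ (i div n, x) * B $$ (x, j div n)) * (\<Sum>r<n. G (i mod n) r * H r (j mod n))"
    by (simp add: sum_product)
  also have "\<dots> = kron (A * B) n (\<lambda>p q. \<Sum>r<n. G p r * H r q) $$ (i,j)"
    using ij A B by (simp add: kron_index[of _ M] mult_index[of _ M M _ M] div_index_less)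
  finally show "(kron A n G * kron B n H) $$ (i,j) = kron (A * B) n (\<lambda>p q. \<Sum>r<n. G p r * H r q) $$ (i,j)" .
qed (use A B in \<open>auto simp: kron_def\<close>)

lemma kron_cong:
  assumes "\<And>p q. p < n \<Longrightarrow> q < n \<Longrightarrow> G p q = H p q"
  shows "kron A n G = kron A n H"
  by (rule eq_matI) (auto simp: kron_def assms mod_index_less)

lemma kron_add_right: "kron A n (\<lambda>p q. G p q + H p q) = kron A n G + kron A n H"
  by (rule eq_matI) (auto simp: kron_def algebra_simps)

lemma kron_zero: "A \<in> carrier_mat M M \<Longrightarrow> kron A n (\<lambda>p q. 0) = 0\<^sub>m (M*n) (M*n)"
  by (rule eq_matI) (auto simp: kron_def)

lemma kron_herm:
  assumes A: "herm M A" and G: "\<And>p q. p < n \<Longrightarrow> q < n \<Longrightarrow> cnj (G p q) = G q p"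
  shows "herm (M*n) (kron A n G)"
proof -
  have "A \<in> carrier_mat M M" using A by (simp add: herm_def)
  then show ?thesis
    using herm_index[OF A] G unfolding herm_iff
    by (auto simp: kron_index[of _ M] div_index_less mod_index_less)
qed

text \<open>The second factor is the rank one operator of \<open>a\<close>. The form at
  \<open>v\<close> is the form of \<open>A\<close> at the vector obtained by contracting
  \<open>v\<close> with the conjugate of \<open>a\<close>.\<close>

lemma kron_psd:
  assumes A: "psd M A"
  shows "psd (M*n) (kron A n (\<lambda>p q. a p * cnj (a q)))"
proof -
  have Ac: "A \<in> carrier_mat M M" by (rule psd_carrier[OF A])
  have "qform (M*n) (kron A n (\<lambda>p q. a p * cnj (a q))) v = qform M A (\<lambda>y. \<Sum>q<n. cnj (a q) * v (y*n + q))" for v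
  proof -
    have "qform (M*n) (kron A n (\<lambda>p q. a p * cnj (a q))) v =
      (\<Sum>x<M. \<Sum>p<n. \<Sum>y<M. \<Sum>q<n. cnj (v (x*n + p)) * (A $$ (x,y) * (a p * cnj (a q))) * v (y*n + q))"
      unfolding qform_def sum_pair_index
      by (intro sum.cong refl) (simp add: kron_index_pair[OF Ac])
    also have "\<dots> = (\<Sum>x<M. \<Sum>y<M. \<Sum>p<n. \<Sum>q<n. cnj (v (x*n + p)) * (A $$ (x,y) * (a p * cnj (a q))) * v (y*n + q))"
      by (rule sum.cong[OF refl], rule sum.swap)
    also have "\<dots> = qform M A (\<lambda>y. \<Sum>q<n. cnj (a q) * v (y*n + q))"
      unfolding qform_def by (simp add: sum_distrib_left sum_distrib_right algebra_simps)
    finally show ?thesis .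
  qed
  then show ?thesis using A kron_herm[of M A n "\<lambda>p q. a p * cnj (a q)"] by (simp add: psd_iff)
qed

lemma kron_mtrace:
  assumes "A \<in> carrier_mat M M"
  shows "mtrace (kron A n G) = mtrace A * (\<Sum>p<n. G p p)"
  using assms by (simp add: mtrace_eq[of _ M] mtrace_eq[of _ "M*n"] sum_pair_index kron_index_pair sum_product)

text \<open>An index \<open>p < 4\<close> encodes the basis vector \<open>(p div 2, p mod 2)\<close> of two qubits, the first belonging to
  \<open>B\<close> and the second being \<open>C\<close>. The Bell vectors are not normalised.\<close>

definition bell_plus :: "nat \<Rightarrow> complex" where
  "bell_plus p = (if p = 0 \<or> p = 3 then 1 else 0)"

definition bell_minus :: "nat \<Rightarrow> complex" where
  "bell_minus p = (if p = 0 then 1 else if p = 3 then -1 else 0)"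

definition bell_mix :: "complex mat \<Rightarrow> complex mat \<Rightarrow> complex mat" where
  "bell_mix P N = kron P 4 (\<lambda>p q. bell_plus p * cnj (bell_plus q)) + kron N 4 (\<lambda>p q. bell_minus p * cnj (bell_minus q))"

text \<open>Transposing \<open>C\<close> in the rank one operators of \<open>bell_plus\<close> and
  \<open>bell_minus\<close> moves the coherences between 00 and 11 to a swap of 01 and 10 and leaves
  \<open>outer_proj\<close> plus, respectively minus, \<open>inner_swap\<close>. The square of
  \<open>inner_swap\<close> is \<open>inner_proj\<close>.\<close>

definition outer_proj :: "nat \<Rightarrow> nat \<Rightarrow> complex" where
  "outer_proj p q = (if p = q \<and> (p = 0 \<or> p = 3) then 1 else 0)"

definition inner_swap :: "nat \<Rightarrow> nat \<Rightarrow> complex" where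
  "inner_swap p q = (if (p = 1 \<and> q = 2) \<or> (p = 2 \<and> q = 1) then 1 else 0)"

definition inner_proj :: "nat \<Rightarrow> nat \<Rightarrow> complex" where
  "inner_proj p q = (if p = q \<and> (p = 1 \<or> p = 2) then 1 else 0)"

lemma sum4: "(\<Sum>r<4. f r) = f 0 + f 1 + f 2 + f (3::nat)" for f :: "nat \<Rightarrow> complex"
  by (simp add: eval_nat_numeral)

lemma less4: "(p::nat) < 4 \<longleftrightarrow> p = 0 \<or> p = 1 \<or> p = 2 \<or> p = 3"
  by auto

text \<open>An index is read in quarters as an index of the first factor together with two qubits,
  and in halves for the cut against \<open>C\<close>. Exchanging last bits, which is what the
  partial transpose does, stays within a quarter.\<close>

lemma quarter_split:
  fixes k b :: nat
  shows "(k div 2) * 2 + b = 4 * (k div 4) + ((k mod 4 div 2) * 2 + b)"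
    and "k mod 4 div 2 = k div 2 mod 2" and "k mod 4 mod 2 = k mod 2"
proof -
  have m: "k mod 4 = 2 * (k div 2 mod 2) + k mod 2" using mod_mult2_eq[of k 2 2] by simp
  have d: "k div 4 = k div 2 div 2" using div_mult2_eq[of k 2 2] by simp
  show m2: "k mod 4 div 2 = k div 2 mod 2" unfolding m by simp
  show "k mod 4 mod 2 = k mod 2" unfolding m by simp
  show "(k div 2) * 2 + b = 4 * (k div 4) + ((k mod 4 div 2) * 2 + b)"
    unfolding m2 d using mult_div_mod_eq[of 2 "k div 2"] by linarith
qed

lemma partial_transpose_bell_mix:
  assumes P: "P \<in> carrier_mat M M" and N: "N \<in> carrier_mat M M"
  shows "partial_transpose2 (M*2) 2 (bell_mix P N) = kron (P + N) 4 outer_proj + kron (P - N) 4 inner_swap"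
proof (rule eq_matI)
  fix i j assume "i < dim_row (kron (P + N) 4 outer_proj + kron (P - N) 4 inner_swap)"
    "j < dim_col (kron (P + N) 4 outer_proj + kron (P - N) 4 inner_swap)"
  then have ij: "i < M*4" "j < M*4" using P N by (auto simp: kron_def)
  define i' where "i' = (i div 2) * 2 + j mod 2"
  define j' where "j' = (j div 2) * 2 + i mod 2"
  note half = quarter_split
  have small: "(k mod 4 div 2) * 2 + l mod 2 < 4" for k l :: nat
    unfolding half(2) using mod_less_divisor[of 2 "k div 2"] mod_less_divisor[of 2 l] by linarith
  have qr: "(4 * a + c) div 4 = a" "(4 * a + c) mod 4 = c" if "c < 4" for a c :: nat using that by auto
  have i4: "i' = 4 * (i div 4) + ((i mod 4 div 2) * 2 + j mod 2)" unfolding i'_def by (rule half(1))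
  have j4: "j' = 4 * (j div 4) + ((j mod 4 div 2) * 2 + i mod 2)" unfolding j'_def by (rule half(1))
  have dv: "i' div 4 = i div 4" "j' div 4 = j div 4"
    unfolding i4 j4 by (rule qr(1)[OF small])+
  have md: "i' mod 4 = (i mod 4 div 2) * 2 + (j mod 4) mod 2" "j' mod 4 = (j mod 4 div 2) * 2 + (i mod 4) mod 2"
    using qr(2)[OF small[of i j], of "i div 4"] qr(2)[OF small[of j i], of "j div 4"]
    unfolding i4[symmetric] j4[symmetric] half(3) .
  have d: "i div 4 < M" "j div 4 < M" using ij div_index_less by blast+
  then have ij': "i' < M*4" "j' < M*4" using i4 j4 small[of i j] small[of j i] by linarith+
  have m: "i mod 4 < 4" "j mod 4 < 4" by auto
  have "partial_transpose2 (M*2) 2 (bell_mix P N) $$ (i,j) = bell_mix P N $$ (i', j')"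
    using ij by (simp add: partial_transpose2_def i'_def j'_def)
  also have "\<dots> = P $$ (i div 4, j div 4) * (bell_plus (i' mod 4) * cnj (bell_plus (j' mod 4)))
      + N $$ (i div 4, j div 4) * (bell_minus (i' mod 4) * cnj (bell_minus (j' mod 4)))"
    using ij' P N by (simp add: bell_mix_def kron_index[of _ M] dv carrier_matD[OF kron_carrier[OF N]])
  also have "\<dots> = (P $$ (i div 4, j div 4) + N $$ (i div 4, j div 4)) * outer_proj (i mod 4) (j mod 4)
      + (P $$ (i div 4, j div 4) - N $$ (i div 4, j div 4)) * inner_swap (i mod 4) (j mod 4)"
    unfolding md using m unfolding less4
    by (elim disjE) (simp_all add: bell_plus_def bell_minus_def outer_proj_def inner_swap_def)
  also have "\<dots> = (kron (P + N) 4 outer_proj + kron (P - N) 4 inner_swap) $$ (i,j)"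
    using ij d P N by (simp add: kron_index[of _ M] carrier_matD[OF kron_carrier[of "P - N" M]] minus_carrier_mat)
  finally show "partial_transpose2 (M*2) 2 (bell_mix P N) $$ (i,j) =
     (kron (P + N) 4 outer_proj + kron (P - N) 4 inner_swap) $$ (i,j)" .
qed (use P N in \<open>auto simp: kron_def partial_transpose2_def\<close>)

text \<open>The two summands act on orthogonal subspaces. With \<open>T\<close> the modulus of
  \<open>C\<close>, the modulus of the sum is
  \<open>kron A 4 outer_proj + kron T 4 inner_proj\<close>, and both projectors have trace
  2.\<close>

lemma trace_norm_outer_inner:
  assumes A: "psd M A" and C: "herm M C"
  shows "trace_norm (kron A 4 outer_proj + kron C 4 inner_swap) = 2 * Re (mtrace A) + 2 * trace_norm C"
proof -
  have Ac: "A \<in> carrier_mat M M" and Cc: "C \<in> carrier_mat M M" and Cadj: "adj C = C"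
    using A C by (auto simp: psd_def herm_def)
  obtain U where U: "unitary M U" "psd M (U * C)" "trace_norm C = Re (mtrace (U * C))"
    "(U * C) * (U * C) = adj C * C" using trace_norm_attained[OF Cc] by metis
  define T where "T = U * C"
  have T: "psd M T" "trace_norm C = Re (mtrace T)" "T * T = C * C" using U Cadj by (auto simp: T_def)
  have Tc: "T \<in> carrier_mat M M" by (rule psd_carrier[OF T(1)])
  let ?Y = "kron A 4 outer_proj + kron C 4 inner_swap" and ?S = "kron A 4 outer_proj + kron T 4 inner_proj"
  have Yc: "?Y \<in> carrier_mat (M*4) (M*4)" using Ac Cc by simp
  define e where "e k p = (if p = k then 1 else 0 :: complex)" for k p :: nat
  have "kron A 4 outer_proj = kron A 4 (\<lambda>p q. e 0 p * cnj (e 0 q) + e 3 p * cnj (e 3 q))"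
    by (rule kron_cong) (auto simp: outer_proj_def e_def)
  then have p1: "psd (M*4) (kron A 4 outer_proj)" using A by (simp add: kron_add_right psd_add kron_psd)
  have "kron T 4 inner_proj = kron T 4 (\<lambda>p q. e 1 p * cnj (e 1 q) + e 2 p * cnj (e 2 q))"
    by (rule kron_cong) (auto simp: inner_proj_def e_def)
  then have p2: "psd (M*4) (kron T 4 inner_proj)" using T by (simp add: kron_add_right psd_add kron_psd)
  have S: "psd (M*4) ?S" using p1 p2 by (rule psd_add)
  \<comment> \<open>One computation for the operator itself (\<open>inner_swap\<close>) and for its
    candidate modulus (\<open>inner_proj\<close>): the two choices of \<open>H\<close> have the same
    square and both annihilate \<open>outer_proj\<close>.\<close>
  have sq: "(kron A 4 G + kron B 4 H) * (kron A 4 G + kron B 4 H)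
      = kron (A * A) 4 outer_proj + kron (B * B) 4 inner_proj"
    if Bc: "B \<in> carrier_mat M M" and G: "G = outer_proj" and H: "H = inner_swap \<or> H = inner_proj" for B G H
  proof -
    have z: "kron A 4 G * kron B 4 H = 0\<^sub>m (M*4) (M*4)"
    proof -
      have "kron A 4 G * kron B 4 H = kron (A * B) 4 (\<lambda>p q. 0)"
        unfolding kron_mult[OF Ac Bc] using H
        by (intro kron_cong) (auto simp: G sum4 outer_proj_def inner_swap_def inner_proj_def)
      then show ?thesis using kron_zero[of "A * B" M 4] Ac Bc by simp
    qed
    have z': "kron B 4 H * kron A 4 G = 0\<^sub>m (M*4) (M*4)"
    proof -
      have "kron B 4 H * kron A 4 G = kron (B * A) 4 (\<lambda>p q. 0)"
        unfolding kron_mult[OF Bc Ac] using H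
        by (intro kron_cong) (auto simp: G sum4 outer_proj_def inner_swap_def inner_proj_def)
      then show ?thesis using kron_zero[of "B * A" M 4] Ac Bc by simp
    qed
    have a: "kron A 4 G * kron A 4 G = kron (A * A) 4 outer_proj"
      unfolding kron_mult[OF Ac Ac] by (intro kron_cong) (auto simp: G sum4 outer_proj_def)
    have b: "kron B 4 H * kron B 4 H = kron (B * B) 4 inner_proj"
      unfolding kron_mult[OF Bc Bc] using H
      by (intro kron_cong) (auto simp: sum4 inner_proj_def inner_swap_def)
    have kc: "kron A 4 G \<in> carrier_mat (M*4) (M*4)" "kron B 4 H \<in> carrier_mat (M*4) (M*4)" using Ac Bc by auto
    have "(kron A 4 G + kron B 4 H) * (kron A 4 G + kron B 4 H)
      = (kron A 4 G * kron A 4 G + kron B 4 H * kron A 4 G) + (kron A 4 G * kron B 4 H + kron B 4 H * kron B 4 H)"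
      using kc by (simp add: mult_add_distrib_mat[of _ "M*4" "M*4" _ "M*4"] add_mult_distrib_mat[of _ "M*4" "M*4" _ _ "M*4"])
    then show ?thesis unfolding z z' a b
      using kron_carrier[of "A * A" M 4 outer_proj] kron_carrier[of "B * B" M 4 inner_proj] Ac Bc
      by (simp add: right_add_zero_mat left_add_zero_mat)
  qed
  have "herm (M*4) (kron C 4 inner_swap)"
    using C by (rule kron_herm) (auto simp: inner_swap_def)
  then have "adj ?Y = ?Y" using p1 herm_add[of "M*4" "kron A 4 outer_proj" "kron C 4 inner_swap"]
    by (simp add: psd_iff herm_def)
  then have "?S * ?S = adj ?Y * ?Y"
    using sq[OF Cc refl, of inner_swap] sq[OF Tc refl, of inner_proj] T(3) by simp
  then have "trace_norm ?Y = Re (mtrace ?S)" by (rule trace_norm_eqI[OF Yc S])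
  also have "mtrace ?S = mtrace A * 2 + mtrace T * 2"
    using Ac Tc by (simp add: mtrace_add[of _ "M*4"] kron_mtrace sum4 outer_proj_def inner_proj_def)
  finally show ?thesis using T(2) by simp
qed

lemma negativity_bell_mix:
  assumes P: "psd M P" and N: "psd M N"
  shows "negativity (M*2) 2 (bell_mix P N) = (2 * Re (mtrace (P + N)) + 2 * trace_norm (P - N) - 1) / 2"
  unfolding negativity_def partial_transpose_bell_mix[OF psd_carrier[OF P] psd_carrier[OF N]]
  using trace_norm_outer_inner[OF psd_add[OF P N] herm_minus[of M P N]] P N by (simp add: psd_iff)

lemma bell_mix_psd: "psd M P \<Longrightarrow> psd M N \<Longrightarrow> psd (M*4) (bell_mix P N)"
  unfolding bell_mix_def by (intro psd_add kron_psd)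

lemma bell_mix_mtrace:
  assumes "P \<in> carrier_mat M M" "N \<in> carrier_mat M M"
  shows "mtrace (bell_mix P N) = 2 * mtrace (P + N)"
  using assms unfolding bell_mix_def
  by (simp add: mtrace_add[of _ "M*4"] mtrace_add[of _ M] kron_mtrace sum4 bell_plus_def bell_minus_def algebra_simps)

text \<open>The \<open>n\<close>-dimensional factor is a spectator: an ancilla index below
  \<open>m*n\<close> splits into one below \<open>m\<close> and one below \<open>n\<close>, and
  \<open>G\<close> contributes a scalar to each block.\<close>

lemma ampl_kron:
  assumes L: "linear_map_on d \<Phi>" and P: "P \<in> carrier_mat (d*m) (d*m)"
  shows "ampl \<Phi> d (m*n) (kron P n G) = kron (ampl \<Phi> d m P) n G"
proof (rule eq_matI)
  fix i j assume "i < dim_row (kron (ampl \<Phi> d m P) n G)" "j < dim_col (kron (ampl \<Phi> d m P) n G)"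
  then have ij: "i < d*m*n" "j < d*m*n" by (auto simp: kron_def ampl_def)
  have n0: "n > 0" and m0: "m > 0" using ij by (cases n; cases m; auto)+
  have I: "i div n < d*m" "j div n < d*m" using ij div_index_less by blast+
  have id: "x * (m*n) + i mod (m*n) = (x*m + (i div n) mod m) * n + i mod n" for x i
    using mod_mult2_eq[of i n m] by (simp add: algebra_simps)
  have "block d (m*n) (kron P n G) (i mod (m*n)) (j mod (m*n)) =
      G (i mod n) (j mod n) \<cdot>\<^sub>m block d m P ((i div n) mod m) ((j div n) mod m)"
  proof (rule eq_matI)
    fix x y assume "x < dim_row (G (i mod n) (j mod n) \<cdot>\<^sub>m block d m P ((i div n) mod m) ((j div n) mod m))"
      "y < dim_col (G (i mod n) (j mod n) \<cdot>\<^sub>m block d m P ((i div n) mod m) ((j div n) mod m))"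
    then have xy: "x < d" "y < d" by (auto simp: block_def)
    then show "block d (m*n) (kron P n G) (i mod (m*n)) (j mod (m*n)) $$ (x,y) =
      (G (i mod n) (j mod n) \<cdot>\<^sub>m block d m P ((i div n) mod m) ((j div n) mod m)) $$ (x,y)"
      using m0 n0 by (simp add: block_def id kron_index_pair[OF P] pair_index_less)
  qed (auto simp: block_def)
  then have "ampl \<Phi> d (m*n) (kron P n G) $$ (i,j) =
      (G (i mod n) (j mod n) \<cdot>\<^sub>m \<Phi> (block d m P ((i div n) mod m) ((j div n) mod m))) $$ (i div n div m, j div n div m)"
    using ij linear_map_onD(3)[OF L, of "block d m P ((i div n) mod m) ((j div n) mod m)"]
    by (simp add: ampl_eq mult.assoc div_mult2_eq mult.commute[of m n])
  also have "\<dots> = kron (ampl \<Phi> d m P) n G $$ (i,j)"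
    using ij I linear_map_onD(1)[OF L, of "block d m P ((i div n) mod m) ((j div n) mod m)"]
    by (simp add: kron_index[of _ "d*m"] ampl_eq[of _ _ m] div_index_less)
  finally show "ampl \<Phi> d (m*n) (kron P n G) $$ (i,j) = kron (ampl \<Phi> d m P) n G $$ (i,j)" .
qed (auto simp: kron_def ampl_def)

lemma ampl_bell_mix:
  assumes L: "linear_map_on d \<Phi>" and P: "P \<in> carrier_mat (d*m) (d*m)" and N: "N \<in> carrier_mat (d*m) (d*m)"
  shows "ampl \<Phi> d (m*4) (bell_mix P N) = bell_mix (ampl \<Phi> d m P) (ampl \<Phi> d m N)"
  using linear_map_onD(2)[OF ampl_linear[OF L, of "m*4"], of "kron P 4 _" "kron N 4 _"] P N
    kron_carrier[OF P, of 4] kron_carrier[OF N, of 4]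
  by (simp add: bell_mix_def ampl_kron[OF L] mult.assoc)

text \<open>System \<open>B\<close> holds the ancilla of dimension \<open>m\<close> and one qubit,
  hence the dimensions \<open>m*2\<close> and 2. The operator \<open>X\<close> enters as the
  difference of \<open>X + c 1\<close> and \<open>c 1\<close>. One state and one factor
  \<open>k\<close> serve all channels, because a channel does not change the trace of
  \<open>P + N\<close>.\<close>

lemma exists_state_negativity:
  assumes d: "d > 0" and m: "m > 0" and X: "herm (d*m) X"
  obtains \<rho> k where "density (d*(m*2)*2) \<rho>" "k > 0"
    "\<And>\<Phi>. CPTP d \<Phi> \<Longrightarrow> negativity (d*(m*2)) 2 (ampl \<Phi> d (m*2*2) \<rho>) = k * trace_norm (ampl \<Phi> d m X)"
proof -
  obtain c where c: "c > 0" "psd (d*m) (X + complex_of_real c \<cdot>\<^sub>m 1\<^sub>m (d*m))" by (rule psd_shift[OF X])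
  have Xc: "X \<in> carrier_mat (d*m) (d*m)" using X by (simp add: herm_def)
  define A where "A = X + complex_of_real c \<cdot>\<^sub>m 1\<^sub>m (d*m)"
  define B where "B = complex_of_real c \<cdot>\<^sub>m (1\<^sub>m (d*m) :: complex mat)"
  have A: "psd (d*m) A" and B: "psd (d*m) B" using c by (auto simp: A_def B_def psd_smult psd_one)
  have Ac: "A \<in> carrier_mat (d*m) (d*m)" and Bc: "B \<in> carrier_mat (d*m) (d*m)" using A B psd_carrier by auto
  \<comment> \<open>The trace of the unscaled mixture, as each Bell vector has squared norm 2.
    Dividing by it makes the trace of \<open>P + N\<close> equal to 1/2, and the constants in the
    negativity cancel exactly.\<close>
  define \<tau> where "\<tau> = 2 * Re (mtrace (A + B))"
  have "Re (mtrace B) > 0" using c d m by (simp add: B_def mtrace_smult[of _ "d*m"] mtrace_one)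
  then have tau: "\<tau> > 0" using psd_mtrace[OF A] Ac Bc by (simp add: \<tau>_def mtrace_add[of _ "d*m"])
  define k where "k = 1 / \<tau>"
  define P where "P = complex_of_real k \<cdot>\<^sub>m A"
  define N where "N = complex_of_real k \<cdot>\<^sub>m B"
  have k: "k > 0" using tau by (simp add: k_def)
  have P: "psd (d*m) P" and N: "psd (d*m) N" using A B k by (auto simp: P_def N_def psd_smult)
  have Pc: "P \<in> carrier_mat (d*m) (d*m)" and Nc: "N \<in> carrier_mat (d*m) (d*m)" using P N psd_carrier by auto
  have PN: "P + N = complex_of_real k \<cdot>\<^sub>m (A + B)" unfolding P_def N_def
    using Ac Bc by (intro eq_matI) (auto simp: algebra_simps)
  have "Im (mtrace (A + B)) = 0" using A B by (intro mtrace_herm_real[of "d*m"] herm_add) (auto simp: psd_iff)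
  then have "mtrace (A + B) = complex_of_real (\<tau> / 2)" by (simp add: \<tau>_def complex_eq_iff)
  then have trPN: "mtrace (P + N) = 1 / 2"
    unfolding PN using Ac Bc tau by (simp add: mtrace_smult[of _ "d*m"] k_def)
  have PmN: "P - N = complex_of_real k \<cdot>\<^sub>m X" unfolding P_def N_def A_def B_def
    using Xc by (intro eq_matI) (auto simp: algebra_simps)
  have "density (d*(m*2)*2) (bell_mix P N)"
    unfolding density_def using bell_mix_psd[OF P N] bell_mix_mtrace[OF Pc Nc] trPN by (simp add: mult.assoc)
  moreover have "negativity (d*(m*2)) 2 (ampl \<Phi> d (m*2*2) (bell_mix P N)) = k * trace_norm (ampl \<Phi> d m X)"
    if Phi: "CPTP d \<Phi>" for \<Phi>
  proof -
    note L = ampl_linear[OF CPTP_D(1)[OF Phi], of m]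
    have "ampl \<Phi> d (m*2*2) (bell_mix P N) = bell_mix (ampl \<Phi> d m P) (ampl \<Phi> d m N)"
      using ampl_bell_mix[OF CPTP_D(1)[OF Phi] Pc Nc] by (simp add: mult.assoc)
    then have "negativity (d*(m*2)) 2 (ampl \<Phi> d (m*2*2) (bell_mix P N)) =
        (2 * Re (mtrace (ampl \<Phi> d m P + ampl \<Phi> d m N)) + 2 * trace_norm (ampl \<Phi> d m P - ampl \<Phi> d m N) - 1) / 2"
      using negativity_bell_mix[OF CPTP_D(2)[OF Phi m P] CPTP_D(2)[OF Phi m N]] by (simp add: mult.assoc)
    also have "ampl \<Phi> d m P + ampl \<Phi> d m N = ampl \<Phi> d m (P + N)" using linear_map_onD(2)[OF L Pc Nc] by simp
    also have "mtrace (ampl \<Phi> d m (P + N)) = 1 / 2" using ampl_mtrace[OF Phi, of "P + N" m] trPN Pc Nc by simp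
    also have "ampl \<Phi> d m P - ampl \<Phi> d m N = complex_of_real k \<cdot>\<^sub>m ampl \<Phi> d m X"
      using linear_map_on_minus[OF L Pc Nc] linear_map_onD(3)[OF L Xc] PmN by simp
    also have "trace_norm (complex_of_real k \<cdot>\<^sub>m ampl \<Phi> d m X) = k * trace_norm (ampl \<Phi> d m X)"
      using k by (intro trace_norm_scale[of _ "d*m"]) auto
    finally show ?thesis by simp
  qed
  ultimately show ?thesis using that k by blast
qed

section \<open>Monotonicity of the trace norm along the evolution\<close>

lemma trace_norm_antimono_if_no_increase:
  fixes \<Lambda> :: "real \<Rightarrow> complex mat \<Rightarrow> complex mat"
  assumes d: "d > 0" and C: "\<And>t. t \<ge> 0 \<Longrightarrow> CPTP d (\<Lambda> t)"
    and diff: "\<And>t X i j. t \<ge> 0 \<Longrightarrow> X \<in> carrier_mat d d \<Longrightarrow> i < d \<Longrightarrow> j < d \<Longrightarrow>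
           (\<lambda>s. \<Lambda> s X $$ (i,j)) differentiable (at t within {0..})"
    and no: "\<not> (\<exists>dB dC \<rho> t D. dB > 0 \<and> dC > 0 \<and> density (d*dB*dC) \<rho> \<and> t > 0 \<and> D > 0 \<and>
           ((\<lambda>s. negativity (d*dB) dC (ampl (\<Lambda> s) d (dB*dC) \<rho>)) has_real_derivative D) (at_right t))"
    and st: "0 < s" "s \<le> t" and m: "m > 0" and X: "herm (d*m) X"
  shows "trace_norm (ampl (\<Lambda> t) d m X) \<le> trace_norm (ampl (\<Lambda> s) d m X)"
proof -
  define g where "g = (\<lambda>u. trace_norm (ampl (\<Lambda> u) d m X))"
  have ent: "(\<lambda>u. ampl (\<Lambda> u) d m X $$ (i,j)) differentiable (at u within {0..})"
    if "i < d*m" "j < d*m" "u \<ge> 0" for i j u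
    using that diff[of u "block d m X (i mod m) (j mod m)" "i div m" "j div m"]
    by (simp add: ampl_eq div_index_less)
  have der: "\<exists>D\<le>0. (g has_real_derivative D) (at_right u)" if u: "u > 0" for u
  proof -
    have "(\<lambda>u. ampl (\<Lambda> u) d m X $$ (i,j)) differentiable (at_right u)" if "i < d*m" "j < d*m" for i j
      by (rule differentiable_within_subset[OF ent[OF that]]) (use u in auto)
    then obtain D where D: "(g has_real_derivative D) (at_right u)"
      unfolding g_def using trace_norm_right_differentiable[of "\<lambda>u. ampl (\<Lambda> u) d m X" "d*m" u] by auto
    obtain \<rho> k where r: "density (d*(m*2)*2) \<rho>" "k > 0"
      "\<And>\<Phi>. CPTP d \<Phi> \<Longrightarrow> negativity (d*(m*2)) 2 (ampl \<Phi> d (m*2*2) \<rho>) = k * trace_norm (ampl \<Phi> d m X)"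
      using exists_state_negativity[OF d m X] by metis
    have "((\<lambda>s. k * g s) has_real_derivative k * D) (at_right u)" by (rule DERIV_cmult[OF D])
    then have lim: "((\<lambda>s. (k * g s - k * g u) / (s - u)) \<longlongrightarrow> k * D) (at_right u)"
      by (simp add: has_field_derivative_iff)
    \<comment> \<open>The proportionality to \<open>g\<close> is known at nonnegative times, where
      \<open>\<Lambda> s\<close> is a channel; this covers a right neighbourhood of
      \<open>u\<close>.\<close>
    define f where "f = (\<lambda>s. negativity (d*(m*2)) 2 (ampl (\<Lambda> s) d (m*2*2) \<rho>))"
    have f: "f s = k * g s" if "s \<ge> 0" for s unfolding f_def g_def using r(3)[OF C[OF that]] .
    have "eventually (\<lambda>s. (k * g s - k * g u) / (s - u) = (f s - f u) / (s - u)) (at_right u)"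
      using eventually_at_right_less[of u] by eventually_elim (use u f in simp)
    then have "(f has_real_derivative k * D) (at_right u)"
      unfolding has_field_derivative_iff by (rule Lim_transform_eventually[OF lim])
    then have neg: "((\<lambda>s. negativity (d*(m*2)) 2 (ampl (\<Lambda> s) d (m*2*2) \<rho>)) has_real_derivative k * D) (at_right u)"
      by (simp only: f_def)
    have "\<not> k * D > 0"
    proof
      assume "k * D > 0"
      then have "\<exists>dB dC \<rho> t D. dB > 0 \<and> dC > 0 \<and> density (d*dB*dC) \<rho> \<and> t > 0 \<and> D > 0 \<and>
           ((\<lambda>s. negativity (d*dB) dC (ampl (\<Lambda> s) d (dB*dC) \<rho>)) has_real_derivative D) (at_right t)"
        using neg r(1) u m
        by (intro exI[of _ "m*2"] exI[of _ 2] exI[of _ \<rho>] exI[of _ u] exI[of _ "k * D"] conjI) (simp_all only: zero_less_mult_iff zero_less_numeral simp_thms)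
      then show False using no by simp
    qed
    then have "D \<le> 0" using r(2) by (simp add: zero_less_mult_iff)
    then show ?thesis using D by blast
  qed
  have "continuous_on {s..t} g"
    unfolding continuous_on_def
  proof
    fix u assume u: "u \<in> {s..t}"
    have e: "((\<lambda>v. ampl (\<Lambda> v) d m X $$ (i,j)) \<longlongrightarrow> ampl (\<Lambda> u) d m X $$ (i,j)) (at u within {s..t})"
      if "i < d*m" "j < d*m" for i j
    proof -
      have "continuous (at u within {0..}) (\<lambda>v. ampl (\<Lambda> v) d m X $$ (i,j))"
        using ent[OF that, of u] u st by (auto simp: differentiable_def intro: has_derivative_continuous)
      then show ?thesis using st by (auto simp: continuous_within intro: tendsto_within_subset)
    qed
    have "((\<lambda>v. g v - g u) \<longlongrightarrow> 0) (at u within {s..t})"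
    proof (rule tendsto_0_le)
      show "((\<lambda>v. \<Sum>i<d*m. \<Sum>j<d*m. cmod (ampl (\<Lambda> v) d m X $$ (i,j) - ampl (\<Lambda> u) d m X $$ (i,j))) \<longlongrightarrow> 0) (at u within {s..t})"
        using e by (intro tendsto_null_sum tendsto_norm_zero) (auto simp: LIM_zero_iff)
      show "eventually (\<lambda>v. norm (g v - g u) \<le>
          norm (\<Sum>i<d*m. \<Sum>j<d*m. cmod (ampl (\<Lambda> v) d m X $$ (i,j) - ampl (\<Lambda> u) d m X $$ (i,j))) * 1) (at u within {s..t})"
      proof (intro always_eventually allI)
        fix v
        have "norm (g v - g u) \<le> (\<Sum>i<d*m. \<Sum>j<d*m. cmod (ampl (\<Lambda> v) d m X $$ (i,j) - ampl (\<Lambda> u) d m X $$ (i,j)))"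
          unfolding g_def real_norm_def by (rule trace_norm_lipschitz[OF ampl_carrier ampl_carrier])
        then show "norm (g v - g u) \<le>
          norm (\<Sum>i<d*m. \<Sum>j<d*m. cmod (ampl (\<Lambda> v) d m X $$ (i,j) - ampl (\<Lambda> u) d m X $$ (i,j))) * 1"
          by (simp add: sum_nonneg)
      qed
    qed
    then show "(g \<longlongrightarrow> g u) (at u within {s..t})" by (simp add: LIM_zero_iff)
  qed
  then have "g t \<le> g s"
    by (rule nonincreasing_if_right_derivative_nonpos[OF st(2)]) (use st der in simp)
  then show ?thesis by (simp add: g_def)
qed

section \<open>Matrix units and compactness of the set of channels\<close>

definition munit :: "nat \<Rightarrow> nat \<Rightarrow> nat \<Rightarrow> complex mat" where
  "munit d k l = mat d d (\<lambda>(i,j). if i = k \<and> j = l then 1 else 0)"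

lemma munit_carrier [simp]: "munit d k l \<in> carrier_mat d d"
  by (simp add: munit_def)

lemma linear_map_on_expand:
  assumes L: "linear_map_on d \<Phi>" and X: "X \<in> carrier_mat d d" and ij: "i < d" "j < d"
  shows "\<Phi> X $$ (i,j) = (\<Sum>k<d. \<Sum>l<d. X $$ (k,l) * \<Phi> (munit d k l) $$ (i,j))"
proof -
  \<comment> \<open>\<open>R I\<close> keeps the entries of \<open>X\<close> at the positions in
    \<open>I\<close>, which allows induction on \<open>I\<close> with one matrix unit added at a
    time.\<close>
  define R where "R I = mat d d (\<lambda>p. if p \<in> I then X $$ p else 0)" for I
  have Rc: "R I \<in> carrier_mat d d" for I by (simp add: R_def)
  have "\<Phi> (R I) $$ (i,j) = (\<Sum>p\<in>I. X $$ p * \<Phi> (munit d (fst p) (snd p)) $$ (i,j))"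
    if "finite I" "I \<subseteq> {..<d} \<times> {..<d}" for I
    using that
  proof (induction I rule: finite_induct)
    case empty
    have "R {} = 0\<^sub>m d d" by (rule eq_matI) (auto simp: R_def)
    then show ?case using linear_map_on_zero[OF L] ij by simp
  next
    case (insert p I)
    obtain k l where p: "p = (k,l)" by (cases p)
    have "R (insert p I) = R I + X $$ p \<cdot>\<^sub>m munit d k l"
      using insert.hyps p by (intro eq_matI) (auto simp: R_def munit_def)
    then have "\<Phi> (R (insert p I)) = \<Phi> (R I) + X $$ p \<cdot>\<^sub>m \<Phi> (munit d k l)"
      using linear_map_onD(2)[OF L Rc, of "X $$ p \<cdot>\<^sub>m munit d k l" I]
        linear_map_onD(3)[OF L munit_carrier, of "X $$ p" k l] by simp
    then have "\<Phi> (R (insert p I)) $$ (i,j) = \<Phi> (R I) $$ (i,j) + X $$ p * \<Phi> (munit d k l) $$ (i,j)"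
      using linear_map_onD(1)[OF L Rc, of I] linear_map_onD(1)[OF L munit_carrier, of k l] ij by simp
    then show ?case using insert p by simp
  qed
  note R = this
  have "R ({..<d} \<times> {..<d}) = X" using X by (intro eq_matI) (auto simp: R_def)
  then show ?thesis
    using R[of "{..<d} \<times> {..<d}"] by (simp add: sum.cartesian_product split_def)
qed

text \<open>In finite dimension pointwise convergence of linear maps tolerates a convergent
  argument: both sides are finite sums of products over matrix units.\<close>

lemma joint_limit:
  assumes F: "\<And>n. linear_map_on d (F n)" and G: "linear_map_on d G"
    and FG: "\<And>X i j. X \<in> carrier_mat d d \<Longrightarrow> i < d \<Longrightarrow> j < d \<Longrightarrow> (\<lambda>n. F n X $$ (i,j)) \<longlonglongrightarrow> G X $$ (i,j)"
    and X: "\<And>n. X n \<in> carrier_mat d d" "Y \<in> carrier_mat d d"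
    and XY: "\<And>i j. i < d \<Longrightarrow> j < d \<Longrightarrow> (\<lambda>n. X n $$ (i,j)) \<longlonglongrightarrow> Y $$ (i,j)"
    and ij: "i < d" "j < d"
  shows "(\<lambda>n. F n (X n) $$ (i,j)) \<longlonglongrightarrow> G Y $$ (i,j)"
  unfolding linear_map_on_expand[OF F X(1) ij] linear_map_on_expand[OF G X(2) ij]
  by (intro tendsto_sum tendsto_mult) (auto intro: XY FG ij)

lemma psd_rank_one: "psd n (mat n n (\<lambda>(i,j). w i * cnj (w j)))"
proof -
  have "qform n (mat n n (\<lambda>(i,j). w i * cnj (w j))) v = of_real ((cmod (\<Sum>i<n. cnj (v i) * w i))\<^sup>2)" for v
  proof -
    have "qform n (mat n n (\<lambda>(i,j). w i * cnj (w j))) v = (\<Sum>i<n. \<Sum>j<n. (cnj (v i) * w i) * (cnj (w j) * v j))"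
      unfolding qform_def by (intro sum.cong refl) (simp add: algebra_simps)
    also have "\<dots> = (\<Sum>i<n. cnj (v i) * w i) * (\<Sum>j<n. cnj (w j) * v j)"
      by (simp only: sum_product)
    also have "(\<Sum>j<n. cnj (w j) * v j) = cnj (\<Sum>i<n. cnj (v i) * w i)"
      by (simp add: mult.commute)
    finally show ?thesis by (simp only: complex_norm_square)
  qed
  then show ?thesis by (auto simp: psd_iff herm_iff)
qed

text \<open>The unnormalised maximally entangled operator; its image under \<open>ampl\<close> is
  the Choi matrix of the map. The conjugate of a real factor matches the shape of
  \<open>psd_rank_one\<close>.\<close>

definition max_ent :: "nat \<Rightarrow> complex mat" where
  "max_ent d = mat (d*d) (d*d) (\<lambda>(i,j). (if i div d = i mod d then 1 else 0) * cnj (if j div d = j mod d then 1 else 0))"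

lemma max_ent_psd: "psd (d*d) (max_ent d)"
  unfolding max_ent_def by (rule psd_rank_one)

lemma ampl_max_ent:
  assumes "a < d" "b < d" "k < d" "l < d"
  shows "ampl \<Phi> d d (max_ent d) $$ (a*d + k, b*d + l) = \<Phi> (munit d k l) $$ (a,b)"
proof -
  have "block d d (max_ent d) k l = munit d k l"
    using assms by (intro eq_matI) (auto simp: block_def munit_def max_ent_def pair_index_less)
  then show ?thesis using assms by (simp add: ampl_index)
qed

text \<open>The left side is an entry of the Choi matrix, which is positive with a trace that does
  not depend on the channel.\<close>

lemma CPTP_munit_bound:
  assumes C: "CPTP d \<Phi>" and "a < d" "b < d" "k < d" "l < d"
  shows "cmod (\<Phi> (munit d k l) $$ (a,b)) \<le> Re (mtrace (max_ent d))"
proof -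
  have d: "d > 0" using assms by simp
  have "cmod (ampl \<Phi> d d (max_ent d) $$ (a*d + k, b*d + l)) \<le> Re (mtrace (ampl \<Phi> d d (max_ent d)))"
    using assms by (intro psd_entry_bound[OF CPTP_D(2)[OF C d max_ent_psd]]) (auto intro: pair_index_less)
  then show ?thesis
    using ampl_max_ent[of a d b k l \<Phi>] ampl_mtrace[OF C psd_carrier[OF max_ent_psd]] assms by simp
qed

lemma qform_limit:
  assumes "\<And>i j. i < n \<Longrightarrow> j < n \<Longrightarrow> (\<lambda>k. A k $$ (i,j)) \<longlonglongrightarrow> B $$ (i,j)"
  shows "(\<lambda>k. qform n (A k) v) \<longlonglongrightarrow> qform n B v"
  unfolding qform_def by (intro tendsto_sum tendsto_mult tendsto_const) (auto intro: assms)

lemma herm_limit: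
  assumes A: "\<And>k. herm n (A k)" and B: "B \<in> carrier_mat n n"
    and lim: "\<And>i j. i < n \<Longrightarrow> j < n \<Longrightarrow> (\<lambda>k. A k $$ (i,j)) \<longlonglongrightarrow> B $$ (i,j)"
  shows "herm n B"
  unfolding herm_iff
proof (intro conjI B allI impI)
  fix i j assume ij: "i < n" "j < n"
  have "(\<lambda>k. cnj (A k $$ (i,j))) \<longlonglongrightarrow> cnj (B $$ (i,j))" by (intro tendsto_cnj lim ij)
  then have "(\<lambda>k. A k $$ (j,i)) \<longlonglongrightarrow> cnj (B $$ (i,j))" using herm_index[OF A ij] by simp
  then show "cnj (B $$ (i,j)) = B $$ (j,i)" using lim[OF ij(2,1)] by (rule LIMSEQ_unique)
qed

lemma psd_limit:
  assumes A: "\<And>k. psd n (A k)" and B: "B \<in> carrier_mat n n"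
    and lim: "\<And>i j. i < n \<Longrightarrow> j < n \<Longrightarrow> (\<lambda>k. A k $$ (i,j)) \<longlonglongrightarrow> B $$ (i,j)"
  shows "psd n B"
  unfolding psd_iff
proof (intro conjI allI)
  show "herm n B" using A by (intro herm_limit[OF _ B lim]) (auto simp: psd_iff)
  fix v
  have "(\<lambda>k. Re (qform n (A k) v)) \<longlonglongrightarrow> Re (qform n B v)" by (intro tendsto_Re qform_limit lim)
  then show "0 \<le> Re (qform n B v)" by (rule LIMSEQ_le_const) (use A in \<open>auto simp: psd_iff\<close>)
qed

text \<open>Compactness of the set of channels: the images of matrix units are uniformly bounded,
  and positivity at each level and trace preservation survive limits.\<close>

lemma CPTP_subseq:
  assumes C: "\<And>n. CPTP d (F n)"
  obtains r G where "strict_mono (r :: nat \<Rightarrow> nat)" "CPTP d G"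
    "\<And>X i j. X \<in> carrier_mat d d \<Longrightarrow> i < d \<Longrightarrow> j < d \<Longrightarrow> (\<lambda>n. F (r n) X $$ (i,j)) \<longlonglongrightarrow> G X $$ (i,j)"
proof -
  let ?I = "({..<d} \<times> {..<d}) \<times> ({..<d} \<times> {..<d})"
  obtain r l where r: "strict_mono r"
    and l: "\<forall>p\<in>?I. (\<lambda>n. F (r n) (munit d (fst (fst p)) (snd (fst p))) $$ (snd p)) \<longlonglongrightarrow> l p"
    using finite_family_subseq[of ?I "\<lambda>n p. F n (munit d (fst (fst p)) (snd (fst p))) $$ (snd p)" "Re (mtrace (max_ent d))"]
      CPTP_munit_bound[OF C] by auto
  define G where "G X = mat d d (\<lambda>(i,j). \<Sum>k<d. \<Sum>m<d. X $$ (k,m) * l ((k,m),(i,j)))" for X :: "complex mat"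
  have lim: "(\<lambda>n. F (r n) X $$ (i,j)) \<longlonglongrightarrow> G X $$ (i,j)" if X: "X \<in> carrier_mat d d" and ij: "i < d" "j < d" for X i j
  proof -
    have "(\<lambda>n. \<Sum>k<d. \<Sum>m<d. X $$ (k,m) * F (r n) (munit d k m) $$ (i,j)) \<longlonglongrightarrow> (\<Sum>k<d. \<Sum>m<d. X $$ (k,m) * l ((k,m),(i,j)))"
      using l ij by (intro tendsto_sum tendsto_mult tendsto_const) force
    then show ?thesis using ij by (simp add: linear_map_on_expand[OF CPTP_D(1)[OF C] X ij] G_def)
  qed
  have GL: "linear_map_on d G"
    unfolding linear_map_on_def G_def
    by (auto intro!: eq_matI simp: sum.distrib sum_distrib_left algebra_simps)
  have "psd (d*m) (ampl G d m X)" if m: "m > 0" and X: "psd (d*m) X" for m X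
  proof (rule psd_limit)
    show "psd (d*m) (ampl (F (r n)) d m X)" for n by (rule CPTP_D(2)[OF C m X])
    show "(\<lambda>n. ampl (F (r n)) d m X $$ (i,j)) \<longlonglongrightarrow> ampl G d m X $$ (i,j)" if "i < d*m" "j < d*m" for i j
      using that lim[OF block_carrier div_index_less div_index_less] by (simp add: ampl_eq)
  qed simp
  moreover have "mtrace (G X) = mtrace X" if X: "X \<in> carrier_mat d d" for X
  proof -
    have "(\<lambda>n. mtrace (F (r n) X)) \<longlonglongrightarrow> mtrace (G X)"
      unfolding mtrace_eq[OF CPTP_D(4)[OF C X]] mtrace_eq[OF linear_map_onD(1)[OF GL X]]
      by (intro tendsto_sum) (auto intro: lim X)
    then show ?thesis using CPTP_D(3)[OF C X] by (simp add: LIMSEQ_const_iff)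
  qed
  ultimately have "CPTP d G" using GL by (simp add: CPTP_def)
  then show ?thesis using that[OF r _ lim] by blast
qed

section \<open>Spanning the two-by-two matrices\<close>

lemma square_system_solvable:
  fixes a :: "nat \<Rightarrow> nat \<Rightarrow> complex"
  assumes inj: "\<And>x. (\<And>i. i < n \<Longrightarrow> (\<Sum>j<n. a i j * x j) = 0) \<Longrightarrow> (\<And>j. j < n \<Longrightarrow> x j = 0)"
  obtains x where "\<And>i. i < n \<Longrightarrow> (\<Sum>j<n. a i j * x j) = b i"
proof -
  define A where "A = mat n n (\<lambda>(i,j). a i j)"
  have A: "A \<in> carrier_mat n n" by (simp add: A_def)
  have mv: "(A *\<^sub>v v) $ i = (\<Sum>j<n. a i j * v $ j)" if "v \<in> carrier_vec n" "i < n" for v i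
    using that by (simp add: A_def scalar_prod_def atLeast0LessThan)
  have "det A \<noteq> 0"
  proof
    assume "det A = 0"
    then obtain v where v: "v \<in> carrier_vec n" "v \<noteq> 0\<^sub>v n" "A *\<^sub>v v = 0\<^sub>v n"
      using det_0_iff_vec_prod_zero[OF A] by auto
    have "(\<Sum>j<n. a i j * v $ j) = 0" if "i < n" for i using mv[OF v(1) that] v(3) that by simp
    then have "v $ j = 0" if "j < n" for j using inj[of "\<lambda>j. v $ j"] that by blast
    then have "v = 0\<^sub>v n" using v(1) by (intro eq_vecI) auto
    then show False using v(2) by simp
  qed
  then obtain B where B: "B \<in> carrier_mat n n" "A * B = 1\<^sub>m n"
    using det_non_zero_imp_unit[OF A, of "()"] by (auto simp: Units_def ring_mat_def)
  define x where "x = B *\<^sub>v vec n b"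
  have xc: "x \<in> carrier_vec n" using B by (simp add: x_def)
  have "A *\<^sub>v x = (A * B) *\<^sub>v vec n b" unfolding x_def using A B(1) by (intro assoc_mult_mat_vec[symmetric]) auto
  then have "A *\<^sub>v x = vec n b" unfolding B(2) by simp
  then have "(\<Sum>j<n. a i j * x $ j) = b i" if "i < n" for i using mv[OF xc that] that by simp
  then show ?thesis using that[of "\<lambda>j. x $ j"] by blast
qed

text \<open>Flattening the entries turns this into a square system of size four. It serves to invert
  injective maps and to complete a three-dimensional range to a basis.\<close>

lemma spanning_if_independent_2x2:
  fixes B :: "nat \<Rightarrow> complex mat"
  assumes ind: "\<And>c. (\<And>i j. i < 2 \<Longrightarrow> j < 2 \<Longrightarrow> (\<Sum>k<4. c k * B k $$ (i,j)) = 0) \<Longrightarrow> (\<And>k. k < 4 \<Longrightarrow> c k = 0)"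
  obtains c where "\<And>i j. i < 2 \<Longrightarrow> j < 2 \<Longrightarrow> (\<Sum>k<4. c k * B k $$ (i,j)) = Y $$ (i,j)"
proof -
  define a where "a p k = B k $$ (p div 2, p mod 2)" for p k :: nat
  have *: "x k = 0" if z: "\<And>p. p < 4 \<Longrightarrow> (\<Sum>k<4. a p k * x k) = 0" and k: "k < 4" for x k
  proof (rule ind[OF _ k])
    fix i j :: nat assume "i < 2" "j < 2"
    then have "2 * i + j < 4" "(2 * i + j) div 2 = i" "(2 * i + j) mod 2 = j" by auto
    then show "(\<Sum>k<4. x k * B k $$ (i,j)) = 0" using z[of "2 * i + j"] by (simp add: a_def mult.commute)
  qed
  obtain x where x: "\<And>p. p < 4 \<Longrightarrow> (\<Sum>k<4. a p k * x k) = Y $$ (p div 2, p mod 2)"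
  proof (rule square_system_solvable[of 4 a "\<lambda>p. Y $$ (p div 2, p mod 2)"])
    show "x j = 0" if "\<And>i. i < 4 \<Longrightarrow> (\<Sum>j<4. a i j * x j) = 0" "j < 4" for x j
      using that by (rule *)
  qed (rule that)
  have "(\<Sum>k<4. x k * B k $$ (i,j)) = Y $$ (i,j)" if "i < 2" "j < 2" for i j
  proof -
    have "2 * i + j < 4" "(2 * i + j) div 2 = i" "(2 * i + j) mod 2 = j" using that by auto
    then show ?thesis using x[of "2 * i + j"] by (simp add: a_def mult.commute)
  qed
  then show ?thesis using that by blast
qed

lemma linear_map_on_2_bij:
  assumes L: "linear_map_on 2 \<Phi>" and inj: "\<And>X. X \<in> carrier_mat 2 2 \<Longrightarrow> \<Phi> X = 0\<^sub>m 2 2 \<Longrightarrow> X = 0\<^sub>m 2 2"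
  shows "bij_betw \<Phi> (carrier_mat 2 2) (carrier_mat 2 2)"
proof -
  have two: "{..<2::nat} = {0, 1}" by auto
  define B where "B k = \<Phi> (munit 2 (k div 2) (k mod 2))" for k
  define X where "X c = mat 2 2 (\<lambda>(i,j). c (2 * i + j))" for c :: "nat \<Rightarrow> complex"
  have Xc: "X c \<in> carrier_mat 2 2" for c by (simp add: X_def)
  have BX: "(\<Sum>k<4. c k * B k $$ (i,j)) = \<Phi> (X c) $$ (i,j)" if "i < 2" "j < 2" for c i j
    unfolding linear_map_on_expand[OF L Xc that]
    by (simp add: sum4 B_def X_def two numeral_2_eq_2[symmetric] numeral_3_eq_3[symmetric])
  have "c k = 0" if z: "\<And>i j. i < 2 \<Longrightarrow> j < 2 \<Longrightarrow> (\<Sum>k<4. c k * B k $$ (i,j)) = 0" and k: "k < 4" for c k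
  proof -
    have "\<Phi> (X c) = 0\<^sub>m 2 2"
      using z BX linear_map_onD(1)[OF L Xc, of c] by (intro eq_matI) auto
    then have "X c = 0\<^sub>m 2 2" by (rule inj[OF Xc])
    then have "X c $$ (k div 2, k mod 2) = 0" using k by simp
    then show ?thesis using k by (simp add: X_def)
  qed
  note ind = this
  have "\<exists>Z\<in>carrier_mat 2 2. \<Phi> Z = Y" if Y: "Y \<in> carrier_mat 2 2" for Y
  proof -
    obtain c where "\<And>i j. i < 2 \<Longrightarrow> j < 2 \<Longrightarrow> (\<Sum>k<4. c k * B k $$ (i,j)) = Y $$ (i,j)"
    proof (rule spanning_if_independent_2x2[of B Y])
      show "c k = 0" if "\<And>i j. i < 2 \<Longrightarrow> j < 2 \<Longrightarrow> (\<Sum>k<4. c k * B k $$ (i,j)) = 0" "k < 4" for c k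
        using that by (rule ind)
    qed (rule that)
    then have "\<Phi> (X c) = Y" using Y BX linear_map_onD(1)[OF L Xc, of c] by (intro eq_matI) auto
    then show ?thesis using Xc by blast
  qed
  moreover have "inj_on \<Phi> (carrier_mat 2 2)"
  proof (rule inj_onI)
    fix Y Z :: "complex mat" assume YZ: "Y \<in> carrier_mat 2 2" "Z \<in> carrier_mat 2 2" "\<Phi> Y = \<Phi> Z"
    have "\<Phi> (Y - Z) = 0\<^sub>m 2 2"
      unfolding linear_map_on_minus[OF L YZ(1,2)] YZ(3) using minus_r_inv_mat[OF linear_map_onD(1)[OF L YZ(2)]] .
    then have "Y - Z = 0\<^sub>m 2 2" by (rule inj[OF minus_carrier_mat[OF YZ(2)]])
    then have "(Y - Z) $$ (i,j) = 0" if "i < 2" "j < 2" for i j using that by simp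
    then show "Y = Z" using YZ by (intro eq_matI) auto
  qed
  ultimately show ?thesis using linear_map_onD(1)[OF L] by (auto simp: bij_betw_def)
qed

section \<open>There is no channel projecting onto a three-dimensional space of qubit operators\<close>

text \<open>If \<open>V X = X - g(X) K\<close> with \<open>g(K) = 1\<close>, then the Choi matrix of \<open>V\<close> has the value
  \<open>- tr (K\<^sup>2) / 2\<close> at the vector of entries of \<open>K\<close>, because \<open>K\<^sup>3 = (tr (K\<^sup>2) / 2) K\<close>
  for a traceless Hermitian \<open>K\<close>.\<close>

lemma no_rank_three_projector:
  assumes V: "CPTP 2 V" and K: "herm 2 K" "K \<noteq> 0\<^sub>m 2 2" "V K = 0\<^sub>m 2 2"
    and dec: "\<And>X. X \<in> carrier_mat 2 2 \<Longrightarrow> \<exists>g Z. Z \<in> carrier_mat 2 2 \<and> V Z = Z \<and> X = Z + g \<cdot>\<^sub>m K"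
  shows False
proof -
  have Kc: "K \<in> carrier_mat 2 2" using K by (simp add: herm_def)
  note L = CPTP_D(1)[OF V]
  have two: "{..<2::nat} = {0, 1}" by auto
  obtain g where g: "\<And>k l i j. i < 2 \<Longrightarrow> j < 2 \<Longrightarrow>
      V (munit 2 k l) $$ (i,j) = munit 2 k l $$ (i,j) - g k l * K $$ (i,j)"
  proof -
    have "\<exists>g. \<forall>i<2. \<forall>j<2. V (munit 2 k l) $$ (i,j) = munit 2 k l $$ (i,j) - g * K $$ (i,j)" for k l
    proof -
      obtain g Z where Z: "Z \<in> carrier_mat 2 2" "V Z = Z" "munit 2 k l = Z + g \<cdot>\<^sub>m K"
        using dec[OF munit_carrier] by blast
      have "V (munit 2 k l) = Z + g \<cdot>\<^sub>m 0\<^sub>m 2 2"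
        unfolding Z(3) using linear_map_onD(2)[OF L Z(1), of "g \<cdot>\<^sub>m K"] linear_map_onD(3)[OF L Kc, of g] Kc Z(2) K(3) by simp
      then show ?thesis using Z Kc by (intro exI[of _ g]) auto
    qed
    then show ?thesis using that by metis
  qed
  define p where "p = K $$ (0,0)"
  define q where "q = K $$ (0,1)"
  \<comment> \<open>\<open>V\<close> preserves the trace and annihilates \<open>K\<close>.\<close>
  have "mtrace K = 0" using CPTP_D(3)[OF V Kc] K(3) by (simp add: mtrace_def)
  then have K11: "K $$ (1,1) = - p" using Kc by (simp add: mtrace_eq[of _ 2] two p_def add_eq_0_iff)
  have K10: "K $$ (1,0) = cnj q" using herm_index[OF K(1), of 0 1] by (simp add: q_def)
  have pr: "cnj p = p" using herm_index[OF K(1), of 0 0] by (simp add: p_def)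
  have Ke: "K $$ (0,0) = p" "K $$ (0,Suc 0) = q" "K $$ (Suc 0,0) = cnj q" "K $$ (Suc 0,Suc 0) = - p"
    using K10 K11 by (simp_all add: p_def q_def)
  \<comment> \<open>This is g(K). Since \<open>V K\<close> is \<open>(1 - S)\<close> times
    \<open>K\<close> and vanishes while \<open>K\<close> does not, it must equal 1.\<close>
  define S where "S = g 0 0 * p + g 0 1 * q + g 1 0 * cnj q - g 1 1 * p"
  have VK: "0 = K $$ (i,j) - S * K $$ (i,j)" if ij: "i < 2" "j < 2" for i j
  proof -
    have "0 = V K $$ (i,j)" using K(3) ij by simp
    also have "\<dots> = (\<Sum>k<2. \<Sum>l<2. K $$ (k,l) * (munit 2 k l $$ (i,j) - g k l * K $$ (i,j)))"
      unfolding linear_map_on_expand[OF L Kc ij] using g[OF ij] by simp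
    also have "\<dots> = K $$ (i,j) - S * K $$ (i,j)"
      using ij by (auto simp: two munit_def S_def Ke less_2_cases_iff algebra_simps)
    finally show ?thesis .
  qed
  have S1: "S = 1"
  proof (rule ccontr)
    assume S: "S \<noteq> 1"
    have "K $$ (i,j) = 0" if ij: "i < 2" "j < 2" for i j
    proof -
      have "(1 - S) * K $$ (i,j) = 0" using VK[OF ij] by (simp add: algebra_simps)
      then show ?thesis using S by simp
    qed
    then have "K = 0\<^sub>m 2 2" using Kc by (intro eq_matI) auto
    then show False using K(2) by simp
  qed
  define v where "v i = K $$ (i div 2, i mod 2)" for i
  have "qform (2*2) (ampl V 2 2 (max_ent 2)) v =
     (\<Sum>a<2. \<Sum>k<2. \<Sum>b<2. \<Sum>l<2. cnj (K $$ (a,k)) * (munit 2 k l $$ (a,b) - g k l * K $$ (a,b)) * K $$ (b,l))"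
    unfolding qform_def sum_pair_index
    by (intro sum.cong refl) (simp add: ampl_max_ent g v_def)
  also have "\<dots> = - ((p * p + q * cnj q) * S)"
    by (simp add: two munit_def S_def Ke pr algebra_simps)
  finally have qf: "qform (2*2) (ampl V 2 2 (max_ent 2)) v = - (p * p + q * cnj q)" using S1 by simp
  have "0 \<le> Re (qform (2*2) (ampl V 2 2 (max_ent 2)) v)"
    using CPTP_D(2)[OF V, of 2 "max_ent 2"] max_ent_psd[of 2] by (simp add: psd_iff)
  moreover have "Re (p * p + q * cnj q) = (cmod p)\<^sup>2 + (cmod q)\<^sup>2"
    using pr by (metis complex_norm_square of_real_add Re_complex_of_real)
  ultimately have "(cmod p)\<^sup>2 + (cmod q)\<^sup>2 \<le> 0" unfolding qf by simp
  then have "p = 0" "q = 0" by (auto simp: sum_power2_le_zero_iff)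
  then have "K = 0\<^sub>m 2 2"
    using Kc Ke by (intro eq_matI) (auto simp: less_2_cases_iff)
  then show False using K(2) by simp
qed

section \<open>The first time at which a qubit evolution is not injective\<close>

definition entry_sum :: "nat \<Rightarrow> complex mat \<Rightarrow> real" where
  "entry_sum n X = (\<Sum>i<n. \<Sum>j<n. cmod (X $$ (i,j)))"

lemma entry_sum_pos:
  assumes X: "X \<in> carrier_mat n n" and X0: "X \<noteq> 0\<^sub>m n n"
  shows "entry_sum n X > 0"
proof (rule ccontr)
  assume "\<not> entry_sum n X > 0"
  then have "entry_sum n X = 0" using sum_nonneg[of "{..<n}"] by (simp add: entry_sum_def sum_nonneg order_antisym)
  then have "X $$ (i,j) = 0" if "i < n" "j < n" for i j
    using that by (auto simp: entry_sum_def sum_nonneg sum_nonneg_eq_0_iff)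
  then have "X = 0\<^sub>m n n" using X by (intro eq_matI) auto
  then show False using X0 by simp
qed

text \<open>Rescaling nonzero matrices to entry sum 1 keeps their limit points away from
  zero.\<close>

definition normalized :: "nat \<Rightarrow> complex mat \<Rightarrow> complex mat" where
  "normalized n X = complex_of_real (1 / entry_sum n X) \<cdot>\<^sub>m X"

lemma normalized_carrier [simp]: "X \<in> carrier_mat n n \<Longrightarrow> normalized n X \<in> carrier_mat n n"
  by (simp add: normalized_def)

lemma entry_sum_normalized:
  assumes X: "X \<in> carrier_mat n n" and X0: "X \<noteq> 0\<^sub>m n n"
  shows "entry_sum n (normalized n X) = 1"
proof -
  have p: "entry_sum n X > 0" by (rule entry_sum_pos[OF assms])
  have "entry_sum n (normalized n X) = (\<Sum>i<n. \<Sum>j<n. cmod (X $$ (i,j)) / entry_sum n X)"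
    unfolding entry_sum_def[of n "normalized n X"]
    using X p by (intro sum.cong refl) (simp add: normalized_def norm_mult norm_divide)
  also have "\<dots> = entry_sum n X / entry_sum n X"
    by (subst (2) entry_sum_def) (simp add: sum_divide_distrib)
  finally show ?thesis using p by simp
qed

lemma normalized_subseq:
  assumes X: "\<And>k. X k \<in> carrier_mat n n" "\<And>k. entry_sum n (X k) = 1"
  obtains r Y where "strict_mono (r :: nat \<Rightarrow> nat)" "Y \<in> carrier_mat n n" "Y \<noteq> 0\<^sub>m n n"
    "\<And>i j. i < n \<Longrightarrow> j < n \<Longrightarrow> (\<lambda>k. X (r k) $$ (i,j)) \<longlonglongrightarrow> Y $$ (i,j)"
proof -
  have le: "cmod (X k $$ (i,j)) \<le> 1" if "i < n" "j < n" for k i j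
  proof -
    have "cmod (X k $$ (i,j)) \<le> (\<Sum>j<n. cmod (X k $$ (i,j)))" using that by (intro member_le_sum) auto
    also have "\<dots> \<le> entry_sum n (X k)" unfolding entry_sum_def
      using that by (intro member_le_sum) (auto intro: sum_nonneg)
    finally show ?thesis using X(2) by simp
  qed
  obtain r l where r: "strict_mono r" "\<forall>p\<in>{..<n}\<times>{..<n}. (\<lambda>k. X (r k) $$ p) \<longlonglongrightarrow> l p"
    using finite_family_subseq[of "{..<n}\<times>{..<n}" "\<lambda>k p. X k $$ p" 1] le by auto
  define Y where "Y = mat n n l"
  have lim: "(\<lambda>k. X (r k) $$ (i,j)) \<longlonglongrightarrow> Y $$ (i,j)" if "i < n" "j < n" for i j
    using r(2) that by (simp add: Y_def)
  have "(\<lambda>k. entry_sum n (X (r k))) \<longlonglongrightarrow> entry_sum n Y"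
    unfolding entry_sum_def by (intro tendsto_sum tendsto_norm) (auto intro: lim)
  then have "entry_sum n Y = 1" using X(2) by (simp add: LIMSEQ_const_iff)
  then have "Y \<noteq> 0\<^sub>m n n" by (auto simp: entry_sum_def)
  moreover have "Y \<in> carrier_mat n n" by (simp add: Y_def)
  ultimately show ?thesis using that[OF r(1)] lim by blast
qed

lemma herm_parts_zero:
  assumes A: "herm n A" and B: "herm n B" and z: "A + \<i> \<cdot>\<^sub>m B = 0\<^sub>m n n"
  shows "A = 0\<^sub>m n n" "B = 0\<^sub>m n n"
proof -
  have c: "A \<in> carrier_mat n n" "B \<in> carrier_mat n n" using A B by (auto simp: herm_def)
  have "A $$ (i,j) = 0 \<and> B $$ (i,j) = 0" if ij: "i < n" "j < n" for i j
  proof -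
    have e: "A $$ (k,l) + \<i> * B $$ (k,l) = 0" if "k < n" "l < n" for k l
      using arg_cong[OF z, of "\<lambda>M. M $$ (k,l)"] that c by simp
    have "A $$ (i,j) - \<i> * B $$ (i,j) = 0"
      using arg_cong[OF e[OF ij(2,1)], of cnj] herm_index[OF A ij(2,1)] herm_index[OF B ij(2,1)] by simp
    with e[OF ij] have "2 * A $$ (i,j) = 0" by (simp add: algebra_simps)
    then show ?thesis using e[OF ij] by simp
  qed
  then show "A = 0\<^sub>m n n" "B = 0\<^sub>m n n" using c by (auto intro!: eq_matI)
qed

text \<open>Channels respect Hermitian parts, so a nontrivial kernel contains a nonzero Hermitian
  element, to which contraction applies.\<close>

lemma CPTP_kernel_parts:
  assumes C: "CPTP d \<Phi>" and A: "herm d A" and B: "herm d B" and z: "\<Phi> (A + \<i> \<cdot>\<^sub>m B) = 0\<^sub>m d d"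
  shows "\<Phi> A = 0\<^sub>m d d" "\<Phi> B = 0\<^sub>m d d"
proof -
  note L = CPTP_D(1)[OF C]
  have c: "A \<in> carrier_mat d d" "B \<in> carrier_mat d d" using A B by (auto simp: herm_def)
  have "\<Phi> A + \<i> \<cdot>\<^sub>m \<Phi> B = 0\<^sub>m d d"
    using z linear_map_onD(2)[OF L c(1), of "\<i> \<cdot>\<^sub>m B"] linear_map_onD(3)[OF L c(2), of \<i>] c by simp
  then show "\<Phi> A = 0\<^sub>m d d" "\<Phi> B = 0\<^sub>m d d"
    using herm_parts_zero[OF CPTP_herm[OF C A] CPTP_herm[OF C B]] by auto
qed

text \<open>Differentiability enters the limit arguments in the form of continuity, and
  \<open>contractive\<close> is what follows if no negativity ever has a positive right
  derivative.\<close>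

locale contractive_qubit_evolution =
  fixes \<Lambda> :: "real \<Rightarrow> complex mat \<Rightarrow> complex mat"
  assumes channel: "\<And>t. t \<ge> 0 \<Longrightarrow> CPTP 2 (\<Lambda> t)"
    and initial: "\<And>X. X \<in> carrier_mat 2 2 \<Longrightarrow> \<Lambda> 0 X = X"
    and cont: "\<And>t X i j. t \<ge> 0 \<Longrightarrow> X \<in> carrier_mat 2 2 \<Longrightarrow> i < 2 \<Longrightarrow> j < 2 \<Longrightarrow>
           continuous (at t within {0..}) (\<lambda>s. \<Lambda> s X $$ (i,j))"
    and contractive: "\<And>s t m X. 0 < s \<Longrightarrow> s \<le> t \<Longrightarrow> m > 0 \<Longrightarrow> herm (2*m) X \<Longrightarrow>
           trace_norm (ampl (\<Lambda> t) 2 m X) \<le> trace_norm (ampl (\<Lambda> s) 2 m X)"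
begin

lemma linear: "t \<ge> 0 \<Longrightarrow> linear_map_on 2 (\<Lambda> t)"
  by (rule CPTP_D(1)[OF channel])

lemma contractive_one:
  assumes st: "0 < s" "s \<le> t" and X: "herm 2 X"
  shows "trace_norm (\<Lambda> t X) \<le> trace_norm (\<Lambda> s X)"
proof -
  have Xc: "X \<in> carrier_mat 2 2" using X by (simp add: herm_def)
  have "ampl (\<Lambda> u) 2 1 X = \<Lambda> u X" if "u \<ge> 0" for u
    using ampl_one[OF Xc, of "\<Lambda> u"] CPTP_D(4)[OF channel[OF that] Xc] by blast
  then show ?thesis using contractive[OF st, of 1 X] X st by simp
qed

text \<open>Contraction bounds the norm of the later image by zero, for the two Hermitian parts
  separately.\<close>

lemma kernel_mono:
  assumes st: "0 < s" "s \<le> t" and X: "X \<in> carrier_mat 2 2" and z: "\<Lambda> s X = 0\<^sub>m 2 2"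
  shows "\<Lambda> t X = 0\<^sub>m 2 2"
proof -
  have s: "CPTP 2 (\<Lambda> s)" and t: "CPTP 2 (\<Lambda> t)" using channel st by auto
  obtain A B where AB: "herm 2 A" "herm 2 B" and XAB: "X = A + \<i> \<cdot>\<^sub>m B" by (rule herm_decomp[OF X])
  have c: "A \<in> carrier_mat 2 2" "B \<in> carrier_mat 2 2" using AB by (auto simp: herm_def)
  have h: "\<Lambda> t H = 0\<^sub>m 2 2" if H: "herm 2 H" "\<Lambda> s H = 0\<^sub>m 2 2" for H
  proof -
    have Hc: "\<Lambda> t H \<in> carrier_mat 2 2" using CPTP_D(4)[OF t] H by (simp add: herm_def)
    have "trace_norm (\<Lambda> t H) \<le> 0"
      using contractive_one[OF st H(1)] by (simp add: H(2) trace_norm_zero_mat)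
    then have "trace_norm (\<Lambda> t H) = 0" using trace_norm_nonneg[OF Hc] by simp
    then show ?thesis by (rule trace_norm_zero[OF Hc])
  qed
  have "\<Lambda> t A = 0\<^sub>m 2 2" "\<Lambda> t B = 0\<^sub>m 2 2"
    using h CPTP_kernel_parts[OF s AB] z AB XAB by auto
  then show ?thesis
    unfolding XAB using linear_map_onD(2)[OF CPTP_D(1)[OF t] c(1), of "\<i> \<cdot>\<^sub>m B"]
      linear_map_onD(3)[OF CPTP_D(1)[OF t] c(2), of \<i>] c by (auto intro!: eq_matI)
qed

lemma seq_continuous:
  assumes "s \<ge> 0" "\<And>n. u n \<ge> 0" "u \<longlonglongrightarrow> s" "X \<in> carrier_mat 2 2" "i < 2" "j < 2"
  shows "(\<lambda>n. \<Lambda> (u n) X $$ (i,j)) \<longlonglongrightarrow> \<Lambda> s X $$ (i,j)"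
  using continuous_within_tendsto_compose'[OF cont[OF assms(1,4,5,6)], of u sequentially] assms by auto

definition injective_at :: "real \<Rightarrow> bool" where
  "injective_at s \<longleftrightarrow> (\<forall>X\<in>carrier_mat 2 2. \<Lambda> s X = 0\<^sub>m 2 2 \<longrightarrow> X = 0\<^sub>m 2 2)"

lemma factor_if_injective:
  assumes st: "0 < s" "s \<le> t" and inj: "injective_at s"
  shows "\<exists>V. CPTP 2 V \<and> (\<forall>X\<in>carrier_mat 2 2. \<Lambda> t X = V (\<Lambda> s X))"
proof (rule CPTP_factor_of_bij)
  show "CPTP 2 (\<Lambda> s)" "CPTP 2 (\<Lambda> t)" using channel st by auto
  show "bij_betw (\<Lambda> s) (carrier_mat 2 2) (carrier_mat 2 2)"
    using inj linear st by (intro linear_map_on_2_bij) (auto simp: injective_at_def)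
qed (use contractive[OF st] in blast)

text \<open>Normalised kernel elements at the times \<open>u n\<close> have a nonzero limit point,
  which continuity puts into the kernel at \<open>s\<close>.\<close>

lemma not_injective_limit:
  assumes s: "s \<ge> 0" "\<And>n. u n \<ge> 0" "u \<longlonglongrightarrow> s" and ni: "\<And>n. \<not> injective_at (u n)"
  shows "\<not> injective_at s"
proof -
  have "\<exists>X\<in>carrier_mat 2 2. \<Lambda> (u n) X = 0\<^sub>m 2 2 \<and> X \<noteq> 0\<^sub>m 2 2" for n
    using ni[of n] by (auto simp: injective_at_def)
  then obtain X where X: "\<And>n. X n \<in> carrier_mat 2 2" "\<And>n. \<Lambda> (u n) (X n) = 0\<^sub>m 2 2" "\<And>n. X n \<noteq> 0\<^sub>m 2 2"
    by metis
  define Z where "Z n = normalized 2 (X n)" for n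
  have Z: "Z n \<in> carrier_mat 2 2" "entry_sum 2 (Z n) = 1" for n
    using X entry_sum_normalized by (auto simp: Z_def)
  have LZ: "\<Lambda> (u n) (Z n) = 0\<^sub>m 2 2" for n
    using linear_map_onD(3)[OF linear[OF s(2)[of n]] X(1)[of n]] X(2)[of n]
    by (auto simp: Z_def normalized_def intro!: eq_matI)
  obtain r Y where r: "strict_mono r" "Y \<in> carrier_mat 2 2" "Y \<noteq> 0\<^sub>m 2 2"
    "\<And>i j. i < 2 \<Longrightarrow> j < 2 \<Longrightarrow> (\<lambda>k. Z (r k) $$ (i,j)) \<longlonglongrightarrow> Y $$ (i,j)"
    using normalized_subseq[of Z 2, OF Z] by blast
  have ur: "(\<lambda>k. u (r k)) \<longlonglongrightarrow> s" using LIMSEQ_subseq_LIMSEQ[OF s(3) r(1)] by (simp add: o_def)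
  have "\<Lambda> s Y $$ (i,j) = 0" if ij: "i < 2" "j < 2" for i j
  proof -
    have "(\<lambda>k. \<Lambda> (u (r k)) (Z (r k)) $$ (i,j)) \<longlonglongrightarrow> \<Lambda> s Y $$ (i,j)"
      by (rule joint_limit[of 2 "\<lambda>k. \<Lambda> (u (r k))" "\<Lambda> s"]) (use s ur r Z ij linear seq_continuous in auto)
    then show ?thesis using LZ ij by (simp add: LIMSEQ_const_iff)
  qed
  then have "\<Lambda> s Y = 0\<^sub>m 2 2" using linear_map_onD(1)[OF linear[OF s(1)] r(2)] by (intro eq_matI) auto
  then show ?thesis using r by (auto simp: injective_at_def)
qed

text \<open>Singularity passes to limits, so the infimum of the singular times is itself singular.
  It is not 0, because \<open>\<Lambda> 0\<close> is the identity.\<close>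

lemma first_singular_time:
  assumes "s0 > 0" "\<not> injective_at s0"
  obtains t1 where "0 < t1" "t1 \<le> s0" "\<not> injective_at t1" "\<And>s. 0 < s \<Longrightarrow> s < t1 \<Longrightarrow> injective_at s"
proof -
  define N where "N = {s. s > 0 \<and> \<not> injective_at s}"
  have ne: "N \<noteq> {}" using assms by (auto simp: N_def)
  have bd: "bdd_below N" by (auto simp: N_def bdd_below_def intro!: exI[of _ 0])
  define t1 where "t1 = Inf N"
  have t1: "t1 \<ge> 0" unfolding t1_def using ne by (intro cInf_greatest) (auto simp: N_def)
  have "\<exists>s\<in>N. s < t1 + 1 / real (Suc n)" for n
    using cInf_less_iff[OF ne bd, of "t1 + 1 / real (Suc n)"] by (simp add: t1_def)
  then obtain u where u: "\<And>n. u n \<in> N" "\<And>n. u n < t1 + 1 / real (Suc n)" by metis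
  have ge: "t1 \<le> u n" for n unfolding t1_def using u(1) bd by (intro cInf_lower)
  have lim: "u \<longlonglongrightarrow> t1"
  proof (rule tendsto_sandwich)
    show "(\<lambda>n. t1) \<longlonglongrightarrow> t1" by simp
    show "(\<lambda>n. t1 + 1 / real (Suc n)) \<longlonglongrightarrow> t1"
      using tendsto_add[OF tendsto_const LIMSEQ_inverse_real_of_nat, of t1] by (simp add: inverse_eq_divide)
  qed (use ge u(2) in \<open>auto intro!: always_eventually less_imp_le\<close>)
  have ni: "\<not> injective_at t1"
    by (rule not_injective_limit[OF t1 _ lim]) (use u(1) in \<open>auto simp: N_def less_imp_le\<close>)
  have "t1 \<noteq> 0" using ni initial by (auto simp: injective_at_def)
  moreover have "t1 \<le> s0" unfolding t1_def using assms bd by (intro cInf_lower) (auto simp: N_def)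
  moreover have "injective_at s" if "0 < s" "s < t1" for s
  proof (rule ccontr)
    assume "\<not> injective_at s"
    then have "s \<in> N" using that by (simp add: N_def)
    then have "t1 \<le> s" unfolding t1_def using bd by (rule cInf_lower)
    then show False using that by simp
  qed
  ultimately show ?thesis using that[of t1] t1 ni by simp
qed

text \<open>The factors \<open>V\<close> with \<open>\<Lambda> t1 = V \<circ> \<Lambda> s\<close> accumulate, as \<open>s\<close> increases to \<open>t1\<close>, at a channel which fixes the
  range of \<open>\<Lambda> t1\<close> but is still singular.\<close>

lemma singular_fixing_channel:
  assumes t1: "0 < t1" "\<not> injective_at t1" and inj: "\<And>s. 0 < s \<Longrightarrow> s < t1 \<Longrightarrow> injective_at s"
  obtains V K where "CPTP 2 V" "herm 2 K" "K \<noteq> 0\<^sub>m 2 2" "V K = 0\<^sub>m 2 2"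
    "\<And>X. X \<in> carrier_mat 2 2 \<Longrightarrow> V (\<Lambda> t1 X) = \<Lambda> t1 X"
proof -
  have C1: "CPTP 2 (\<Lambda> t1)" using channel t1 by simp
  obtain X where X: "X \<in> carrier_mat 2 2" "\<Lambda> t1 X = 0\<^sub>m 2 2" "X \<noteq> 0\<^sub>m 2 2"
    using t1 by (auto simp: injective_at_def)
  obtain A B where AB: "herm 2 A" "herm 2 B" and XAB: "X = A + \<i> \<cdot>\<^sub>m B" by (rule herm_decomp[OF X(1)])
  have "\<Lambda> t1 A = 0\<^sub>m 2 2" "\<Lambda> t1 B = 0\<^sub>m 2 2" using CPTP_kernel_parts[OF C1 AB] X(2) XAB by auto
  moreover have "A \<noteq> 0\<^sub>m 2 2 \<or> B \<noteq> 0\<^sub>m 2 2" using X(3) XAB by (auto intro!: eq_matI)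
  ultimately obtain K0 where K0: "herm 2 K0" "K0 \<noteq> 0\<^sub>m 2 2" "\<Lambda> t1 K0 = 0\<^sub>m 2 2" using AB by blast
  have K0c: "K0 \<in> carrier_mat 2 2" using K0 by (simp add: herm_def)
  \<comment> \<open>The shift by two starts the sequence at \<open>t1 / 2\<close>, so all its times
    lie strictly between 0 and \<open>t1\<close>, where the evolution is injective.\<close>
  define u where "u n = t1 * (1 - inverse (real (Suc (Suc n))))" for n
  have u: "0 < u n" "u n < t1" for n
  proof -
    have "inverse (real (Suc (Suc n))) < 1" by (simp add: field_simps)
    then show "0 < u n" using t1 by (simp add: u_def)
    show "u n < t1" using t1 by (simp add: u_def)
  qed
  have "(\<lambda>n. t1 * (1 - inverse (real (Suc (Suc n))))) \<longlonglongrightarrow> t1 * (1 - 0)"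
    by (intro tendsto_mult tendsto_diff tendsto_const LIMSEQ_Suc[OF LIMSEQ_inverse_real_of_nat])
  then have ulim: "u \<longlonglongrightarrow> t1" by (simp add: u_def[abs_def])
  have "\<exists>V. CPTP 2 V \<and> (\<forall>X\<in>carrier_mat 2 2. \<Lambda> t1 X = V (\<Lambda> (u n) X))" for n
    using factor_if_injective[OF u(1)[of n] less_imp_le[OF u(2)[of n]] inj[OF u(1) u(2)]] by simp
  then obtain V where V: "\<And>n. CPTP 2 (V n)" "\<And>n X. X \<in> carrier_mat 2 2 \<Longrightarrow> \<Lambda> t1 X = V n (\<Lambda> (u n) X)"
    by metis
  have Cu: "CPTP 2 (\<Lambda> (u n))" for n using channel u(1)[of n] by simp
  \<comment> \<open>\<open>V n\<close> sends the image of \<open>K0\<close> at time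
    \<open>u n\<close> to its image at \<open>t1\<close>, which is zero. Normalisation makes the
    annihilated direction persist in the limit channel.\<close>
  define Z where "Z n = normalized 2 (\<Lambda> (u n) K0)" for n
  have LK: "\<Lambda> (u n) K0 \<in> carrier_mat 2 2" "\<Lambda> (u n) K0 \<noteq> 0\<^sub>m 2 2" for n
    using CPTP_D(4)[OF Cu K0c] inj[OF u(1)[of n] u(2)[of n]] K0 K0c by (auto simp: injective_at_def)
  have Z: "Z n \<in> carrier_mat 2 2" "entry_sum 2 (Z n) = 1" for n
    using LK entry_sum_normalized by (auto simp: Z_def)
  have Zh: "herm 2 (Z n)" for n
    unfolding Z_def normalized_def by (intro herm_smult CPTP_herm[OF Cu K0(1)])
  have VZ: "V n (Z n) = 0\<^sub>m 2 2" for n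
    unfolding Z_def normalized_def linear_map_onD(3)[OF CPTP_D(1)[OF V(1)] LK(1)] V(2)[OF K0c, symmetric] K0(3)
    by (auto intro!: eq_matI)
  obtain r K where r: "strict_mono r" and K: "K \<in> carrier_mat 2 2" "K \<noteq> 0\<^sub>m 2 2"
    and Klim: "\<And>i j. i < 2 \<Longrightarrow> j < 2 \<Longrightarrow> (\<lambda>k. Z (r k) $$ (i,j)) \<longlonglongrightarrow> K $$ (i,j)"
    using normalized_subseq[of Z 2, OF Z] by blast
  obtain q W where q: "strict_mono q" and W: "CPTP 2 W"
    and Wlim: "\<And>X i j. X \<in> carrier_mat 2 2 \<Longrightarrow> i < 2 \<Longrightarrow> j < 2 \<Longrightarrow> (\<lambda>n. V (r (q n)) X $$ (i,j)) \<longlonglongrightarrow> W X $$ (i,j)"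
    using CPTP_subseq[of 2 "\<lambda>n. V (r n)"] V(1) by blast
  have lin: "linear_map_on 2 (V (r (q n)))" for n by (rule CPTP_D(1)[OF V(1)])
  have urq: "(\<lambda>k. u (r (q k))) \<longlonglongrightarrow> t1"
    using LIMSEQ_subseq_LIMSEQ[OF LIMSEQ_subseq_LIMSEQ[OF ulim r] q] by (simp add: o_def)
  have Kq: "(\<lambda>k. Z (r (q k)) $$ (i,j)) \<longlonglongrightarrow> K $$ (i,j)" if "i < 2" "j < 2" for i j
    using LIMSEQ_subseq_LIMSEQ[OF Klim[OF that] q] by (simp add: o_def)
  have "herm 2 K" by (rule herm_limit[OF Zh K(1) Kq])
  moreover have "W K = 0\<^sub>m 2 2"
  proof -
    have "W K $$ (i,j) = 0" if ij: "i < 2" "j < 2" for i j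
    proof -
      have "(\<lambda>k. V (r (q k)) (Z (r (q k))) $$ (i,j)) \<longlonglongrightarrow> W K $$ (i,j)"
        by (rule joint_limit[OF lin CPTP_D(1)[OF W] Wlim Z(1) K(1) Kq ij])
      then show ?thesis using VZ ij by (simp add: LIMSEQ_const_iff)
    qed
    then show ?thesis using CPTP_D(4)[OF W K(1)] by (intro eq_matI) auto
  qed
  moreover have "W (\<Lambda> t1 X) = \<Lambda> t1 X" if X: "X \<in> carrier_mat 2 2" for X
  proof -
    have c: "\<Lambda> t1 X \<in> carrier_mat 2 2" by (rule CPTP_D(4)[OF C1 X])
    have "W (\<Lambda> t1 X) $$ (i,j) = \<Lambda> t1 X $$ (i,j)" if ij: "i < 2" "j < 2" for i j
    proof -
      have sc: "(\<lambda>k. \<Lambda> (u (r (q k))) X $$ (a,b)) \<longlonglongrightarrow> \<Lambda> t1 X $$ (a,b)" if "a < 2" "b < 2" for a b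
        using seq_continuous[OF _ _ urq X that] t1 u by (simp add: less_imp_le)
      have "(\<lambda>k. V (r (q k)) (\<Lambda> (u (r (q k))) X) $$ (i,j)) \<longlonglongrightarrow> W (\<Lambda> t1 X) $$ (i,j)"
        by (rule joint_limit[OF lin CPTP_D(1)[OF W] Wlim CPTP_D(4)[OF Cu X] c sc ij])
      then show ?thesis using V(2)[OF X, symmetric] by (simp add: LIMSEQ_const_iff)
    qed
    then show ?thesis using CPTP_D(4)[OF W c] c by (intro eq_matI) auto
  qed
  ultimately show ?thesis using that[OF W _ K(2)] by blast
qed

text \<open>Otherwise the images of the identity, \<open>X0\<close> and \<open>X\<close> would be
  independent and, together with \<open>K\<close>, a basis. The channel fixing the range and
  annihilating \<open>K\<close> would then be a projector of rank three.\<close>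

lemma range_at_singular_time:
  assumes t1: "0 < t1" "\<not> injective_at t1" and inj: "\<And>s. 0 < s \<Longrightarrow> s < t1 \<Longrightarrow> injective_at s"
    and X0: "X0 \<in> carrier_mat 2 2" "mtrace X0 = 0" "\<Lambda> t1 X0 \<noteq> 0\<^sub>m 2 2" and X: "X \<in> carrier_mat 2 2"
  shows "\<exists>\<beta>. \<Lambda> t1 (X - (mtrace X / 2) \<cdot>\<^sub>m 1\<^sub>m 2 - \<beta> \<cdot>\<^sub>m X0) = 0\<^sub>m 2 2"
proof (rule ccontr)
  assume bad: "\<nexists>\<beta>. \<Lambda> t1 (X - (mtrace X / 2) \<cdot>\<^sub>m 1\<^sub>m 2 - \<beta> \<cdot>\<^sub>m X0) = 0\<^sub>m 2 2"
  obtain V K where V: "CPTP 2 V" "herm 2 K" "K \<noteq> 0\<^sub>m 2 2" "V K = 0\<^sub>m 2 2"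
    "\<And>X. X \<in> carrier_mat 2 2 \<Longrightarrow> V (\<Lambda> t1 X) = \<Lambda> t1 X"
    using singular_fixing_channel[OF t1 inj] by blast
  have Kc: "K \<in> carrier_mat 2 2" using V by (simp add: herm_def)
  note C1 = channel[OF less_imp_le[OF t1(1)]]
  note L = CPTP_D(1)[OF C1] and LV = CPTP_D(1)[OF V(1)]
  define I where "I = (1\<^sub>m 2 :: complex mat)"
  have Ic: "I \<in> carrier_mat 2 2" by (simp add: I_def)
  define comb where "comb a b c = a \<cdot>\<^sub>m I + (b \<cdot>\<^sub>m X0 + c \<cdot>\<^sub>m X)" for a b c
  have combc: "comb a b c \<in> carrier_mat 2 2" for a b c using Ic X0 X by (simp add: comb_def)
  have Lc: "\<Lambda> t1 Z \<in> carrier_mat 2 2" if "Z \<in> carrier_mat 2 2" for Z by (rule CPTP_D(4)[OF C1 that])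
  have Lcomb: "\<Lambda> t1 (comb a b c) = a \<cdot>\<^sub>m \<Lambda> t1 I + (b \<cdot>\<^sub>m \<Lambda> t1 X0 + c \<cdot>\<^sub>m \<Lambda> t1 X)" for a b c
    unfolding comb_def using Ic X0 X by (simp add: linear_map_onD[OF L])
  define B where "B = (\<lambda>k::nat. if k = 0 then \<Lambda> t1 I else if k = 1 then \<Lambda> t1 X0 else if k = 2 then \<Lambda> t1 X else K)"
  have Bsum: "(\<Sum>k<4. c k * B k $$ (i,j)) = (\<Lambda> t1 (comb (c 0) (c 1) (c 2)) + c 3 \<cdot>\<^sub>m K) $$ (i,j)"
    if "i < 2" "j < 2" for c i j
    using that Lc[OF Ic] Lc[OF X0(1)] Lc[OF X] Kc by (simp add: sum4 B_def Lcomb)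
  have ind: "c k = 0" if z: "\<And>i j. i < 2 \<Longrightarrow> j < 2 \<Longrightarrow> (\<Sum>k<4. c k * B k $$ (i,j)) = 0" and k: "k < 4" for c k
  proof -
    let ?Y = "\<Lambda> t1 (comb (c 0) (c 1) (c 2))"
    have Yc: "?Y \<in> carrier_mat 2 2" by (rule Lc[OF combc])
    have s: "?Y + c 3 \<cdot>\<^sub>m K = 0\<^sub>m 2 2" using z Bsum Yc Kc by (intro eq_matI) auto
    \<comment> \<open>Applying \<open>V\<close> separates the two parts of the relation: the range
      is fixed and \<open>K\<close> is annihilated.\<close>
    have "V (?Y + c 3 \<cdot>\<^sub>m K) = ?Y + c 3 \<cdot>\<^sub>m 0\<^sub>m 2 2"
      using linear_map_onD(2)[OF LV Yc, of "c 3 \<cdot>\<^sub>m K"] linear_map_onD(3)[OF LV Kc, of "c 3"] Kc V(4) V(5)[OF combc] by simp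
    then have "?Y + c 3 \<cdot>\<^sub>m 0\<^sub>m 2 2 = 0\<^sub>m 2 2" unfolding s linear_map_on_zero[OF LV] by simp
    then have "(?Y + c 3 \<cdot>\<^sub>m 0\<^sub>m 2 2) $$ (i,j) = 0" if "i < 2" "j < 2" for i j using that by simp
    then have Y0: "?Y = 0\<^sub>m 2 2" using Yc by (intro eq_matI) auto
    have "c 3 * K $$ (i,j) = 0" if "i < 2" "j < 2" for i j
      using arg_cong[OF s[unfolded Y0], of "\<lambda>M. M $$ (i,j)"] that Kc by simp
    moreover obtain i j where "i < 2" "j < 2" "K $$ (i,j) \<noteq> 0"
      using V(3) Kc eq_matI[of "0\<^sub>m 2 2" K] by auto
    ultimately have c3: "c 3 = 0" by auto
    have "mtrace (comb (c 0) (c 1) (c 2)) = 0"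
      using CPTP_D(3)[OF C1 combc, of "c 0" "c 1" "c 2"] Y0 by (simp add: mtrace_def)
    then have tr: "c 0 * 2 + c 2 * mtrace X = 0"
      unfolding comb_def using Ic X0 X by (simp add: mtrace_add[of _ 2] mtrace_smult[of _ 2] I_def mtrace_one)
    \<comment> \<open>Otherwise the relation can be solved for \<open>X\<close>. By trace
      preservation the coefficient of the identity is then the one that \<open>bad\<close>
      excludes.\<close>
    have c2: "c 2 = 0"
    proof (rule ccontr)
      assume n: "c 2 \<noteq> 0"
      have c0: "c 0 = - (c 2 * mtrace X / 2)" using tr by (simp add: eq_neg_iff_add_eq_0 field_simps)
      have "X - (mtrace X / 2) \<cdot>\<^sub>m 1\<^sub>m 2 - (- (c 1 / c 2)) \<cdot>\<^sub>m X0 = (1 / c 2) \<cdot>\<^sub>m comb (c 0) (c 1) (c 2)"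
        using X X0 n by (intro eq_matI) (auto simp: comb_def I_def c0 field_simps)
      then have "\<Lambda> t1 (X - (mtrace X / 2) \<cdot>\<^sub>m 1\<^sub>m 2 - (- (c 1 / c 2)) \<cdot>\<^sub>m X0) = (1 / c 2) \<cdot>\<^sub>m 0\<^sub>m 2 2"
        using linear_map_onD(3)[OF L combc] Y0 by simp
      also have "\<dots> = 0\<^sub>m 2 2" by (auto intro!: eq_matI)
      finally show False using bad by blast
    qed
    then have c0: "c 0 = 0" using tr by simp
    have "c 1 * \<Lambda> t1 X0 $$ (i,j) = 0" if "i < 2" "j < 2" for i j
      using arg_cong[OF Y0, of "\<lambda>M. M $$ (i,j)"] that Lc[OF Ic] Lc[OF X0(1)] Lc[OF X] by (simp add: Lcomb c0 c2)
    moreover obtain i j where "i < 2" "j < 2" "\<Lambda> t1 X0 $$ (i,j) \<noteq> 0"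
      using X0(3) Lc[OF X0(1)] eq_matI[of "0\<^sub>m 2 2" "\<Lambda> t1 X0"] by auto
    ultimately have "c 1 = 0" by auto
    then show ?thesis using c0 c2 c3 k by (auto simp: less4)
  qed
  show False
  proof (rule no_rank_three_projector[OF V(1-4)])
    fix Y :: "complex mat" assume Y: "Y \<in> carrier_mat 2 2"
    obtain c where c: "\<And>i j. i < 2 \<Longrightarrow> j < 2 \<Longrightarrow> (\<Sum>k<4. c k * B k $$ (i,j)) = Y $$ (i,j)"
    proof (rule spanning_if_independent_2x2[of B Y])
      show "c k = 0" if "\<And>i j. i < 2 \<Longrightarrow> j < 2 \<Longrightarrow> (\<Sum>k<4. c k * B k $$ (i,j)) = 0" "k < 4" for c k
        using that by (rule ind)
    qed (rule that)
    let ?Y = "\<Lambda> t1 (comb (c 0) (c 1) (c 2))"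
    have "Y = ?Y + c 3 \<cdot>\<^sub>m K"
      using Y c Bsum Lc[OF combc] Kc by (intro eq_matI) auto
    then show "\<exists>g Z. Z \<in> carrier_mat 2 2 \<and> V Z = Z \<and> Y = Z + g \<cdot>\<^sub>m K"
      using V(5)[OF combc] Lc[OF combc] by blast
  qed
qed

end

section \<open>Kraus maps\<close>

text \<open>The \<open>r\<close>-th Kraus operator has entry \<open>K r i x\<close> in row
  \<open>i\<close> and column \<open>x\<close>.\<close>

definition kraus :: "nat \<Rightarrow> nat \<Rightarrow> (nat \<Rightarrow> nat \<Rightarrow> nat \<Rightarrow> complex) \<Rightarrow> complex mat \<Rightarrow> complex mat" where
  "kraus d n K X = mat d d (\<lambda>(i,j). \<Sum>r<n. \<Sum>x<d. \<Sum>y<d. K r i x * X $$ (x,y) * cnj (K r j y))"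

lemma psd_sum:
  assumes "\<And>r. r < n \<Longrightarrow> psd N (A r)"
  shows "psd N (mat N N (\<lambda>p. \<Sum>r<n. A r $$ p))"
proof -
  have "qform N (mat N N (\<lambda>p. \<Sum>r<n. A r $$ p)) v = (\<Sum>r<n. qform N (A r) v)" for v
  proof -
    have "qform N (mat N N (\<lambda>p. \<Sum>r<n. A r $$ p)) v = (\<Sum>i<N. \<Sum>j<N. \<Sum>r<n. cnj (v i) * A r $$ (i,j) * v j)"
      unfolding qform_def by (intro sum.cong refl) (simp add: sum_distrib_left sum_distrib_right)
    also have "\<dots> = (\<Sum>r<n. qform N (A r) v)"
      unfolding qform_def by (subst (2) sum.swap, subst sum.swap) simp
    finally show ?thesis .
  qed
  moreover have "herm N (mat N N (\<lambda>p. \<Sum>r<n. A r $$ p))"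
    unfolding herm_iff using assms herm_index[of N "A _"] by (auto simp: psd_iff intro!: sum.cong)
  ultimately show ?thesis using assms by (auto simp: psd_iff intro!: sum_nonneg)
qed

lemma sum_swap4:
  "(\<Sum>i\<in>A. \<Sum>r\<in>B. \<Sum>x\<in>C. \<Sum>y\<in>D. f i r x y) = (\<Sum>x\<in>C. \<Sum>y\<in>D. \<Sum>r\<in>B. \<Sum>i\<in>A. f i r x y)"
  for f :: "_ \<Rightarrow> _ \<Rightarrow> _ \<Rightarrow> _ \<Rightarrow> 'a::comm_monoid_add"
proof -
  have "(\<Sum>i\<in>A. \<Sum>r\<in>B. \<Sum>x\<in>C. \<Sum>y\<in>D. f i r x y) = (\<Sum>r\<in>B. \<Sum>i\<in>A. \<Sum>x\<in>C. \<Sum>y\<in>D. f i r x y)"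
    by (rule sum.swap)
  also have "\<dots> = (\<Sum>r\<in>B. \<Sum>x\<in>C. \<Sum>i\<in>A. \<Sum>y\<in>D. f i r x y)"
    by (rule sum.cong[OF refl], rule sum.swap)
  also have "\<dots> = (\<Sum>r\<in>B. \<Sum>x\<in>C. \<Sum>y\<in>D. \<Sum>i\<in>A. f i r x y)"
    by (rule sum.cong[OF refl], rule sum.cong[OF refl], rule sum.swap)
  also have "\<dots> = (\<Sum>x\<in>C. \<Sum>r\<in>B. \<Sum>y\<in>D. \<Sum>i\<in>A. f i r x y)"
    by (rule sum.swap)
  also have "\<dots> = (\<Sum>x\<in>C. \<Sum>y\<in>D. \<Sum>r\<in>B. \<Sum>i\<in>A. f i r x y)"
    by (rule sum.cong[OF refl], rule sum.swap)
  finally show ?thesis .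
qed

lemma kraus_CPTP:
  assumes tp: "\<And>x y. x < d \<Longrightarrow> y < d \<Longrightarrow> (\<Sum>r<n. \<Sum>i<d. cnj (K r i y) * K r i x) = (if x = y then 1 else 0)"
  shows "CPTP d (kraus d n K)"
proof -
  have L: "linear_map_on d (kraus d n K)"
    unfolding linear_map_on_def kraus_def
    by (auto intro!: eq_matI simp: sum.distrib sum_distrib_left algebra_simps)
  moreover have "mtrace (kraus d n K X) = mtrace X" if X: "X \<in> carrier_mat d d" for X
  proof -
    have "mtrace (kraus d n K X) = (\<Sum>i<d. \<Sum>r<n. \<Sum>x<d. \<Sum>y<d. X $$ (x,y) * (cnj (K r i y) * K r i x))"
      by (simp add: mtrace_def kraus_def mult.commute mult.left_commute)
    also have "\<dots> = (\<Sum>x<d. \<Sum>y<d. \<Sum>r<n. \<Sum>i<d. X $$ (x,y) * (cnj (K r i y) * K r i x))"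
      by (rule sum_swap4)
    also have "\<dots> = (\<Sum>x<d. \<Sum>y<d. X $$ (x,y) * (if x = y then 1 else 0))"
      by (intro sum.cong refl) (simp add: sum_distrib_left[symmetric] tp)
    also have "\<dots> = (\<Sum>x<d. \<Sum>y<d. if x = y then X $$ (x,y) else 0)"
      by (intro sum.cong refl) simp
    also have "\<dots> = mtrace X" using X by (simp add: mtrace_eq[of _ d])
    finally show ?thesis .
  qed
  moreover have "psd (d*m) (ampl (kraus d n K) d m X)" if m: "m > 0" and X: "psd (d*m) X" for m X
  proof -
    have Xc: "X \<in> carrier_mat (d*m) (d*m)" by (rule psd_carrier[OF X])
    \<comment> \<open>The Kraus operator tensored with the identity of the ancilla; amplification is
      conjugation by these, summed over \<open>r\<close>.\<close>
    define D where "D r = mat (d*m) (d*m) (\<lambda>(i,j). if j mod m = i mod m then K r (i div m) (j div m) else 0)" for r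
    have Dc: "D r \<in> carrier_mat (d*m) (d*m)" for r by (simp add: D_def)
    have DX: "(D r * X) $$ (i,j) = (\<Sum>x<d. K r (i div m) x * X $$ (x*m + i mod m, j))" if "i < d*m" "j < d*m" for r i j
    proof -
      have "(D r * X) $$ (i,j) = (\<Sum>x<d. \<Sum>k<m. D r $$ (i, x*m + k) * X $$ (x*m + k, j))"
        unfolding mult_index[OF Dc Xc that] sum_pair_index ..
      also have "\<dots> = (\<Sum>x<d. \<Sum>k<m. if k = i mod m then K r (i div m) x * X $$ (x*m + k, j) else 0)"
        using that by (intro sum.cong refl) (auto simp: D_def pair_index_less)
      also have "\<dots> = (\<Sum>x<d. K r (i div m) x * X $$ (x*m + i mod m, j))"
        using m by (intro sum.cong refl) simp
      finally show ?thesis .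
    qed
    have DXD: "(D r * X * adj (D r)) $$ (i,j) =
        (\<Sum>x<d. \<Sum>y<d. K r (i div m) x * X $$ (x*m + i mod m, y*m + j mod m) * cnj (K r (j div m) y))"
      if ij: "i < d*m" "j < d*m" for r i j
    proof -
      have adjD: "adj (D r) $$ (y*m + l, j) = (if l = j mod m then cnj (K r (j div m) y) else 0)" if "y < d" "l < m" for y l
        using that ij adj_index[OF Dc, of "y*m + l" j r] by (simp add: pair_index_less) (simp add: D_def pair_index_less)
      have "(D r * X * adj (D r)) $$ (i,j) = (\<Sum>y<d. \<Sum>l<m. (D r * X) $$ (i, y*m + l) * adj (D r) $$ (y*m + l, j))"
        unfolding mult_index[OF mult_square_carrier[OF Dc Xc] adj_carrier[OF Dc] ij] sum_pair_index ..
      also have "\<dots> = (\<Sum>y<d. \<Sum>l<m. if l = j mod m then (D r * X) $$ (i, y*m + l) * cnj (K r (j div m) y) else 0)"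
        using ij adjD by (intro sum.cong refl) simp
      also have "\<dots> = (\<Sum>y<d. (D r * X) $$ (i, y*m + j mod m) * cnj (K r (j div m) y))"
        using m by (intro sum.cong refl) simp
      also have "\<dots> = (\<Sum>y<d. \<Sum>x<d. K r (i div m) x * X $$ (x*m + i mod m, y*m + j mod m) * cnj (K r (j div m) y))"
        using ij m by (intro sum.cong refl) (simp add: DX pair_index_less sum_distrib_right)
      also have "\<dots> = (\<Sum>x<d. \<Sum>y<d. K r (i div m) x * X $$ (x*m + i mod m, y*m + j mod m) * cnj (K r (j div m) y))"
        by (rule sum.swap)
      finally show ?thesis .
    qed
    have "psd (d*m) (D r * X * adj (D r))" for r
      using psd_conj_mult[OF adj_carrier[OF Dc] X, of r] adj_adj[OF Dc] by simp
    then have "psd (d*m) (mat (d*m) (d*m) (\<lambda>p. \<Sum>r<n. (D r * X * adj (D r)) $$ p))" by (intro psd_sum)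
    also have "mat (d*m) (d*m) (\<lambda>p. \<Sum>r<n. (D r * X * adj (D r)) $$ p) = ampl (kraus d n K) d m X"
      by (rule eq_matI) (auto simp: DXD ampl_eq kraus_def block_def div_index_less)
    finally show ?thesis .
  qed
  ultimately show ?thesis by (simp add: CPTP_def)
qed

lemma two_set: "{..<2::nat} = {0, 1}"
  by auto

lemma four_set: "{..<4::nat} = {0, 1, 2, 3}"
  by auto

lemma sum2: "(\<Sum>i<2. f i) = f 0 + f (1::nat)" for f :: "nat \<Rightarrow> complex"
  by (simp add: two_set)

definition pure :: "(nat \<Rightarrow> complex) \<Rightarrow> complex mat" where
  "pure a = mat 2 2 (\<lambda>(i,j). a i * cnj (a j))"

text \<open>The Kraus operators are determined by \<open>a \<mapsto> A r\<close> and \<open>b \<mapsto> B r\<close>; equality of the Gram matrices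
  is exactly trace preservation.\<close>

lemma pure_pair_channel:
  fixes a b :: "nat \<Rightarrow> complex" and A B :: "nat \<Rightarrow> nat \<Rightarrow> complex"
  assumes \<Delta>: "a 0 * b 1 - a 1 * b 0 \<noteq> 0"
    and AA: "(\<Sum>r<n. \<Sum>i<2. cnj (A r i) * A r i) = cnj (a 0) * a 0 + cnj (a 1) * a 1"
    and BB: "(\<Sum>r<n. \<Sum>i<2. cnj (B r i) * B r i) = cnj (b 0) * b 0 + cnj (b 1) * b 1"
    and AB: "(\<Sum>r<n. \<Sum>i<2. cnj (A r i) * B r i) = cnj (a 0) * b 0 + cnj (a 1) * b 1"
  obtains V where "CPTP 2 V" "V (pure a) = mat 2 2 (\<lambda>(i,j). \<Sum>r<n. A r i * cnj (A r j))"
    "V (pure b) = mat 2 2 (\<lambda>(i,j). \<Sum>r<n. B r i * cnj (B r j))"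
proof -
  define \<Delta> where "\<Delta> = a 0 * b 1 - a 1 * b 0"
  have D0: "\<Delta> \<noteq> 0" "cnj \<Delta> \<noteq> 0" using assms(1) unfolding \<Delta>_def complex_cnj_zero_iff by auto
  have BA: "(\<Sum>r<n. \<Sum>i<2. cnj (B r i) * A r i) = a 0 * cnj (b 0) + a 1 * cnj (b 1)"
    using arg_cong[OF AB, of cnj] by (simp add: mult.commute)
  \<comment> \<open>Cramer's rule for the requirement that the \<open>r\<close>-th operator sends
    \<open>a\<close> to \<open>A r\<close> and \<open>b\<close> to \<open>B r\<close>;
    \<open>\<Delta>\<close> is the determinant of the pair.\<close>
  define K where "K r i x = (if x = 0 then A r i * b 1 - B r i * a 1 else B r i * a 0 - A r i * b 0) / \<Delta>" for r i x :: nat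
  \<comment> \<open>The columns of the Kraus operators are combinations of \<open>A r\<close> and
    \<open>B r\<close>, so their inner products need only the Gram matrix of these, which the
    hypotheses equate with that of \<open>a\<close> and \<open>b\<close>.\<close>
  have gram: "(\<Sum>r<n. \<Sum>i<2. cnj ((A r i * s - B r i * t) / \<Delta>) * ((A r i * u - B r i * v) / \<Delta>)) =
      (cnj s * u * (cnj (a 0) * a 0 + cnj (a 1) * a 1) - cnj s * v * (cnj (a 0) * b 0 + cnj (a 1) * b 1)
       - cnj t * u * (a 0 * cnj (b 0) + a 1 * cnj (b 1)) + cnj t * v * (cnj (b 0) * b 0 + cnj (b 1) * b 1)) / (cnj \<Delta> * \<Delta>)" for s t u v
  proof -
    have "(\<Sum>r<n. \<Sum>i<2. cnj ((A r i * s - B r i * t) / \<Delta>) * ((A r i * u - B r i * v) / \<Delta>)) =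
      (\<Sum>r<n. \<Sum>i<2. (cnj s * u * (cnj (A r i) * A r i) - cnj s * v * (cnj (A r i) * B r i)
        - cnj t * u * (cnj (B r i) * A r i) + cnj t * v * (cnj (B r i) * B r i)) / (cnj \<Delta> * \<Delta>))"
      by (intro sum.cong refl) (simp add: algebra_simps add_divide_distrib diff_divide_distrib)
    also have "\<dots> = (cnj s * u * (\<Sum>r<n. \<Sum>i<2. cnj (A r i) * A r i) - cnj s * v * (\<Sum>r<n. \<Sum>i<2. cnj (A r i) * B r i)
        - cnj t * u * (\<Sum>r<n. \<Sum>i<2. cnj (B r i) * A r i) + cnj t * v * (\<Sum>r<n. \<Sum>i<2. cnj (B r i) * B r i)) / (cnj \<Delta> * \<Delta>)"
      by (simp only: sum_divide_distrib[symmetric] sum.distrib sum_subtractf sum_distrib_left[symmetric])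
    finally show ?thesis unfolding AA AB BA BB .
  qed
  have K0: "K r i 0 = (A r i * b 1 - B r i * a 1) / \<Delta>" and K1: "K r i (Suc 0) = (A r i * (- b 0) - B r i * (- a 0)) / \<Delta>" for r i
    by (auto simp: K_def)
  have "(\<Sum>r<n. \<Sum>i<2. cnj (K r i y) * K r i x) = (if x = y then 1 else 0)" if "x < 2" "y < 2" for x y
  proof -
    have c: "num / (cnj \<Delta> * \<Delta>) = 1" if "num = cnj \<Delta> * \<Delta>" for num using that D0 by simp
    from that consider "x = 0" "y = 0" | "x = 0" "y = Suc 0" | "x = Suc 0" "y = 0" | "x = Suc 0" "y = Suc 0" by fastforce
    then show ?thesis
    proof cases
      case 1
      show ?thesis unfolding 1 K0 gram by (simp only: simp_thms if_True, rule c, simp add: \<Delta>_def algebra_simps)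
    next
      case 2
      show ?thesis unfolding 2 K0 K1 gram by (simp add: algebra_simps)
    next
      case 3
      show ?thesis unfolding 3 K0 K1 gram by (simp add: algebra_simps)
    next
      case 4
      show ?thesis unfolding 4 K1 gram by (simp only: simp_thms if_True, rule c, simp add: \<Delta>_def algebra_simps)
    qed
  qed
  then have V: "CPTP 2 (kraus 2 n K)" by (rule kraus_CPTP)
  have Ka: "K r i 0 * a 0 + K r i (Suc 0) * a (Suc 0) = A r i" and Kb: "K r i 0 * b 0 + K r i (Suc 0) * b (Suc 0) = B r i" for r i
  proof -
    have k: "K r i 0 * s + K r i (Suc 0) * t =
        ((A r i * b 1 - B r i * a 1) * s + (B r i * a 0 - A r i * b 0) * t) / \<Delta>" for s t
      by (simp add: K_def add_divide_distrib)
    have "(A r i * b 1 - B r i * a 1) * a 0 + (B r i * a 0 - A r i * b 0) * a (Suc 0) = A r i * \<Delta>"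
      by (simp add: \<Delta>_def algebra_simps)
    then show "K r i 0 * a 0 + K r i (Suc 0) * a (Suc 0) = A r i" unfolding k using D0 by simp
    have "(A r i * b 1 - B r i * a 1) * b 0 + (B r i * a 0 - A r i * b 0) * b (Suc 0) = B r i * \<Delta>"
      by (simp add: \<Delta>_def algebra_simps)
    then show "K r i 0 * b 0 + K r i (Suc 0) * b (Suc 0) = B r i" unfolding k using D0 by simp
  qed
  have V': "kraus 2 n K (pure c) = mat 2 2 (\<lambda>(i,j). \<Sum>r<n. (K r i 0 * c 0 + K r i (Suc 0) * c (Suc 0)) * cnj (K r j 0 * c 0 + K r j (Suc 0) * c (Suc 0)))" for c
    by (rule eq_matI) (auto simp: kraus_def pure_def two_set algebra_simps)
  show ?thesis using that[OF V] V'[of a] V'[of b] unfolding Ka Kb by blast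
qed

text \<open>The channel that discards its input and prepares the state \<open>M\<close> times its
  adjoint; the hypothesis says that this state has trace one.\<close>

lemma replacer_channel:
  fixes M :: "nat \<Rightarrow> nat \<Rightarrow> complex"
  assumes M: "(\<Sum>i<2. \<Sum>k<2. cnj (M i k) * M i k) = 1"
  obtains V where "CPTP 2 V"
    "\<And>X. X \<in> carrier_mat 2 2 \<Longrightarrow> V X = mat 2 2 (\<lambda>(i,j). mtrace X * (\<Sum>k<2. M i k * cnj (M j k)))"
proof -
  \<comment> \<open>With \<open>r = 2 * x + k\<close>, the operator sends the basis vector
    \<open>x\<close> to column \<open>k\<close> of \<open>M\<close> and the other basis vector to
    zero.\<close>
  define K where "K r i x = (if r div 2 = x then M i (r mod 2) else 0)" for r i x :: nat
  have "CPTP 2 (kraus 2 4 K)"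
  proof (rule kraus_CPTP)
    fix x y :: nat assume "x < 2" "y < 2"
    then show "(\<Sum>r<4. \<Sum>i<2. cnj (K r i y) * K r i x) = (if x = y then 1 else 0)"
      using M by (auto simp: four_set two_set K_def less_2_cases_iff algebra_simps)
  qed
  moreover have "kraus 2 4 K X = mat 2 2 (\<lambda>(i,j). mtrace X * (\<Sum>k<2. M i k * cnj (M j k)))" if "X \<in> carrier_mat 2 2" for X
    using that by (intro eq_matI) (auto simp: kraus_def four_set two_set K_def mtrace_eq[of _ 2] algebra_simps)
  ultimately show ?thesis using that by blast
qed

section \<open>Hermitian two-by-two matrices\<close>

text \<open>The determinant of a Hermitian matrix in real terms. At trace one it vanishes exactly on
  the Bloch sphere and is positive inside; \<open>hdet_mixed\<close> is its polar form.\<close>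

definition hdet :: "complex mat \<Rightarrow> real" where
  "hdet A = Re (A $$ (0,0)) * Re (A $$ (1,1)) - (cmod (A $$ (0,1)))\<^sup>2"

definition hdet_mixed :: "complex mat \<Rightarrow> complex mat \<Rightarrow> real" where
  "hdet_mixed A B = Re (A $$ (0,0)) * Re (B $$ (1,1)) + Re (A $$ (1,1)) * Re (B $$ (0,0))
     - 2 * Re (A $$ (0,1) * cnj (B $$ (0,1)))"

lemma mtrace_2: "A \<in> carrier_mat 2 2 \<Longrightarrow> mtrace A = A $$ (0,0) + A $$ (1,1)"
  by (simp add: mtrace_eq[of _ 2] two_set)

lemma herm_2_entries:
  assumes "herm 2 A"
  shows "A $$ (0,0) = of_real (Re (A $$ (0,0)))" "A $$ (1,1) = of_real (Re (A $$ (1,1)))" "A $$ (1,0) = cnj (A $$ (0,1))"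
  using herm_index[OF assms, of 0 0] herm_index[OF assms, of 1 1] herm_index[OF assms, of 0 1]
  by (auto simp: complex_eq_iff)

lemma mat_2_eqI:
  assumes "A \<in> carrier_mat 2 2" "B \<in> carrier_mat 2 2" "A $$ (0,0) = B $$ (0,0)" "A $$ (0,1) = B $$ (0,1)"
    "A $$ (1,0) = B $$ (1,0)" "A $$ (1,1) = B $$ (1,1)"
  shows "A = B"
  using assms by (intro eq_matI) (auto simp: less_2_cases_iff)

lemma hdet_lincomb:
  assumes "A \<in> carrier_mat 2 2" "B \<in> carrier_mat 2 2"
  shows "hdet (of_real x \<cdot>\<^sub>m A + of_real y \<cdot>\<^sub>m B) = x\<^sup>2 * hdet A + x * y * hdet_mixed A B + y\<^sup>2 * hdet B"
proof -
  show ?thesis using assms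
    by (simp add: hdet_def hdet_mixed_def cmod_power2) (simp add: power2_eq_square algebra_simps)
qed

lemma psd_hdet:
  assumes A: "psd 2 A" shows "0 \<le> hdet A"
proof -
  define p q r where "p = Re (A $$ (0,0))" and "q = A $$ (0,1)" and "r = Re (A $$ (1,1))"
  have h: "herm 2 A" using A by (simp add: psd_iff)
  have e: "A $$ (0,0) = of_real p" "A $$ (1,1) = of_real r" "A $$ (1,0) = cnj q"
    using herm_2_entries[OF h] by (auto simp: p_def q_def r_def)
  have qf: "0 \<le> p * (cmod x)\<^sup>2 + 2 * Re (cnj x * q * y) + r * (cmod y)\<^sup>2" for x y
  proof -
    have "qform 2 A (\<lambda>k. if k = 0 then x else if k = 1 then y else 0) =
        of_real p * (x * cnj x) + (cnj x * q * y + cnj (cnj x * q * y)) + of_real r * (y * cnj y)"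
      using qform_two[of 0 2 1 A x y] e by (simp add: q_def algebra_simps)
    moreover have "0 \<le> Re (qform 2 A (\<lambda>k. if k = 0 then x else if k = 1 then y else 0))"
      using A unfolding psd_iff by blast
    ultimately have "0 \<le> Re (of_real p * (x * cnj x) + (cnj x * q * y + cnj (cnj x * q * y)) + of_real r * (y * cnj y))" by simp
    then show ?thesis by (simp add: complex_norm_square[symmetric] del: of_real_power) (simp add: cmod_power2 algebra_simps)
  qed
  have p0: "0 \<le> p" using psd_diag[OF A, of 0] by (simp add: p_def)
  show ?thesis
  proof (cases "p = 0")
    case True
    have "q = 0"
    proof (rule ccontr)
      assume q: "q \<noteq> 0"
      \<comment> \<open>Chosen so that the form takes the value -1.\<close>
      define t where "t = (r + 1) / (2 * (cmod q)\<^sup>2)"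
      have "0 \<le> 2 * Re (cnj (- of_real t * q) * q * 1) + r" using qf[of "- of_real t * q" 1] True by simp
      also have "cnj (- of_real t * q) * q * 1 = - of_real (t * (cmod q)\<^sup>2)"
        using complex_norm_square[of q] by (simp add: mult.commute)
      finally have "0 \<le> - 2 * (t * (cmod q)\<^sup>2) + r" by simp
      also have "t * (cmod q)\<^sup>2 = (r + 1) / 2" using q by (simp add: t_def)
      finally show False by (simp add: field_simps)
    qed
    then show ?thesis using True by (simp add: hdet_def p_def q_def)
  next
    case False
    \<comment> \<open>At the vector \<open>(-q, p)\<close> the form is \<open>p\<close> times the
      determinant.\<close>
    have "0 \<le> p * (cmod q)\<^sup>2 + 2 * Re (cnj (- q) * q * of_real p) + r * p\<^sup>2"
      using qf[of "- q" "of_real p"] by simp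
    also have "cnj (- q) * q * of_real p = - of_real (p * (cmod q)\<^sup>2)"
      using complex_norm_square[of q] by (simp add: mult.commute)
    finally have "0 \<le> p * (p * r - (cmod q)\<^sup>2)" by (simp add: power2_eq_square algebra_simps)
    then show ?thesis using False p0 by (simp add: hdet_def p_def q_def r_def zero_le_mult_iff)
  qed
qed

lemma herm_2_square:
  assumes h: "herm 2 A"
  shows "(A * A) $$ (0,0) = of_real ((Re (A $$ (0,0)))\<^sup>2 + (cmod (A $$ (0,1)))\<^sup>2)"
    "(A * A) $$ (1,1) = of_real ((Re (A $$ (1,1)))\<^sup>2 + (cmod (A $$ (0,1)))\<^sup>2)"
    "(A * A) $$ (0,1) = A $$ (0,1) * of_real (Re (A $$ (0,0)) + Re (A $$ (1,1)))"
proof -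
  have c: "A \<in> carrier_mat 2 2" using h by (simp add: herm_def)
  define p q r where "p = Re (A $$ (0,0))" and "q = A $$ (0,1)" and "r = Re (A $$ (1,1))"
  have e: "A $$ (0,0) = of_real p" "A $$ (1,1) = of_real r" "A $$ (1,0) = cnj q" "A $$ (0,1) = q"
    using herm_2_entries[OF h] by (auto simp: p_def q_def r_def)
  have m: "(A * A) $$ (i,j) = A $$ (i,0) * A $$ (0,j) + A $$ (i,1) * A $$ (1,j)" if "i < 2" "j < 2" for i j
    using mult_index[OF c c that] by (simp add: two_set)
  have qq: "q * cnj q = of_real ((cmod q)\<^sup>2)" using complex_norm_square[of q] by simp
  have "(A * A) $$ (0,0) = of_real (p\<^sup>2 + (cmod q)\<^sup>2)" "(A * A) $$ (1,1) = of_real (r\<^sup>2 + (cmod q)\<^sup>2)"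
    "(A * A) $$ (0,1) = q * of_real (p + r)"
    using m[of 0 0] m[of 1 1] m[of 0 1] qq unfolding e
    by (simp_all add: power2_eq_square algebra_simps)
  then show "(A * A) $$ (0,0) = of_real ((Re (A $$ (0,0)))\<^sup>2 + (cmod (A $$ (0,1)))\<^sup>2)"
    "(A * A) $$ (1,1) = of_real ((Re (A $$ (1,1)))\<^sup>2 + (cmod (A $$ (0,1)))\<^sup>2)"
    "(A * A) $$ (0,1) = A $$ (0,1) * of_real (Re (A $$ (0,0)) + Re (A $$ (1,1)))"
    by (simp_all only: p_def q_def r_def)
qed

text \<open>In terms of eigenvalues this expands the square of the sum of their moduli. The proof
  compares \<open>X\<close> with its modulus \<open>S\<close>: from \<open>S * S = X * X\<close> the
  diagonals of the squares agree and the determinants agree up to sign, that of \<open>S\<close>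
  being nonnegative.\<close>

lemma trace_norm_herm_2:
  assumes X: "herm 2 X"
  shows "(trace_norm X)\<^sup>2 = (Re (mtrace X))\<^sup>2 - 2 * hdet X + 2 * \<bar>hdet X\<bar>"
proof -
  have Xc: "X \<in> carrier_mat 2 2" and Xa: "adj X = X" using X by (auto simp: herm_def)
  obtain U where U: "unitary 2 U" "psd 2 (U * X)" "trace_norm X = Re (mtrace (U * X))" "(U * X) * (U * X) = adj X * X"
    using trace_norm_attained[OF Xc] by metis
  define S where "S = U * X"
  have S: "psd 2 S" "trace_norm X = Re (mtrace S)" "S * S = X * X" using U Xa by (auto simp: S_def)
  have Sh: "herm 2 S" using S by (simp add: psd_iff)
  have Sc: "S \<in> carrier_mat 2 2" by (rule psd_carrier[OF S(1)])
  define p a r where "p = Re (S $$ (0,0))" and "a = (cmod (S $$ (0,1)))\<^sup>2" and "r = Re (S $$ (1,1))"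
  define p' a' r' where "p' = Re (X $$ (0,0))" and "a' = (cmod (X $$ (0,1)))\<^sup>2" and "r' = Re (X $$ (1,1))"
  have e1: "p\<^sup>2 + a = p'\<^sup>2 + a'" and e2: "r\<^sup>2 + a = r'\<^sup>2 + a'"
    using herm_2_square(1,2)[OF Sh] herm_2_square(1,2)[OF X] S(3)
    unfolding p_def a_def r_def p'_def a'_def r'_def by (metis of_real_eq_iff)+
  have "cmod ((S * S) $$ (0,1)) = cmod ((X * X) $$ (0,1))" using S(3) by simp
  then have "(cmod (S $$ (0,1)) * \<bar>p + r\<bar>)\<^sup>2 = (cmod (X $$ (0,1)) * \<bar>p' + r'\<bar>)\<^sup>2"
    unfolding herm_2_square(3)[OF Sh] herm_2_square(3)[OF X] norm_mult norm_of_real p_def r_def p'_def r'_def by simp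
  then have e3: "a * (p + r)\<^sup>2 = a' * (p' + r')\<^sup>2" by (simp add: power_mult_distrib a_def a'_def)
  have "(p * r - a)\<^sup>2 = (p\<^sup>2 + a) * (r\<^sup>2 + a) - a * (p + r)\<^sup>2" by (simp add: power2_eq_square algebra_simps)
  also have "\<dots> = (p' * r' - a')\<^sup>2" unfolding e1 e2 e3 by (simp add: power2_eq_square algebra_simps)
  finally have "\<bar>p * r - a\<bar> = \<bar>p' * r' - a'\<bar>" by (simp add: power2_eq_iff abs_eq_iff)
  moreover have hS: "hdet S = p * r - a" and hX: "hdet X = p' * r' - a'"
    by (simp_all add: hdet_def p_def a_def r_def p'_def a'_def r'_def)
  ultimately have h: "p * r - a = \<bar>hdet X\<bar>" using psd_hdet[OF S(1)] by simp
  have "(trace_norm X)\<^sup>2 = (p + r)\<^sup>2" using S(2) Sc by (simp add: mtrace_2 p_def r_def)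
  also have "\<dots> = (p\<^sup>2 + a) + (r\<^sup>2 + a) + 2 * (p * r - a)" by (simp add: power2_eq_square algebra_simps)
  also have "\<dots> = (p' + r')\<^sup>2 - 2 * hdet X + 2 * \<bar>hdet X\<bar>"
    unfolding e1 e2 h hX by (simp add: power2_eq_square algebra_simps)
  also have "p' + r' = Re (mtrace X)" using Xc by (simp add: mtrace_2 p'_def r'_def)
  finally show ?thesis .
qed

text \<open>For a nonpositive determinant the squared norm is the squared trace minus four times the
  determinant, so at equal trace a smaller norm means a larger determinant.\<close>

lemma hdet_mono_if_trace_norm_le:
  assumes Y: "herm 2 Y" and Z: "herm 2 Z" and tr: "mtrace Y = mtrace Z" and le: "trace_norm Y \<le> trace_norm Z"
    and hZ: "hdet Z \<le> 0"
  shows "hdet Z \<le> hdet Y"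
proof -
  have "0 \<le> trace_norm Y" using Y by (intro trace_norm_nonneg[of _ 2]) (simp add: herm_def)
  then have "(trace_norm Y)\<^sup>2 \<le> (trace_norm Z)\<^sup>2" using le by (intro power_mono)
  then show ?thesis unfolding trace_norm_herm_2[OF Y] trace_norm_herm_2[OF Z] using tr hZ by auto
qed

lemma pure_if_hdet_zero:
  assumes P: "herm 2 P" "mtrace P = 1" "hdet P = 0"
  obtains a where "P = pure a" "cnj (a 0) * a 0 + cnj (a 1) * a 1 = 1"
proof -
  have Pc: "P \<in> carrier_mat 2 2" using P by (simp add: herm_def)
  define p q r where "p = Re (P $$ (0,0))" and "q = P $$ (0,1)" and "r = Re (P $$ (1,1))"
  have e: "P $$ (0,0) = of_real p" "P $$ (1,1) = of_real r" "P $$ (1,0) = cnj q" "P $$ (0,1) = q"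
    using herm_2_entries[OF P(1)] by (auto simp: p_def q_def r_def)
  have tr: "p + r = 1" using P(2) Pc by (simp add: mtrace_2 p_def r_def complex_eq_iff)
  have dt: "p * r = (cmod q)\<^sup>2" using P(3) by (simp add: hdet_def p_def q_def r_def)
  have "0 \<le> p * r" using dt by simp
  then have p0: "0 \<le> p" using tr by (auto simp: zero_le_mult_iff)
  show ?thesis
  proof (cases "p = 0")
    case True
    then have "q = 0" "r = 1" using dt tr by auto
    then show ?thesis using True Pc e
      by (intro that[of "\<lambda>i. if i = 0 then 0 else 1"] mat_2_eqI) (auto simp: pure_def)
  next
    case False
    \<comment> \<open>The first column of \<open>P\<close> divided by the root of its diagonal
      entry.\<close>
    define a where "a i = (if i = 0 then of_real (sqrt p) else cnj q / of_real (sqrt p))" for i :: nat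
    have s: "of_real (sqrt p) * of_real (sqrt p) = (of_real p :: complex)" using p0 by (simp flip: of_real_mult)
    have s0: "complex_of_real (sqrt p) \<noteq> 0" using False p0 by simp
    have a11: "a 1 * cnj (a 1) = of_real r"
    proof -
      have "a 1 * cnj (a 1) = (q * cnj q) / of_real p" by (simp add: a_def s[symmetric] mult.commute)
      also have "q * cnj q = of_real (p * r)" unfolding dt by (rule complex_norm_square[symmetric])
      finally show ?thesis using False by simp
    qed
    have "P = pure a"
      using Pc e s s0 a11 by (intro mat_2_eqI) (auto simp: pure_def a_def)
    moreover have "cnj (a 0) * a 0 + cnj (a 1) * a 1 = 1"
    proof -
      have "cnj (a 0) * a 0 + cnj (a 1) * a 1 = of_real p + of_real r"
        using a11 s by (simp add: a_def mult.commute)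
      then show ?thesis using tr by (simp flip: of_real_add)
    qed
    ultimately show ?thesis using that by blast
  qed
qed

text \<open>By Lagrange's identity this is, for unit vectors, one minus the squared modulus of their
  overlap.\<close>

lemma hdet_mixed_pure:
  "hdet_mixed (pure a) (pure b) = (cmod (a 0 * b 1 - a 1 * b 0))\<^sup>2"
  unfolding hdet_mixed_def pure_def cmod_power2
  by (simp add: power2_eq_square algebra_simps)

text \<open>By the Cayley-Hamilton theorem a positive two by two matrix of trace one and determinant
  \<delta> squared has the square root
  \<open>(\<sigma> + \<delta> 1) / sqrt (1 + 2 * \<delta>)\<close>, whose determinant is
  \<delta>.\<close>

lemma psd_sqrt_2:
  assumes A: "psd 2 \<sigma>" and tr: "mtrace \<sigma> = 1"
  obtains M :: "nat \<Rightarrow> nat \<Rightarrow> complex" where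
    "\<And>i j. i < 2 \<Longrightarrow> j < 2 \<Longrightarrow> (\<Sum>k<2. M i k * cnj (M j k)) = \<sigma> $$ (i,j)"
    "M 0 0 * M 1 1 - M 0 1 * M 1 0 = of_real (sqrt (hdet \<sigma>))"
proof -
  have h: "herm 2 \<sigma>" using A by (simp add: psd_iff)
  have c: "\<sigma> \<in> carrier_mat 2 2" by (rule psd_carrier[OF A])
  define p q r where "p = Re (\<sigma> $$ (0,0))" and "q = \<sigma> $$ (0,1)" and "r = Re (\<sigma> $$ (1,1))"
  define \<delta> where "\<delta> = sqrt (hdet \<sigma>)"
  have e: "\<sigma> $$ (0,0) = of_real p" "\<sigma> $$ (1,1) = of_real r" "\<sigma> $$ (1,0) = cnj q" "\<sigma> $$ (0,1) = q"
    using herm_2_entries[OF h] by (auto simp: p_def q_def r_def)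
  have pr: "p + r = 1" using tr c by (simp add: mtrace_2 p_def r_def complex_eq_iff)
  have d0: "0 \<le> \<delta>" using psd_hdet[OF A] by (simp add: \<delta>_def)
  have dd: "\<delta> * \<delta> = p * r - (cmod q)\<^sup>2" using psd_hdet[OF A] by (simp add: \<delta>_def) (simp add: hdet_def p_def q_def r_def)
  define w where "w = sqrt (1 + 2 * \<delta>)"
  have w: "w * w = 1 + 2 * \<delta>" "w \<noteq> 0" using d0 by (auto simp: w_def)
  have q2: "q * cnj q = of_real (p * r - \<delta> * \<delta>)" using complex_norm_square[of q] dd by simp
  have r': "r = 1 - p" using pr by simp
  define M where "M i k = (if i = 0 then (if k = 0 then of_real (p + \<delta>) else q) else if k = 0 then cnj q else of_real (r + \<delta>)) / of_real w"
    for i k :: nat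
  have ww: "complex_of_real w * complex_of_real w = of_real (1 + 2 * \<delta>)" using w(1) by (simp flip: of_real_mult)
  have w0: "complex_of_real w \<noteq> 0" using w(2) by simp
  have nz: "complex_of_real (1 + 2 * \<delta>) \<noteq> 0" using d0 by (simp only: of_real_eq_0_iff)
  have qd: "(x / of_real w) * (y / of_real w) = x * y / of_real (1 + 2 * \<delta>)" for x y :: complex unfolding ww[symmetric] by simp
  have cancel: "x * of_real (1 + 2 * \<delta>) / of_real (1 + 2 * \<delta>) = x" for x :: complex
    unfolding times_divide_eq_right[symmetric] divide_self[OF nz] by simp
  have c00: "of_real (p + \<delta>) * of_real (p + \<delta>) + q * cnj q = complex_of_real (p * (1 + 2 * \<delta>))"
    unfolding q2 r' of_real_mult[symmetric] of_real_add[symmetric] by (rule arg_cong[of _ _ complex_of_real]) (simp add: algebra_simps)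
  have c11: "q * cnj q + of_real (r + \<delta>) * of_real (r + \<delta>) = complex_of_real (r * (1 + 2 * \<delta>))"
    unfolding q2 r' of_real_mult[symmetric] of_real_add[symmetric] by (rule arg_cong[of _ _ complex_of_real]) (simp add: algebra_simps)
  have c01: "of_real (p + \<delta>) * q + q * of_real (r + \<delta>) = q * complex_of_real (1 + 2 * \<delta>)"
    unfolding r' by (simp add: algebra_simps)
  have c01': "cnj q * of_real (p + \<delta>) + of_real (r + \<delta>) * cnj q = cnj q * complex_of_real (1 + 2 * \<delta>)"
    unfolding r' by (simp add: algebra_simps)
  have cM: "cnj (M i k) = M k i" if "i < 2" "k < 2" for i k using that by (auto simp: M_def less_2_cases_iff)
  have M: "M 0 0 = of_real (p + \<delta>) / of_real w" "M 0 1 = q / of_real w" "M 1 0 = cnj q / of_real w" "M 1 1 = of_real (r + \<delta>) / of_real w"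
    by (simp_all add: M_def)
  have sq: "(\<Sum>k<2. M i k * cnj (M j k)) = M i 0 * M 0 j + M i 1 * M 1 j" if "i < 2" "j < 2" for i j
    using that cM by (simp add: sum2)
  have "(\<Sum>k<2. M i k * cnj (M j k)) = \<sigma> $$ (i,j)" if ij: "i < 2" "j < 2" for i j
  proof -
    have "M 0 0 * M 0 0 + M 0 1 * M 1 0 = \<sigma> $$ (0,0)"
      unfolding M qd add_divide_distrib[symmetric] c00 e by (simp only: of_real_mult cancel)
    moreover have "M 0 0 * M 0 1 + M 0 1 * M 1 1 = \<sigma> $$ (0,1)"
      unfolding M qd add_divide_distrib[symmetric] c01 e by (rule cancel)
    moreover have "M 1 0 * M 0 0 + M 1 1 * M 1 0 = \<sigma> $$ (1,0)"
      unfolding M qd add_divide_distrib[symmetric] c01' e by (rule cancel)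
    moreover have "M 1 0 * M 0 1 + M 1 1 * M 1 1 = \<sigma> $$ (1,1)"
      unfolding M qd add_divide_distrib[symmetric] e by (simp only: mult.commute[of "cnj q" q] c11 of_real_mult cancel)
    ultimately show ?thesis using ij sq[OF ij] by (auto simp: less_2_cases_iff)
  qed
  moreover have "M 0 0 * M 1 1 - M 0 1 * M 1 0 = of_real \<delta>"
  proof -
    have "of_real (p + \<delta>) * of_real (r + \<delta>) - q * cnj q = complex_of_real (\<delta> * (1 + 2 * \<delta>))"
      unfolding q2 r' of_real_mult[symmetric] of_real_diff[symmetric] by (rule arg_cong[of _ _ complex_of_real]) (simp add: algebra_simps)
    then show ?thesis
      unfolding M qd diff_divide_distrib[symmetric] by (simp only: of_real_mult cancel)
  qed
  ultimately show ?thesis using that[of M] by (simp only: \<delta>_def)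
qed

section \<open>Channels between pairs of qubit states\<close>

text \<open>For qubit states, one minus \<open>hdet_mixed\<close> is tr (\<sigma>0 \<sigma>1), and
  adding twice the root of the product of the determinants gives the squared fidelity. By Uhlmann's
  theorem purifications realise the fidelity as an overlap; a larger purifying space also realises
  every overlap of smaller modulus.\<close>

lemma purification_pair:
  assumes S0: "psd 2 \<sigma>0" "mtrace \<sigma>0 = 1" and S1: "psd 2 \<sigma>1" "mtrace \<sigma>1 = 1"
    and c: "(cmod c)\<^sup>2 \<le> 1 - hdet_mixed \<sigma>0 \<sigma>1 + 2 * (sqrt (hdet \<sigma>0) * sqrt (hdet \<sigma>1))"
  obtains A B :: "nat \<Rightarrow> nat \<Rightarrow> complex" where
    "\<And>i j. i < 2 \<Longrightarrow> j < 2 \<Longrightarrow> (\<Sum>r<4. A r i * cnj (A r j)) = \<sigma>0 $$ (i,j)"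
    "\<And>i j. i < 2 \<Longrightarrow> j < 2 \<Longrightarrow> (\<Sum>r<4. B r i * cnj (B r j)) = \<sigma>1 $$ (i,j)"
    "(\<Sum>r<4. \<Sum>i<2. cnj (A r i) * B r i) = c"
proof -
  obtain M0 :: "nat \<Rightarrow> nat \<Rightarrow> complex" where M0:
    "\<And>i j. i < 2 \<Longrightarrow> j < 2 \<Longrightarrow> (\<Sum>k<2. M0 i k * cnj (M0 j k)) = \<sigma>0 $$ (i,j)"
    "M0 0 0 * M0 1 1 - M0 0 1 * M0 1 0 = of_real (sqrt (hdet \<sigma>0))" by (rule psd_sqrt_2[OF S0]) (rule that)
  obtain M1 :: "nat \<Rightarrow> nat \<Rightarrow> complex" where M1:
    "\<And>i j. i < 2 \<Longrightarrow> j < 2 \<Longrightarrow> (\<Sum>k<2. M1 i k * cnj (M1 j k)) = \<sigma>1 $$ (i,j)"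
    "M1 0 0 * M1 1 1 - M1 0 1 * M1 1 0 = of_real (sqrt (hdet \<sigma>1))" by (rule psd_sqrt_2[OF S1]) (rule that)
  define \<delta> where "\<delta> = sqrt (hdet \<sigma>0) * sqrt (hdet \<sigma>1)"
  \<comment> \<open>\<open>T\<close> is the adjoint of \<open>M0\<close> times \<open>M1\<close>. Up
    to normalisation, \<open>u\<close> and \<open>w\<close> form the first row of the special
    unitary \<open>W\<close> that maximises the real part of tr (T W).\<close>
  define T where "T k l = cnj (M0 0 k) * M1 0 l + cnj (M0 1 k) * M1 1 l" for k l
  define u where "u = cnj (T 0 0) + T 1 1"
  define w where "w = cnj (T 1 0) - T 0 1"
  define F where "F = 1 - hdet_mixed \<sigma>0 \<sigma>1 + 2 * \<delta>"
  have dT: "T 0 0 * T 1 1 - T 0 1 * T 1 0 = of_real \<delta>"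
  proof -
    have "T 0 0 * T 1 1 - T 0 1 * T 1 0 = cnj (M0 0 0 * M0 1 1 - M0 0 1 * M0 1 0) * (M1 0 0 * M1 1 1 - M1 0 1 * M1 1 0)"
      by (simp add: T_def algebra_simps)
    then show ?thesis unfolding M0(2) M1(2) by (simp add: \<delta>_def)
  qed
  have TT: "T 0 0 * cnj (T 0 0) + T 0 1 * cnj (T 0 1) + T 1 0 * cnj (T 1 0) + T 1 1 * cnj (T 1 1) = of_real (1 - hdet_mixed \<sigma>0 \<sigma>1)"
  proof -
    have h: "herm 2 \<sigma>0" "herm 2 \<sigma>1" using S0 S1 by (auto simp: psd_iff)
    have "T 0 0 * cnj (T 0 0) + T 0 1 * cnj (T 0 1) + T 1 0 * cnj (T 1 0) + T 1 1 * cnj (T 1 1) =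
      (\<Sum>k<2. M0 0 k * cnj (M0 0 k)) * (\<Sum>k<2. M1 0 k * cnj (M1 0 k))
      + (\<Sum>k<2. M0 1 k * cnj (M0 0 k)) * (\<Sum>k<2. M1 0 k * cnj (M1 1 k))
      + (\<Sum>k<2. M0 0 k * cnj (M0 1 k)) * (\<Sum>k<2. M1 1 k * cnj (M1 0 k))
      + (\<Sum>k<2. M0 1 k * cnj (M0 1 k)) * (\<Sum>k<2. M1 1 k * cnj (M1 1 k))"
      by (simp add: T_def sum2 algebra_simps)
    also have "\<dots> = \<sigma>0 $$ (0,0) * \<sigma>1 $$ (0,0) + \<sigma>0 $$ (1,0) * \<sigma>1 $$ (0,1) + \<sigma>0 $$ (0,1) * \<sigma>1 $$ (1,0) + \<sigma>0 $$ (1,1) * \<sigma>1 $$ (1,1)"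
      using M0(1) M1(1) by simp
    also have "\<dots> = of_real (1 - hdet_mixed \<sigma>0 \<sigma>1)"
    proof -
      define p0 q0 r0 where "p0 = Re (\<sigma>0 $$ (0,0))" and "q0 = \<sigma>0 $$ (0,1)" and "r0 = Re (\<sigma>0 $$ (1,1))"
      define p1 q1 r1 where "p1 = Re (\<sigma>1 $$ (0,0))" and "q1 = \<sigma>1 $$ (0,1)" and "r1 = Re (\<sigma>1 $$ (1,1))"
      have e0: "\<sigma>0 $$ (0,0) = of_real p0" "\<sigma>0 $$ (1,1) = of_real r0" "\<sigma>0 $$ (1,0) = cnj q0" "\<sigma>0 $$ (0,1) = q0"
        using herm_2_entries[OF h(1)] by (auto simp: p0_def q0_def r0_def)
      have e1: "\<sigma>1 $$ (0,0) = of_real p1" "\<sigma>1 $$ (1,1) = of_real r1" "\<sigma>1 $$ (1,0) = cnj q1" "\<sigma>1 $$ (0,1) = q1"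
        using herm_2_entries[OF h(2)] by (auto simp: p1_def q1_def r1_def)
      have "mtrace \<sigma>0 = of_real p0 + of_real r0" "mtrace \<sigma>1 = of_real p1 + of_real r1"
        unfolding mtrace_2[OF psd_carrier[OF S0(1)]] mtrace_2[OF psd_carrier[OF S1(1)]] e0 e1 by simp_all
      then have "complex_of_real (p0 + r0) = of_real 1" "complex_of_real (p1 + r1) = of_real 1" using S0 S1 by auto
      then have t: "r0 = 1 - p0" "r1 = 1 - p1" unfolding of_real_eq_iff by auto
      have mx: "hdet_mixed \<sigma>0 \<sigma>1 = p0 * r1 + r0 * p1 - 2 * Re (q0 * cnj q1)"
        unfolding hdet_mixed_def e0 e1 by simp
      show ?thesis unfolding mx e0 e1 t by (auto simp: complex_eq_iff algebra_simps)
    qed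
    finally show ?thesis .
  qed
  have uw: "u * cnj u + w * cnj w = of_real F"
  proof -
    have "u * cnj u + w * cnj w = (T 0 0 * cnj (T 0 0) + T 0 1 * cnj (T 0 1) + T 1 0 * cnj (T 1 0) + T 1 1 * cnj (T 1 1))
      + (T 0 0 * T 1 1 - T 0 1 * T 1 0) + cnj (T 0 0 * T 1 1 - T 0 1 * T 1 0)"
      by (simp add: u_def w_def algebra_simps)
    then show ?thesis unfolding TT dT by (simp add: F_def)
  qed
  have "of_real F = complex_of_real ((cmod u)\<^sup>2 + (cmod w)\<^sup>2)"
    unfolding uw[symmetric] by (simp only: of_real_add complex_norm_square)
  then have F: "F = (cmod u)\<^sup>2 + (cmod w)\<^sup>2" by (simp only: of_real_eq_iff)
  then have F0: "F \<ge> 0" by simp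
  have cF: "(cmod c)\<^sup>2 \<le> F" using c by (simp add: F_def \<delta>_def)
  define \<nu> where "\<nu> = sqrt F"
  have nn: "\<nu> * \<nu> = F" using F0 by (simp add: \<nu>_def)
  have "\<exists>N z. (\<forall>i<2. \<forall>j<2. (\<Sum>k<2. N i k * cnj (N j k)) = \<sigma>1 $$ (i,j)) \<and> cmod z \<le> 1 \<and>
      z * (\<Sum>k<2. \<Sum>i<2. cnj (M0 i k) * N i k) = c" (is "\<exists>N z. ?Q N z")
  proof (cases "\<nu> = 0")
    case True
    \<comment> \<open>At fidelity zero there is nothing to normalise, and the bound forces the
      required overlap to vanish too.\<close>
    then have "c = 0" using nn cF by simp
    then show ?thesis using M1(1) by (intro exI[of _ M1] exI[of _ 0]) auto
  next
    case False
    then have n0: "complex_of_real \<nu> \<noteq> 0" by simp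
    define \<alpha> \<beta> where "\<alpha> = u / of_real \<nu>" and "\<beta> = w / of_real \<nu>"
    have ab: "\<alpha> * cnj \<alpha> + \<beta> * cnj \<beta> = 1"
    proof -
      have "\<alpha> * cnj \<alpha> + \<beta> * cnj \<beta> = (u * cnj u + w * cnj w) / of_real (\<nu> * \<nu>)"
        by (simp add: \<alpha>_def \<beta>_def add_divide_distrib)
      then show ?thesis unfolding uw nn using False nn by auto
    qed
    \<comment> \<open>\<open>N\<close> is \<open>M1 * W\<close>: another root of the same state,
      whose overlap with \<open>M0\<close> is the fidelity.\<close>
    define N where "N i k = (if k = 0 then M1 i 0 * \<alpha> - M1 i 1 * cnj \<beta> else M1 i 0 * \<beta> + M1 i 1 * cnj \<alpha>)" for i k :: nat
    have "(\<Sum>k<2. N i k * cnj (N j k)) = \<sigma>1 $$ (i,j)" if "i < 2" "j < 2" for i j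
    proof -
      have "(\<Sum>k<2. N i k * cnj (N j k)) = (\<alpha> * cnj \<alpha> + \<beta> * cnj \<beta>) * (\<Sum>k<2. M1 i k * cnj (M1 j k))"
        by (simp add: sum2 N_def algebra_simps)
      then show ?thesis using ab M1(1)[OF that] by simp
    qed
    moreover have "(\<Sum>k<2. \<Sum>i<2. cnj (M0 i k) * N i k) = of_real \<nu>"
    proof -
      have "(\<Sum>k<2. \<Sum>i<2. cnj (M0 i k) * N i k) = T 0 0 * \<alpha> - T 0 1 * cnj \<beta> + T 1 0 * \<beta> + T 1 1 * cnj \<alpha>"
        by (simp add: sum2 N_def T_def algebra_simps)
      also have "\<dots> = (T 0 0 * u - T 0 1 * cnj w + T 1 0 * w + T 1 1 * cnj u) / of_real \<nu>"
        by (simp add: \<alpha>_def \<beta>_def add_divide_distrib diff_divide_distrib)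
      also have "T 0 0 * u - T 0 1 * cnj w + T 1 0 * w + T 1 1 * cnj u =
          (T 0 0 * cnj (T 0 0) + T 0 1 * cnj (T 0 1) + T 1 0 * cnj (T 1 0) + T 1 1 * cnj (T 1 1))
          + 2 * (T 0 0 * T 1 1 - T 0 1 * T 1 0)"
        by (simp add: u_def w_def algebra_simps)
      also have "\<dots> = of_real (\<nu> * \<nu>)" unfolding TT dT nn by (simp add: F_def)
      finally show ?thesis using n0 by simp
    qed
    moreover have "cmod (c / of_real \<nu>) \<le> 1"
    proof -
      have "(cmod c)\<^sup>2 \<le> \<nu>\<^sup>2" using cF nn by (simp add: power2_eq_square)
      then have "cmod c \<le> \<nu>" by (rule power2_le_imp_le) (simp add: \<nu>_def F0)
      moreover have "0 < \<nu>" using False F0 by (simp add: \<nu>_def)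
      ultimately show ?thesis by (simp add: norm_divide)
    qed
    ultimately show ?thesis using n0 by (intro exI[of _ N] exI[of _ "c / of_real \<nu>"]) simp
  qed
  then obtain N z where N: "\<And>i j. i < 2 \<Longrightarrow> j < 2 \<Longrightarrow> (\<Sum>k<2. N i k * cnj (N j k)) = \<sigma>1 $$ (i,j)" and z: "cmod z \<le> 1"
    and ov: "z * (\<Sum>k<2. \<Sum>i<2. cnj (M0 i k) * N i k) = c" by blast
  \<comment> \<open>Spreading \<open>N\<close> over four columns with weights \<open>z\<close> and
    \<open>\<zeta>\<close> preserves the state, while the overlap is scaled by \<open>z\<close>,
    since \<open>A\<close> is zero on the last two columns.\<close>
  define \<zeta> where "\<zeta> = complex_of_real (sqrt (1 - (cmod z)\<^sup>2))"
  have zz: "z * cnj z + \<zeta> * cnj \<zeta> = 1"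
  proof -
    have "(cmod z)\<^sup>2 \<le> 1" using z by (simp add: abs_square_le_1)
    then have "\<zeta> * cnj \<zeta> = of_real (1 - (cmod z)\<^sup>2)" by (simp add: \<zeta>_def flip: of_real_mult)
    then show ?thesis using complex_norm_square[of z] by simp
  qed
  define A where "A r i = (if r < 2 then M0 i r else 0)" for r i :: nat
  define B where "B r i = (if r < 2 then z * N i r else \<zeta> * N i (r - 2))" for r i :: nat
  show ?thesis
  proof (rule that[of A B])
    fix i j :: nat assume ij: "i < 2" "j < 2"
    show "(\<Sum>r<4. A r i * cnj (A r j)) = \<sigma>0 $$ (i,j)" using M0(1)[OF ij] by (simp add: sum4 sum2 A_def)
    have "(\<Sum>r<4. B r i * cnj (B r j)) = (z * cnj z + \<zeta> * cnj \<zeta>) * (\<Sum>k<2. N i k * cnj (N j k))"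
      by (simp add: sum4 sum2 B_def algebra_simps)
    then show "(\<Sum>r<4. B r i * cnj (B r j)) = \<sigma>1 $$ (i,j)" using zz N[OF ij] by simp
  next
    show "(\<Sum>r<4. \<Sum>i<2. cnj (A r i) * B r i) = c"
      using ov by (simp add: sum4 sum2 A_def B_def algebra_simps)
  qed
qed

text \<open>The sum \<open>d0 / x + x * d1\<close> is smallest at the quotient of the two roots.
  Either root may vanish, so this minimiser is only approximated.\<close>

lemma le_twice_sqrt_if_le_all:
  fixes m A d0 d1 :: real
  assumes d: "d0 \<ge> 0" "d1 \<ge> 0" and le: "\<And>x. x > 0 \<Longrightarrow> m \<le> A + d0 / x + x * d1"
  shows "m \<le> A + 2 * (sqrt d0 * sqrt d1)"
proof (rule field_le_epsilon)
  fix e' :: real assume e': "e' > 0"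
  define a b where "a = sqrt d0" and "b = sqrt d1"
  have ab: "a \<ge> 0" "b \<ge> 0" "a * a = d0" "b * b = d1" using d by (auto simp: a_def b_def)
  define e where "e = e' / (a + b + 1)"
  have e: "e > 0" "e * (a + b) \<le> e'"
    using e' ab by (auto simp: e_def field_simps)
  \<comment> \<open>The shift by \<open>e\<close> avoids dividing by zero and costs at most
    \<open>e * (a + b)\<close>, which the choice of \<open>e\<close> keeps below
    \<open>e'\<close>.\<close>
  define x where "x = (a + e) / (b + e)"
  have x: "x > 0" using ab e by (simp add: x_def)
  have "d0 / x = a * (b + e) * (a / (a + e))" using ab(1,2) e unfolding ab(3)[symmetric] by (simp add: x_def field_simps)
  also have "\<dots> \<le> a * (b + e) * 1" using ab e by (intro mult_left_mono) (auto simp: divide_le_eq_1)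
  finally have 1: "d0 / x \<le> a * (b + e)" by simp
  have "x * d1 = b * (a + e) * (b / (b + e))" using ab(1,2) e unfolding ab(4)[symmetric] by (simp add: x_def field_simps)
  also have "\<dots> \<le> b * (a + e) * 1" using ab e by (intro mult_left_mono) (auto simp: divide_le_eq_1)
  finally have 2: "x * d1 \<le> b * (a + e)" by simp
  have "m \<le> A + a * (b + e) + b * (a + e)" using le[OF x] 1 2 by linarith
  also have "\<dots> = A + 2 * (a * b) + e * (a + b)" by (simp add: algebra_simps)
  also have "\<dots> \<le> A + 2 * (sqrt d0 * sqrt d1) + e'" using e(2) by (simp add: a_def b_def)
  finally show "m \<le> A + 2 * (sqrt d0 * sqrt d1) + e'" .
qed

lemma hdet_traceless_neg:
  assumes H: "herm 2 H" "mtrace H = 0" "H \<noteq> 0\<^sub>m 2 2"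
  shows "hdet H < 0"
proof -
  have Hc: "H \<in> carrier_mat 2 2" using H by (simp add: herm_def)
  have t: "Re (H $$ (1,1)) = - Re (H $$ (0,0))"
    using H(2) unfolding mtrace_2[OF Hc] by (simp add: complex_eq_iff add_eq_0_iff)
  have eq: "hdet H = - ((Re (H $$ (0,0)))\<^sup>2 + (cmod (H $$ (0,1)))\<^sup>2)" unfolding hdet_def t by (simp add: power2_eq_square)
  have "hdet H \<noteq> 0"
  proof
    assume "hdet H = 0"
    then have "(Re (H $$ (0,0)))\<^sup>2 + (cmod (H $$ (0,1)))\<^sup>2 = 0" using eq by linarith
    then have z: "Re (H $$ (0,0)) = 0" "H $$ (0,1) = 0" unfolding sum_power2_eq_zero_iff by auto
    have "H $$ (0,0) = 0" "H $$ (1,1) = 0" "H $$ (1,0) = 0" using herm_2_entries[OF H(1)] z t by simp_all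
    then have "H = 0\<^sub>m 2 2" using Hc z(2) by (intro mat_2_eqI) auto
    then show False using H(3) by simp
  qed
  moreover have "hdet H \<le> 0" unfolding eq by simp
  ultimately show ?thesis by simp
qed

text \<open>Alberti and Uhlmann's theorem, reduced to a pair of pure states: the line through \<open>\<omega>\<close> in
  direction \<open>H\<close> meets the Bloch sphere in two points, and the norm inequalities say that the fidelity
  of their prospective images is at least their own.\<close>

lemma alberti_uhlmann:
  assumes w: "herm 2 \<omega>" "mtrace \<omega> = 1" "hdet \<omega> > 0" and H: "herm 2 H" "mtrace H = 0" "H \<noteq> 0\<^sub>m 2 2"
    and w': "herm 2 \<omega>'" "mtrace \<omega>' = 1" and H': "herm 2 H'" "mtrace H' = 0"
    and contr: "\<And>x y :: real. trace_norm (of_real x \<cdot>\<^sub>m \<omega>' + of_real y \<cdot>\<^sub>m H') \<le> trace_norm (of_real x \<cdot>\<^sub>m \<omega> + of_real y \<cdot>\<^sub>m H)"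
  obtains V where "CPTP 2 V" "V \<omega> = \<omega>'" "V H = H'"
proof -
  have car: "\<omega> \<in> carrier_mat 2 2" "H \<in> carrier_mat 2 2" "\<omega>' \<in> carrier_mat 2 2" "H' \<in> carrier_mat 2 2"
    using w H w' H' by (auto simp: herm_def)
  define L where "L x y = of_real x \<cdot>\<^sub>m \<omega> + of_real y \<cdot>\<^sub>m H" for x y :: real
  define L' where "L' x y = of_real x \<cdot>\<^sub>m \<omega>' + of_real y \<cdot>\<^sub>m H'" for x y :: real
  have Lc: "L x y \<in> carrier_mat 2 2" "L' x y \<in> carrier_mat 2 2" for x y using car by (auto simp: L_def L'_def)
  have Lh: "herm 2 (L x y)" "herm 2 (L' x y)" for x y
    unfolding L_def L'_def by (intro herm_add herm_smult w H w' H')+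
  have Lt: "mtrace (L x y) = of_real x" "mtrace (L' x y) = of_real x" for x y
    using car w H w' H' by (simp_all add: L_def L'_def mtrace_add[of _ 2] mtrace_smult[of _ 2])
  have Lcomb: "of_real s \<cdot>\<^sub>m L x y + of_real t \<cdot>\<^sub>m L x' y' = L (s * x + t * x') (s * y + t * y')"
    "of_real s \<cdot>\<^sub>m L' x y + of_real t \<cdot>\<^sub>m L' x' y' = L' (s * x + t * x') (s * y + t * y')" for s t x y x' y'
    using car by (auto simp: L_def L'_def algebra_simps intro!: eq_matI)
  have L10: "L 1 0 = \<omega>" "L 0 1 = H" "L' 1 0 = \<omega>'" "L' 0 1 = H'"
    using car by (auto simp: L_def L'_def intro!: eq_matI)
  define e where "e = - hdet H"
  have e: "e > 0" using hdet_traceless_neg[OF H] by (simp add: e_def)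
  define D where "D = hdet \<omega>"
  define b where "b = hdet_mixed \<omega> H"
  define s where "s = sqrt (b\<^sup>2 + 4 * e * D)"
  have s: "s > 0" "s * s = b\<^sup>2 + 4 * e * D"
  proof -
    have "0 < b\<^sup>2 + 4 * e * D" using e w(3) by (intro add_nonneg_pos) (auto simp: D_def)
    then show "s > 0" "s * s = b\<^sup>2 + 4 * e * D" by (auto simp: s_def)
  qed
  \<comment> \<open>The zeros of the determinant \<open>D + x * b - x\<^sup>2 * e\<close> along the
    trace one operators \<open>L 1 x\<close>, real because \<open>e\<close> and \<open>D\<close> are
    positive. These are the two points on the Bloch sphere.\<close>
  define x1 where "x1 = (b - s) / (2 * e)"
  define x2 where "x2 = (b + s) / (2 * e)"
  have x12: "x2 - x1 = s / e" using e by (simp add: x1_def x2_def field_simps)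
  then have x12p: "x2 - x1 > 0" using e s by simp
  have hL: "hdet (L x y) = x\<^sup>2 * D + x * y * b - y\<^sup>2 * e" for x y
    unfolding L_def hdet_lincomb[OF car(1,2)] by (simp add: D_def b_def e_def)
  have root: "hdet (L 1 x) = 0" if x: "2 * e * x = b + \<epsilon> * s" and ep: "\<epsilon> * \<epsilon> = 1" for x \<epsilon>
  proof -
    have "4 * e * (D + x * b - x\<^sup>2 * e) = 4 * e * D + b\<^sup>2 - (2 * e * x - b)\<^sup>2"
      by (simp add: power2_eq_square algebra_simps)
    also have "(2 * e * x - b)\<^sup>2 = (\<epsilon> * \<epsilon>) * (s * s)" unfolding x by (simp add: power2_eq_square)
    also have "4 * e * D + b\<^sup>2 - (\<epsilon> * \<epsilon>) * (s * s) = 0" unfolding ep s(2) by simp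
    finally show ?thesis using e by (simp add: hL)
  qed
  define P where "P = L 1 x1"
  define Q where "Q = L 1 x2"
  have hP: "hdet P = 0" unfolding P_def by (rule root[of _ "-1"]) (use e in \<open>auto simp: x1_def\<close>)
  have hQ: "hdet Q = 0" unfolding Q_def by (rule root[of _ 1]) (use e in \<open>auto simp: x2_def\<close>)
  have Pc: "P \<in> carrier_mat 2 2" "Q \<in> carrier_mat 2 2" using Lc by (auto simp: P_def Q_def)
  obtain a where a: "P = pure a" "cnj (a 0) * a 0 + cnj (a 1) * a 1 = 1"
    using pure_if_hdet_zero[of P] Lh Lt hP by (auto simp: P_def)
  obtain c where c: "Q = pure c" "cnj (c 0) * c 0 + cnj (c 1) * c 1 = 1"
    using pure_if_hdet_zero[of Q] Lh Lt hQ by (auto simp: Q_def)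
  define g where "g = hdet_mixed P Q"
  define \<Delta> where "\<Delta> = a 0 * c 1 - a 1 * c 0"
  have g: "g = (cmod \<Delta>)\<^sup>2" unfolding g_def \<Delta>_def a c by (rule hdet_mixed_pure)
  have hPQ: "hdet (of_real x \<cdot>\<^sub>m P + of_real y \<cdot>\<^sub>m Q) = x * y * g" for x y
    unfolding hdet_lincomb[OF Pc] hP hQ g_def by simp
  have "hdet (of_real (-1) \<cdot>\<^sub>m P + of_real 1 \<cdot>\<^sub>m Q) = - ((x2 - x1)\<^sup>2 * e)"
    unfolding P_def Q_def Lcomb hL by simp
  then have "g = (x2 - x1)\<^sup>2 * e" unfolding hPQ by simp
  then have "g > 0" using e x12p by simp
  then have D0: "\<Delta> \<noteq> 0" using g by auto
  define \<sigma>0 where "\<sigma>0 = L' 1 x1"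
  define \<sigma>1 where "\<sigma>1 = L' 1 x2"
  have Sc: "\<sigma>0 \<in> carrier_mat 2 2" "\<sigma>1 \<in> carrier_mat 2 2" using Lc by (auto simp: \<sigma>0_def \<sigma>1_def)
  \<comment> \<open>A trace one operator of determinant zero has norm 1, so contraction bounds the
    norm of its counterpart by the trace.\<close>
  have psd: "psd 2 (L' 1 x)" if "hdet (L 1 x) = 0" for x
  proof (rule psd_if_trace_norm_le)
    have "(trace_norm (L 1 x))\<^sup>2 = 1" unfolding trace_norm_herm_2[OF Lh(1)] that by (simp add: Lt)
    then have "trace_norm (L 1 x) \<le> 1" by (metis abs_le_square_iff abs_of_nonneg one_power2 order_refl trace_norm_nonneg[OF Lc(1)] zero_le_one)
    then show "trace_norm (L' 1 x) \<le> Re (mtrace (L' 1 x))"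
      using contr[of 1 x] by (simp add: Lt) (simp add: L_def L'_def)
  qed (rule Lc)
  have S0: "psd 2 \<sigma>0" "mtrace \<sigma>0 = 1" and S1: "psd 2 \<sigma>1" "mtrace \<sigma>1 = 1"
    using psd hP hQ Lt by (auto simp: \<sigma>0_def \<sigma>1_def P_def Q_def)
  \<comment> \<open>Contraction at \<open>P - x Q\<close> compares determinants of
    \<open>P - x Q\<close> and \<open>\<sigma>0 - x \<sigma>1\<close>. Dividing by \<open>x\<close>
    and optimising over \<open>x > 0\<close> yields the fidelity inequality.\<close>
  have "hdet_mixed \<sigma>0 \<sigma>1 \<le> g + 2 * (sqrt (hdet \<sigma>0) * sqrt (hdet \<sigma>1))"
  proof (rule le_twice_sqrt_if_le_all)
    show "0 \<le> hdet \<sigma>0" "0 \<le> hdet \<sigma>1" using psd_hdet S0 S1 by auto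
    fix x :: real assume x: "x > 0"
    define Y where "Y = of_real 1 \<cdot>\<^sub>m \<sigma>0 + of_real (- x) \<cdot>\<^sub>m \<sigma>1"
    define Z where "Z = of_real 1 \<cdot>\<^sub>m P + of_real (- x) \<cdot>\<^sub>m Q"
    have Y: "Y = L' (1 - x) (x1 - x * x2)" unfolding Y_def \<sigma>0_def \<sigma>1_def Lcomb by simp
    have Z: "Z = L (1 - x) (x1 - x * x2)" unfolding Z_def P_def Q_def Lcomb by simp
    have hZ: "hdet Z = - x * g" unfolding Z_def hPQ by simp
    have "hdet Z \<le> hdet Y"
    proof (rule hdet_mono_if_trace_norm_le)
      show "trace_norm Y \<le> trace_norm Z" unfolding Y Z L_def L'_def by (rule contr)
      show "hdet Z \<le> 0" unfolding hZ using x \<open>g > 0\<close> by simp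
    qed (auto simp: Y Z Lh Lt)
    also have "hdet Y = hdet \<sigma>0 - x * hdet_mixed \<sigma>0 \<sigma>1 + x\<^sup>2 * hdet \<sigma>1"
      unfolding Y_def hdet_lincomb[OF Sc] by simp
    finally have "x * hdet_mixed \<sigma>0 \<sigma>1 \<le> x * (g + hdet \<sigma>0 / x + x * hdet \<sigma>1)"
      using x by (simp add: hZ algebra_simps power2_eq_square)
    then show "hdet_mixed \<sigma>0 \<sigma>1 \<le> g + hdet \<sigma>0 / x + x * hdet \<sigma>1" using x by (simp only: mult_le_cancel_left_pos)
  qed
  moreover have "(cmod (cnj (a 0) * c 0 + cnj (a 1) * c 1))\<^sup>2 = 1 - g"
  proof -
    have "complex_of_real ((cmod (cnj (a 0) * c 0 + cnj (a 1) * c 1))\<^sup>2 + (cmod \<Delta>)\<^sup>2) =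
      (cnj (a 0) * a 0 + cnj (a 1) * a 1) * (cnj (c 0) * c 0 + cnj (c 1) * c 1)"
      unfolding of_real_add complex_norm_square \<Delta>_def by (simp add: algebra_simps)
    also have "\<dots> = complex_of_real 1" unfolding a c by simp
    finally show ?thesis unfolding of_real_eq_iff g by simp
  qed
  ultimately have "(cmod (cnj (a 0) * c 0 + cnj (a 1) * c 1))\<^sup>2 \<le> 1 - hdet_mixed \<sigma>0 \<sigma>1 + 2 * (sqrt (hdet \<sigma>0) * sqrt (hdet \<sigma>1))"
    by simp
  then obtain A B :: "nat \<Rightarrow> nat \<Rightarrow> complex" where
    A: "\<And>i j. i < 2 \<Longrightarrow> j < 2 \<Longrightarrow> (\<Sum>r<4. A r i * cnj (A r j)) = \<sigma>0 $$ (i,j)" and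
    B: "\<And>i j. i < 2 \<Longrightarrow> j < 2 \<Longrightarrow> (\<Sum>r<4. B r i * cnj (B r j)) = \<sigma>1 $$ (i,j)" and
    AB: "(\<Sum>r<4. \<Sum>i<2. cnj (A r i) * B r i) = cnj (a 0) * c 0 + cnj (a 1) * c 1"
    using purification_pair[OF S0 S1] by blast
  have norm: "(\<Sum>r<4. \<Sum>i<2. cnj (C r i) * C r i) = mtrace \<tau>"
    if "\<tau> \<in> carrier_mat 2 2" "\<And>i j. i < 2 \<Longrightarrow> j < 2 \<Longrightarrow> (\<Sum>r<4. C r i * cnj (C r j)) = \<tau> $$ (i,j)"
    for C :: "nat \<Rightarrow> nat \<Rightarrow> complex" and \<tau>
  proof -
    have "(\<Sum>r<4. \<Sum>i<2. cnj (C r i) * C r i) = (\<Sum>i<2. \<Sum>r<4. C r i * cnj (C r i))"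
      by (subst sum.swap) (simp add: mult.commute)
    then show ?thesis using that by (simp add: sum2 mtrace_2)
  qed
  obtain V where V: "CPTP 2 V" "V (pure a) = mat 2 2 (\<lambda>(i,j). \<Sum>r<4. A r i * cnj (A r j))"
    "V (pure c) = mat 2 2 (\<lambda>(i,j). \<Sum>r<4. B r i * cnj (B r j))"
    using pure_pair_channel[where a=a and b=c and n=4 and A=A and B=B] D0 norm[OF Sc(1) A] norm[OF Sc(2) B] S0(2) S1(2) AB a(2) c(2)
    by (auto simp: \<Delta>_def)
  have VP: "V P = \<sigma>0" unfolding a V(2) using A Sc by (intro eq_matI) auto
  have VQ: "V Q = \<sigma>1" unfolding c V(3) using B Sc by (intro eq_matI) auto
  note LV = CPTP_D(1)[OF V(1)]
  have VL: "V (of_real x \<cdot>\<^sub>m P + of_real y \<cdot>\<^sub>m Q) = of_real x \<cdot>\<^sub>m \<sigma>0 + of_real y \<cdot>\<^sub>m \<sigma>1" for x y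
    using linear_map_onD(2)[OF LV, of "of_real x \<cdot>\<^sub>m P" "of_real y \<cdot>\<^sub>m Q"] linear_map_onD(3)[OF LV] Pc VP VQ by simp
  define k where "k = x2 - x1"
  have k: "k \<noteq> 0" using x12p by (simp add: k_def)
  \<comment> \<open>The coefficients that recover \<open>\<omega>\<close> and \<open>H\<close> from
    the two points \<open>P\<close> and \<open>Q\<close> of the line.\<close>
  have u: "x2 / k * 1 + - (x1 / k) * 1 = 1" "x2 / k * x1 + - (x1 / k) * x2 = 0"
    "- (1 / k) * 1 + 1 / k * 1 = 0" "- (1 / k) * x1 + 1 / k * x2 = 1"
    using k by (auto simp: field_simps) (simp_all add: k_def)
  have "V \<omega> = \<omega>'"
    using VL[of "x2 / k" "- (x1 / k)"] unfolding P_def Q_def \<sigma>0_def \<sigma>1_def Lcomb u L10 .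
  moreover have "V H = H'"
    using VL[of "- (1 / k)" "1 / k"] unfolding P_def Q_def \<sigma>0_def \<sigma>1_def Lcomb u L10 .
  ultimately show ?thesis using that V(1) by blast
qed

section \<open>Divisibility of contractive qubit evolutions\<close>

context contractive_qubit_evolution
begin

text \<open>Here \<open>\<Lambda> s X\<close> depends only on the trace of \<open>X\<close>, and by
  the growth of kernels so does \<open>\<Lambda> t X\<close>. The factor prepares the image at time
  \<open>t\<close> of the maximally mixed state, written as a root times its adjoint.\<close>

lemma factor_if_constant:
  assumes st: "0 < s" "s \<le> t" and kill: "\<And>X. herm 2 X \<Longrightarrow> mtrace X = 0 \<Longrightarrow> \<Lambda> s X = 0\<^sub>m 2 2"
  shows "\<exists>V. CPTP 2 V \<and> (\<forall>X\<in>carrier_mat 2 2. \<Lambda> t X = V (\<Lambda> s X))"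
proof -
  have s: "CPTP 2 (\<Lambda> s)" and t: "CPTP 2 (\<Lambda> t)" using channel st by auto
  define I where "I = complex_of_real (1/2) \<cdot>\<^sub>m (1\<^sub>m 2 :: complex mat)"
  have I: "psd 2 I" unfolding I_def by (rule psd_smult[OF psd_one]) simp
  have trI: "mtrace I = 1" by (simp add: I_def mtrace_smult[of _ 2] mtrace_one)
  have Ic: "I \<in> carrier_mat 2 2" by (rule psd_carrier[OF I])
  have W: "psd 2 (\<Lambda> t I)" "mtrace (\<Lambda> t I) = 1" using CPTP_psd[OF t I] CPTP_D(3)[OF t Ic] trI by auto
  have Wc: "\<Lambda> t I \<in> carrier_mat 2 2" by (rule psd_carrier[OF W(1)])
  obtain M :: "nat \<Rightarrow> nat \<Rightarrow> complex" where M: "\<And>i j. i < 2 \<Longrightarrow> j < 2 \<Longrightarrow> (\<Sum>k<2. M i k * cnj (M j k)) = \<Lambda> t I $$ (i,j)"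
    by (rule psd_sqrt_2[OF W]) (rule that)
  have "(\<Sum>i<2. \<Sum>k<2. cnj (M i k) * M i k) = 1"
  proof -
    have "(\<Sum>i<2. \<Sum>k<2. cnj (M i k) * M i k) = (\<Sum>i<2. \<Sum>k<2. M i k * cnj (M i k))" by (simp add: mult.commute)
    also have "\<dots> = mtrace (\<Lambda> t I)" using M Wc by (simp add: mtrace_eq[of _ 2])
    finally show ?thesis using W(2) by simp
  qed
  then obtain V where V: "CPTP 2 V"
    "\<And>X. X \<in> carrier_mat 2 2 \<Longrightarrow> V X = mat 2 2 (\<lambda>(i,j). mtrace X * (\<Sum>k<2. M i k * cnj (M j k)))"
    using replacer_channel[of M] by blast
  have "\<Lambda> t X = V (\<Lambda> s X)" if X: "X \<in> carrier_mat 2 2" for X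
  proof -
    have Y: "X - mtrace X \<cdot>\<^sub>m I \<in> carrier_mat 2 2" using Ic by (simp add: minus_carrier_mat)
    have trY: "mtrace (X - mtrace X \<cdot>\<^sub>m I) = 0"
      using X Ic trI by (simp add: mtrace_minus[of _ 2] mtrace_smult[of _ 2])
    obtain A B where AB: "herm 2 A" "herm 2 B" and YAB: "X - mtrace X \<cdot>\<^sub>m I = A + \<i> \<cdot>\<^sub>m B" by (rule herm_decomp[OF Y])
    have c: "A \<in> carrier_mat 2 2" "B \<in> carrier_mat 2 2" using AB by (auto simp: herm_def)
    have "mtrace A + \<i> * mtrace B = 0" using trY YAB c by (simp add: mtrace_add[of _ 2] mtrace_smult[of _ 2])
    moreover have "Im (mtrace A) = 0" "Im (mtrace B) = 0" using mtrace_herm_real AB by auto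
    ultimately have "mtrace A = 0" "mtrace B = 0" by (auto simp: complex_eq_iff)
    then have "\<Lambda> s A = 0\<^sub>m 2 2" "\<Lambda> s B = 0\<^sub>m 2 2" using kill AB by auto
    then have "\<Lambda> s (X - mtrace X \<cdot>\<^sub>m I) = 0\<^sub>m 2 2"
      unfolding YAB using linear_map_onD(2)[OF CPTP_D(1)[OF s] c(1), of "\<i> \<cdot>\<^sub>m B"]
        linear_map_onD(3)[OF CPTP_D(1)[OF s] c(2), of \<i>] c by (auto intro!: eq_matI)
    then have "\<Lambda> t (X - mtrace X \<cdot>\<^sub>m I) = 0\<^sub>m 2 2" by (rule kernel_mono[OF st Y])
    then have "\<Lambda> t X - mtrace X \<cdot>\<^sub>m \<Lambda> t I = 0\<^sub>m 2 2"
      using linear_map_on_minus[OF CPTP_D(1)[OF t] X, of "mtrace X \<cdot>\<^sub>m I"] linear_map_onD(3)[OF CPTP_D(1)[OF t] Ic] Ic by simp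
    note z = this
    have e: "\<Lambda> t X $$ (i,j) = mtrace X * \<Lambda> t I $$ (i,j)" if "i < 2" "j < 2" for i j
      using arg_cong[OF z, of "\<lambda>M. M $$ (i,j)"] that Wc by simp
    have "V (\<Lambda> s X) = mat 2 2 (\<lambda>(i,j). mtrace X * (\<Sum>k<2. M i k * cnj (M j k)))"
      unfolding V(2)[OF CPTP_D(4)[OF s X]] CPTP_D(3)[OF s X] ..
    then show ?thesis using e M CPTP_D(4)[OF t X] by (intro eq_matI) auto
  qed
  then show ?thesis using V(1) by blast
qed

text \<open>Modulo the kernel of \<open>\<Lambda> s\<close>, which \<open>\<Lambda> t\<close>
  annihilates as well, every operator is a combination of the maximally mixed state and
  \<open>X0\<close>. A factor is thus constrained only at their two images.\<close>

lemma factor_if_line: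
  assumes st: "0 < s" "s \<le> t" and X0: "herm 2 X0" "mtrace X0 = 0" "\<Lambda> s X0 \<noteq> 0\<^sub>m 2 2"
    and line: "\<And>X. X \<in> carrier_mat 2 2 \<Longrightarrow> \<exists>\<beta>. \<Lambda> s (X - (mtrace X / 2) \<cdot>\<^sub>m 1\<^sub>m 2 - \<beta> \<cdot>\<^sub>m X0) = 0\<^sub>m 2 2"
  shows "\<exists>V. CPTP 2 V \<and> (\<forall>X\<in>carrier_mat 2 2. \<Lambda> t X = V (\<Lambda> s X))"
proof -
  have s: "CPTP 2 (\<Lambda> s)" and t: "CPTP 2 (\<Lambda> t)" using channel st by auto
  note Ls = CPTP_D(1)[OF s] and Lt = CPTP_D(1)[OF t]
  define I where "I = complex_of_real (1/2) \<cdot>\<^sub>m (1\<^sub>m 2 :: complex mat)"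
  have I: "psd 2 I" unfolding I_def by (rule psd_smult[OF psd_one]) simp
  have trI: "mtrace I = 1" by (simp add: I_def mtrace_smult[of _ 2] mtrace_one)
  have Ic: "I \<in> carrier_mat 2 2" by (rule psd_carrier[OF I])
  have Ih: "herm 2 I" using I by (simp add: psd_iff)
  have X0c: "X0 \<in> carrier_mat 2 2" using X0 by (simp add: herm_def)
  define \<omega> H \<omega>' H' where "\<omega> = \<Lambda> s I" and "H = \<Lambda> s X0" and "\<omega>' = \<Lambda> t I" and "H' = \<Lambda> t X0"
  have wc: "\<omega> \<in> carrier_mat 2 2" "H \<in> carrier_mat 2 2"
    using CPTP_D(4)[OF s] Ic X0c by (auto simp: \<omega>_def H_def)
  have Hh: "herm 2 H" unfolding H_def by (rule CPTP_herm[OF s X0(1)])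
  have lc: "\<Lambda> u (x \<cdot>\<^sub>m I + y \<cdot>\<^sub>m X0) = x \<cdot>\<^sub>m \<Lambda> u I + y \<cdot>\<^sub>m \<Lambda> u X0" if "u \<ge> 0" for u x y
    using linear_map_onD(2)[OF linear[OF that], of "x \<cdot>\<^sub>m I" "y \<cdot>\<^sub>m X0"] linear_map_onD(3)[OF linear[OF that]] Ic X0c by simp
  \<comment> \<open>The maximally mixed state can be moved a little along \<open>X0\<close> in both
    directions without losing positivity. Hence \<open>\<omega>\<close> can be moved along
    \<open>H\<close>, so it is not on the Bloch sphere.\<close>
  have hw: "hdet \<omega> > 0"
  proof -
    obtain k where k: "k > 0" "psd 2 (X0 + complex_of_real k \<cdot>\<^sub>m 1\<^sub>m 2)" by (rule psd_shift[OF X0(1)])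
    have "herm 2 (complex_of_real (-1) \<cdot>\<^sub>m X0)" by (rule herm_smult[OF X0(1)])
    then obtain l where l: "l > 0" "psd 2 (complex_of_real (-1) \<cdot>\<^sub>m X0 + complex_of_real l \<cdot>\<^sub>m 1\<^sub>m 2)" by (rule psd_shift)
    have e1: "X0 + complex_of_real k \<cdot>\<^sub>m 1\<^sub>m 2 = complex_of_real (2 * k) \<cdot>\<^sub>m I + complex_of_real 1 \<cdot>\<^sub>m X0"
      using X0c by (intro eq_matI) (auto simp: I_def)
    have e2: "complex_of_real (-1) \<cdot>\<^sub>m X0 + complex_of_real l \<cdot>\<^sub>m 1\<^sub>m 2 = complex_of_real (2 * l) \<cdot>\<^sub>m I + complex_of_real (-1) \<cdot>\<^sub>m X0"
      using X0c by (intro eq_matI) (auto simp: I_def)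
    have "psd 2 (complex_of_real (2 * k) \<cdot>\<^sub>m \<omega> + complex_of_real 1 \<cdot>\<^sub>m H)" "psd 2 (complex_of_real (2 * l) \<cdot>\<^sub>m \<omega> + complex_of_real (-1) \<cdot>\<^sub>m H)"
      using CPTP_psd[OF s k(2)] CPTP_psd[OF s l(2)] st unfolding e1 e2 by (simp_all add: lc \<omega>_def H_def)
    then have "0 \<le> hdet (complex_of_real (2 * k) \<cdot>\<^sub>m \<omega> + complex_of_real 1 \<cdot>\<^sub>m H)"
      "0 \<le> hdet (complex_of_real (2 * l) \<cdot>\<^sub>m \<omega> + complex_of_real (-1) \<cdot>\<^sub>m H)" by (auto intro: psd_hdet)
    then have h: "0 \<le> (2 * k)\<^sup>2 * hdet \<omega> + 2 * k * hdet_mixed \<omega> H + hdet H" "0 \<le> (2 * l)\<^sup>2 * hdet \<omega> - 2 * l * hdet_mixed \<omega> H + hdet H"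
      unfolding hdet_lincomb[OF wc] by simp_all
    have Hneg: "hdet H < 0"
      using hdet_traceless_neg[OF Hh] CPTP_D(3)[OF s X0c] X0 by (simp add: H_def)
    \<comment> \<open>The weights \<open>l\<close> and \<open>k\<close> cancel the mixed terms of
      the two inequalities.\<close>
    have "0 \<le> l * ((2 * k)\<^sup>2 * hdet \<omega> + 2 * k * hdet_mixed \<omega> H + hdet H) + k * ((2 * l)\<^sup>2 * hdet \<omega> - 2 * l * hdet_mixed \<omega> H + hdet H)"
      using mult_nonneg_nonneg[OF less_imp_le[OF l(1)] h(1)] mult_nonneg_nonneg[OF less_imp_le[OF k(1)] h(2)] by linarith
    also have "\<dots> = (4 * k * l * (k + l)) * hdet \<omega> + (k + l) * hdet H" by (simp add: power2_eq_square algebra_simps)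
    also have "\<dots> < (4 * k * l * (k + l)) * hdet \<omega>" using Hneg k(1) l(1) by (simp add: mult_pos_neg)
    finally have "0 < (4 * k * l * (k + l)) * hdet \<omega>" .
    then show ?thesis by (rule zero_less_mult_pos) (use k(1) l(1) in simp)
  qed
  have contr: "trace_norm (of_real x \<cdot>\<^sub>m \<omega>' + of_real y \<cdot>\<^sub>m H') \<le> trace_norm (of_real x \<cdot>\<^sub>m \<omega> + of_real y \<cdot>\<^sub>m H)" for x y :: real
    using contractive_one[OF st, of "of_real x \<cdot>\<^sub>m I + of_real y \<cdot>\<^sub>m X0"] st Ih X0(1)
    by (simp add: lc \<omega>_def H_def \<omega>'_def H'_def herm_add herm_smult)
  obtain V where V: "CPTP 2 V" "V \<omega> = \<omega>'" "V H = H'"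
  proof (rule alberti_uhlmann[OF _ _ hw Hh _ _ _ _ _ _ contr])
    show "herm 2 \<omega>" "herm 2 \<omega>'" "herm 2 H'"
      unfolding \<omega>_def \<omega>'_def H'_def by (rule CPTP_herm[OF s Ih] CPTP_herm[OF t Ih] CPTP_herm[OF t X0(1)])+
    show "mtrace \<omega> = 1" "mtrace \<omega>' = 1" "mtrace H = 0" "mtrace H' = 0"
      unfolding \<omega>_def \<omega>'_def H_def H'_def using CPTP_D(3)[OF s] CPTP_D(3)[OF t] Ic X0c trI X0(2) by simp_all
    show "H \<noteq> 0\<^sub>m 2 2" using X0(3) by (simp add: H_def)
  qed (rule that)
  have "\<Lambda> t X = V (\<Lambda> s X)" if X: "X \<in> carrier_mat 2 2" for X
  proof -
    obtain \<beta> where b: "\<Lambda> s (X - (mtrace X / 2) \<cdot>\<^sub>m 1\<^sub>m 2 - \<beta> \<cdot>\<^sub>m X0) = 0\<^sub>m 2 2" using line[OF X] by blast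
    define R where "R = X - (mtrace X / 2) \<cdot>\<^sub>m 1\<^sub>m 2 - \<beta> \<cdot>\<^sub>m X0"
    define Y where "Y = mtrace X \<cdot>\<^sub>m I + \<beta> \<cdot>\<^sub>m X0"
    have Rc: "R \<in> carrier_mat 2 2" and Yc: "Y \<in> carrier_mat 2 2"
      using X0c Ic by (auto simp: R_def Y_def minus_carrier_mat)
    have Rs: "\<Lambda> s R = 0\<^sub>m 2 2" using b by (simp add: R_def)
    have Rt: "\<Lambda> t R = 0\<^sub>m 2 2" by (rule kernel_mono[OF st Rc Rs])
    have XRY: "X = R + Y" using X X0c by (intro eq_matI) (auto simp: R_def Y_def I_def)
    have "\<Lambda> s X = \<Lambda> s Y"
      unfolding XRY linear_map_onD(2)[OF Ls Rc Yc] Rs using linear_map_onD(1)[OF Ls Yc] by simp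
    moreover have "\<Lambda> t X = \<Lambda> t Y"
      unfolding XRY linear_map_onD(2)[OF Lt Rc Yc] Rt using linear_map_onD(1)[OF Lt Yc] by simp
    moreover have "\<Lambda> s Y = mtrace X \<cdot>\<^sub>m \<omega> + \<beta> \<cdot>\<^sub>m H" "\<Lambda> t Y = mtrace X \<cdot>\<^sub>m \<omega>' + \<beta> \<cdot>\<^sub>m H'"
      using lc[of s "mtrace X" \<beta>] lc[of t "mtrace X" \<beta>] st by (simp_all add: Y_def \<omega>_def H_def \<omega>'_def H'_def)
    moreover have "V (mtrace X \<cdot>\<^sub>m \<omega> + \<beta> \<cdot>\<^sub>m H) = mtrace X \<cdot>\<^sub>m \<omega>' + \<beta> \<cdot>\<^sub>m H'"
      using linear_map_onD(2)[OF CPTP_D(1)[OF V(1)], of "mtrace X \<cdot>\<^sub>m \<omega>" "\<beta> \<cdot>\<^sub>m H"]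
        linear_map_onD(3)[OF CPTP_D(1)[OF V(1)]] wc V by simp
    ultimately show ?thesis by simp
  qed
  then show ?thesis using V(1) by blast
qed

lemma divisible:
  assumes st: "0 \<le> s" "s \<le> t"
  shows "\<exists>V. CPTP 2 V \<and> (\<forall>X\<in>carrier_mat 2 2. \<Lambda> t X = V (\<Lambda> s X))"
proof (cases "s = 0")
  case True
  then show ?thesis using channel[of t] initial st by auto
next
  case False
  then have s: "0 < s" using st by simp
  show ?thesis
  proof (cases "injective_at s")
    case True
    then show ?thesis by (rule factor_if_injective[OF s st(2)])
  next
    case False
    then obtain t1 where t1: "0 < t1" "t1 \<le> s" "\<not> injective_at t1" "\<And>s. 0 < s \<Longrightarrow> s < t1 \<Longrightarrow> injective_at s"
      using first_singular_time[OF s] by blast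
    show ?thesis
    proof (cases "\<forall>X. herm 2 X \<longrightarrow> mtrace X = 0 \<longrightarrow> \<Lambda> s X = 0\<^sub>m 2 2")
      case True
      then show ?thesis using factor_if_constant[OF s st(2)] by blast
    next
      case False
      then obtain X0 where X0: "herm 2 X0" "mtrace X0 = 0" "\<Lambda> s X0 \<noteq> 0\<^sub>m 2 2" by blast
      have X0c: "X0 \<in> carrier_mat 2 2" using X0 by (simp add: herm_def)
      \<comment> \<open>What survives until \<open>s\<close> has survived \<open>t1\<close>. So the
        line found at \<open>t1\<close> is spanned by the image of \<open>X0\<close>, and growth of
        kernels carries the relation on to \<open>s\<close>.\<close>
      have X01: "\<Lambda> t1 X0 \<noteq> 0\<^sub>m 2 2" using kernel_mono[OF t1(1,2) X0c] X0(3) by blast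
      show ?thesis
      proof (rule factor_if_line[OF s st(2) X0])
        fix X :: "complex mat" assume X: "X \<in> carrier_mat 2 2"
        obtain \<beta> where "\<Lambda> t1 (X - (mtrace X / 2) \<cdot>\<^sub>m 1\<^sub>m 2 - \<beta> \<cdot>\<^sub>m X0) = 0\<^sub>m 2 2"
          using range_at_singular_time[OF t1(1,3,4) X0c X0(2) X01 X] by blast
        then have "\<Lambda> s (X - (mtrace X / 2) \<cdot>\<^sub>m 1\<^sub>m 2 - \<beta> \<cdot>\<^sub>m X0) = 0\<^sub>m 2 2"
          using X0c by (intro kernel_mono[OF t1(1,2)]) (auto simp: minus_carrier_mat)
        then show "\<exists>\<beta>. \<Lambda> s (X - (mtrace X / 2) \<cdot>\<^sub>m 1\<^sub>m 2 - \<beta> \<cdot>\<^sub>m X0) = 0\<^sub>m 2 2" by blast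
      qed
    qed
  qed
qed

end

theorem theorem2:
  fixes d :: nat and \<Lambda> :: "real \<Rightarrow> complex mat \<Rightarrow> complex mat"
  assumes "d \<ge> 2"
    and "\<And>t. t \<ge> 0 \<Longrightarrow> CPTP d (\<Lambda> t)"
    and "\<And>X. X \<in> carrier_mat d d \<Longrightarrow> \<Lambda> 0 X = X"
    and "\<And>t X i j. t \<ge> 0 \<Longrightarrow> X \<in> carrier_mat d d \<Longrightarrow> i < d \<Longrightarrow> j < d \<Longrightarrow>
           (\<lambda>s. \<Lambda> s X $$ (i,j)) differentiable (at t within {0..})"
    and "\<not> markovian d \<Lambda>"
    and "(\<forall>t\<ge>0. bij_betw (\<Lambda> t) (carrier_mat d d) (carrier_mat d d)) \<or> d = 2"
  shows "\<exists>dB dC \<rho> t D. dB > 0 \<and> dC > 0 \<and> density (d*dB*dC) \<rho> \<and> t > 0 \<and> D > 0 \<and>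
           ((\<lambda>s. negativity (d*dB) dC (ampl (\<Lambda> s) d (dB*dC) \<rho>))
              has_real_derivative D) (at_right t)"
proof (rule ccontr)
  assume no: "\<not> ?thesis"
  have d: "d > 0" using assms(1) by simp
  have contr: "trace_norm (ampl (\<Lambda> t) d m X) \<le> trace_norm (ampl (\<Lambda> s) d m X)"
    if "0 < s" "s \<le> t" "m > 0" "herm (d*m) X" for s t m X
    by (rule trace_norm_antimono_if_no_increase[OF d assms(2) assms(4) no that])
  have "\<exists>V. CPTP d V \<and> (\<forall>X \<in> carrier_mat d d. \<Lambda> t X = V (\<Lambda> s X))" if st: "0 \<le> s" "s \<le> t" for s t
    using assms(6)
  proof
    assume bij: "\<forall>t\<ge>0. bij_betw (\<Lambda> t) (carrier_mat d d) (carrier_mat d d)"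
    show ?thesis
    proof (cases "s = 0")
      case True
      \<comment> \<open>Contraction is known from positive times on; from time 0 the factor is
        \<open>\<Lambda> t\<close> itself, as \<open>\<Lambda> 0\<close> is the identity.\<close>
      then show ?thesis using assms(2)[of t] assms(3) st by auto
    next
      case False
      then have "0 < s" using st by simp
      then show ?thesis
        using bij st assms(2) contr by (intro CPTP_factor_of_bij) auto
    qed
  next
    assume d2: "d = 2"
    interpret contractive_qubit_evolution \<Lambda>
    proof
      show "CPTP 2 (\<Lambda> t)" if "t \<ge> 0" for t using assms(2)[OF that] d2 by simp
      show "\<Lambda> 0 X = X" if "X \<in> carrier_mat 2 2" for X using assms(3) that d2 by simp
      show "continuous (at t within {0..}) (\<lambda>s. \<Lambda> s X $$ (i,j))"
        if "t \<ge> 0" "X \<in> carrier_mat 2 2" "i < 2" "j < 2" for t X i j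
        using assms(4)[of t X i j] that d2 by (auto simp: differentiable_def intro: has_derivative_continuous)
      show "trace_norm (ampl (\<Lambda> t) 2 m X) \<le> trace_norm (ampl (\<Lambda> s) 2 m X)"
        if "0 < s" "s \<le> t" "m > 0" "herm (2*m) X" for s t m X
        using contr[of s t m X] that d2 by simp
    qed
    show ?thesis using divisible[OF st] d2 by simp
  qed
  then have "markovian d \<Lambda>" unfolding markovian_def by blast
  then show False using assms(5) by simp
qed


end
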